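(* Let $n$ be an odd number. A manifold $M$ is an $n$-dimensional CHW manifold (that is, of complex dimension $n$) if and only if there exist: - elliptic curves $E_1,\ldots,E_n$ (over $\mathbb{C}$); - non-zero 2-torsion points $t_i\in E_i$, $i=1,2,\ldots,n$ (each $t_i$ is also regarded as the element of $\bigoplus_{k=1}^n E_k$ whose $i$-th entry is $t_i$ and whose other entries are $0$); - a subgroup $W\subset\langle t_1,\ldots,t_n\rangle\subset\bigoplus_{i=1}^nE_i$ such that $t_i\notin W$ for $i=1,2,\ldots,n$; - for each $i=1,\ldots,n$ an element $(x_i^1,\ldots,x_i^i,\ldots,x_i^n)\in\bigoplus_{k=1}^nE_k$, where $x_i^i$ is a non-zero 2-torsion point and $x_i^i\neq t_i$; which satisfy the following conditions: (i) for all $i\ne j$ the element $x_{ij}=(x_{ij}^1,\ldots,x_{ij}^n)$ belongs to $W$, where $x_{ij}^k=0$ if $k=i$ or $k=j$, and $x_{ij}^k=2(x_i^k-x_j^k)$ if $k\notin\{i,j\}$; (ii) for every proper subset $I=\{i_1<i_2<\ldots<i_m\}\subsetneq\{1,2,\ldots,n\}$ with $m$ odd and every $(y_1,\ldots,y_n)\in W$ there exists $j\in I$ such that $x_I^j\ne y_j$; (iii) for every $j\in\{1,2,\ldots,n\}$ the equality $x_n^j=x^j_{\{1,2,\ldots,n-1\}}$ holds; and for which $M$ is of the form $$M=(E_1\oplus E_2\oplus\cdots\oplus E_n)/\hat G,$$ where $\hat G=\langle \hat f_i,\,t_w : 1\le i\le n,\ w\in W\rangle$, the maps $\hat f_i$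 are given by $$\hat f_i(z_1,\ldots,z_n)=(-z_1+x_i^1,\ldots,-z_{i-1}+x_i^{i-1},\,z_i+x_i^i,\,-z_{i+1}+x_i^{i+1},\ldots,-z_n+x_i^n),$$ and $t_w$ is the translation of $\bigoplus_{i=1}^nE_i$ by $w$. Here, for a subset $I=\{i_1<\ldots<i_m\}\subset\{1,\ldots,n\}$ and $j\in\{1,\ldots,n\}$, $$x_I^j=\begin{cases}\sum_{k=1}^m(-1)^{k-1}x_{i_k}^j & j\notin I,\\ \sum_{k=1}^p(-1)^{k-1}x_{i_k}^j-\sum_{k=p+1}^m(-1)^{k-1}x_{i_k}^j & j=i_p\in I.\end{cases}$$
   Context: A flat manifold is a compact Riemannian manifold with vanishing Riemann curvature tensor. A flat Kähler manifold of complex dimension $n$ is a quotient $\mathbb{C}^n/\Gamma$ with $\Gamma$ a discrete, cocompact, torsion-free subgroup of $U(n)\ltimes\mathbb{C}^n$. A complex Hantzsche-Wendt manifold (CHW manifold) of complex dimension $n$ is a flat Kähler manifold of complex dimension $n$ whose holonomy group is isomorphic to $\mathbb{Z}_2^{n-1}$ and is contained in $SU(n)$.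
   Formalization: The case n = 1 is excluded: there an elliptic curve is a CHW manifold, but condition (iii) would force x_1^1 = 0 (empty sum), contradicting that x_1^1 is a non-zero 2-torsion point, so the stated equivalence fails. *)

theory Defs
  imports
    "HOL-Analysis.Analysis"
    "HOL-Algebra.FiniteProduct"
    "HOL-Algebra.Elementary_Groups"
    "HOL-Algebra.Product_Groups"
    "HOL-Algebra.Generated_Groups"
    "HOL-Algebra.Group_Action"
    "HOL-Algebra.Bij"
begin

section \<open>Complex manifolds\<close>

text \<open>A map on an open subset of complex n-space is holomorphic if at every point it has a
  (real Frechet) derivative that is complex linear.\<close>

definition holomorphic_vec_on ::
    "(complex ^ 'n::finite \<Rightarrow> complex ^ 'm::finite) \<Rightarrow> (complex ^ 'n) set \<Rightarrow> bool" where
  "holomorphic_vec_on f S \<longleftrightarrow>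
     (\<forall>z\<in>S. \<exists>D. (f has_derivative D) (at z) \<and> (\<forall>c v. D (c *s v) = c *s D v))"

record ('a, 'n) charted_space =
  ctop :: "'a topology"
  charts :: "('a set \<times> ('a \<Rightarrow> complex ^ 'n)) set"

definition complex_manifold :: "('a, 'n::finite) charted_space \<Rightarrow> bool" where
  "complex_manifold M \<longleftrightarrow>
     Hausdorff_space (ctop M) \<and> second_countable (ctop M) \<and>
     topspace (ctop M) = (\<Union>(U, \<phi>)\<in>charts M. U) \<and>
     (\<forall>(U, \<phi>)\<in>charts M. openin (ctop M) U \<and> open (\<phi> ` U) \<and>
        homeomorphic_map (subtopology (ctop M) U) (top_of_set (\<phi> ` U)) \<phi>) \<and>
     (\<forall>(U, \<phi>)\<in>charts M. \<forall>(V, \<psi>)\<in>charts M.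
        holomorphic_vec_on (\<psi> \<circ> inv_into U \<phi>) (\<phi> ` (U \<inter> V)))"

definition holomorphic_map ::
    "('a, 'n::finite) charted_space \<Rightarrow> ('b, 'm::finite) charted_space \<Rightarrow> ('a \<Rightarrow> 'b) \<Rightarrow> bool" where
  "holomorphic_map M N f \<longleftrightarrow>
     continuous_map (ctop M) (ctop N) f \<and>
     (\<forall>(U, \<phi>)\<in>charts M. \<forall>(V, \<psi>)\<in>charts N.
        holomorphic_vec_on (\<psi> \<circ> f \<circ> inv_into U \<phi>) (\<phi> ` {x \<in> U. f x \<in> V}))"

definition biholomorphic ::
    "('a, 'n::finite) charted_space \<Rightarrow> ('b, 'n) charted_space \<Rightarrow> bool" where
  "biholomorphic M N \<longleftrightarrow>
     (\<exists>f g. homeomorphic_maps (ctop M) (ctop N) f g \<and>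
            holomorphic_map M N f \<and> holomorphic_map N M g)"

definition complex_space :: "(complex ^ 'n, 'n::finite) charted_space" where
  "complex_space = \<lparr>ctop = euclidean, charts = {(UNIV, id)}\<rparr>"

definition quot_topology :: "'a topology \<Rightarrow> ('a \<Rightarrow> 'b) \<Rightarrow> 'b topology" where
  "quot_topology X p =
     topology (\<lambda>V. V \<subseteq> p ` topspace X \<and> openin X {x \<in> topspace X. p x \<in> V})"

lemma openin_quot_topology:
  "openin (quot_topology X p) V \<longleftrightarrow> V \<subseteq> p ` topspace X \<and> openin X {x \<in> topspace X. p x \<in> V}"
proof -
  have "istopology (\<lambda>V. V \<subseteq> p ` topspace X \<and> openin X {x \<in> topspace X. p x \<in> V})"
    unfolding istopology_def
  proof (intro conjI allI impI)
    fix S T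
    assume *: "S \<subseteq> p ` topspace X \<and> openin X {x \<in> topspace X. p x \<in> S}"
      "T \<subseteq> p ` topspace X \<and> openin X {x \<in> topspace X. p x \<in> T}"
    show "S \<inter> T \<subseteq> p ` topspace X" using * by blast
    have "{x \<in> topspace X. p x \<in> S \<inter> T} =
        {x \<in> topspace X. p x \<in> S} \<inter> {x \<in> topspace X. p x \<in> T}" by blast
    then show "openin X {x \<in> topspace X. p x \<in> S \<inter> T}" using * by (simp add: openin_Int)
  next
    fix \<K>
    assume *: "\<forall>K\<in>\<K>. K \<subseteq> p ` topspace X \<and> openin X {x \<in> topspace X. p x \<in> K}"
    show "\<Union>\<K> \<subseteq> p ` topspace X" using * by blast
    have "{x \<in> topspace X. p x \<in> \<Union>\<K>} = (\<Union>K\<in>\<K>. {x \<in> topspace X. p x \<in> K})" by blast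
    then show "openin X {x \<in> topspace X. p x \<in> \<Union>\<K>}" using * by auto
  qed
  then show ?thesis
    unfolding quot_topology_def by (simp add: topology_inverse')
qed

text \<open>The quotient of a charted space by the fibres of \<open>p\<close> (in the uses below: by the orbits of a
  group). Its charts are the local inverses of \<open>p\<close>, on open sets where \<open>p\<close> is injective,
  followed by a chart of \<open>M\<close>; they cover the quotient when the group acts freely and
  properly discontinuously.\<close>

definition quotient_manifold ::
    "('a, 'n::finite) charted_space \<Rightarrow> ('a \<Rightarrow> 'b) \<Rightarrow> ('b, 'n) charted_space" where
  "quotient_manifold M p =
     \<lparr>ctop = quot_topology (ctop M) p,
      charts = {(p ` U, \<phi> \<circ> inv_into U p) | U \<phi>.
                  \<exists>V. (V, \<phi>) \<in> charts M \<and> U \<subseteq> V \<and> openin (ctop M) U \<and> inj_on p U}\<rparr>"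


section \<open>Flat Kaehler manifolds and complex Hantzsche-Wendt manifolds\<close>

definition unitary :: "complex ^ 'n ^ 'n::finite \<Rightarrow> bool" where
  "unitary A \<longleftrightarrow> A ** transpose (\<chi> i j. cnj (A $ i $ j)) = mat 1"

definition unitary_group :: "(complex ^ 'n ^ 'n::finite) monoid" where
  "unitary_group = \<lparr>carrier = {A. unitary A}, monoid.mult = (**), one = mat 1\<rparr>"

text \<open>The semidirect product of \<open>U(n)\<close> and complex n-space; the pair \<open>(A, v)\<close> stands for the map
  \<open>z \<mapsto> A z + v\<close>.\<close>

definition unitary_affine_group :: "((complex ^ 'n ^ 'n::finite) \<times> (complex ^ 'n)) monoid" where
  "unitary_affine_group =
     \<lparr>carrier = {(A, v). unitary A},
      monoid.mult = (\<lambda>(A, v) (B, w). (A ** B, A *v w + v)),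
      one = (mat 1, 0)\<rparr>"

definition affine_act ::
    "(complex ^ 'n ^ 'n::finite) \<times> (complex ^ 'n) \<Rightarrow> complex ^ 'n \<Rightarrow> complex ^ 'n" where
  "affine_act = (\<lambda>(A, v) z. A *v z + v)"

definition flat_quotient ::
    "((complex ^ 'n ^ 'n::finite) \<times> (complex ^ 'n)) set \<Rightarrow> ((complex ^ 'n) set, 'n) charted_space" where
  "flat_quotient \<Gamma> =
     quotient_manifold complex_space (orbit (unitary_affine_group\<lparr>carrier := \<Gamma>\<rparr>) affine_act)"

definition flat_kaehler_group :: "((complex ^ 'n ^ 'n::finite) \<times> (complex ^ 'n)) set \<Rightarrow> bool" where
  "flat_kaehler_group \<Gamma> \<longleftrightarrow>
     subgroup \<Gamma> unitary_affine_group \<and>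
     discrete \<Gamma> \<and>
     compact_space (ctop (flat_quotient \<Gamma>)) \<and>
     (\<forall>\<gamma>\<in>\<Gamma>. \<forall>k::nat. \<gamma> \<noteq> \<one>\<^bsub>unitary_affine_group\<^esub> \<and> k > 0 \<longrightarrow>
        \<gamma> [^]\<^bsub>unitary_affine_group\<^esub> k \<noteq> \<one>\<^bsub>unitary_affine_group\<^esub>)"

text \<open>The holonomy group of the flat manifold defined by \<open>\<Gamma>\<close> is the group of linear parts.\<close>

definition holonomy_group ::
    "((complex ^ 'n ^ 'n::finite) \<times> (complex ^ 'n)) set \<Rightarrow> (complex ^ 'n ^ 'n) monoid" where
  "holonomy_group \<Gamma> = unitary_group\<lparr>carrier := fst ` \<Gamma>\<rparr>"

definition chw_manifold :: "('a, 'n::finite) charted_space \<Rightarrow> bool" where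
  "chw_manifold M \<longleftrightarrow>
     (\<exists>\<Gamma> :: ((complex ^ 'n ^ 'n) \<times> (complex ^ 'n)) set.
        flat_kaehler_group \<Gamma> \<and>
        holonomy_group \<Gamma> \<cong> product_group {..<CARD('n) - 1} (\<lambda>_. integer_mod_group 2) \<and>
        (\<forall>A \<in> carrier (holonomy_group \<Gamma>). det A = 1) \<and>
        biholomorphic M (flat_quotient \<Gamma>))"


section \<open>Products of elliptic curves\<close>

definition is_lattice :: "complex set \<Rightarrow> bool" where
  "is_lattice \<Lambda> \<longleftrightarrow>
     (\<exists>\<omega>\<^sub>1 \<omega>\<^sub>2. \<omega>\<^sub>1 \<noteq> \<omega>\<^sub>2 \<and> independent {\<omega>\<^sub>1, \<omega>\<^sub>2} \<and>
        \<Lambda> = {of_int a * \<omega>\<^sub>1 + of_int b * \<omega>\<^sub>2 | a b. True})"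

definition complex_group :: "complex monoid" where
  "complex_group = \<lparr>carrier = UNIV, monoid.mult = (+), one = 0\<rparr>"

text \<open>The group law of an elliptic curve is an addition in the mathematics; here it is written with
  the multiplicative notation of HOL-Algebra, so that \<open>\<one>\<close> is the zero point, \<open>inv\<close> is negation
  and \<open>[^]\<close> is taking integer multiples.\<close>

definition elliptic_curve :: "complex set \<Rightarrow> complex set monoid" where
  "elliptic_curve \<Lambda> = complex_group Mod \<Lambda>"

definition curve_sum :: "('n \<Rightarrow> complex set) \<Rightarrow> ('n \<Rightarrow> complex set) monoid" where
  "curve_sum \<Lambda> = product_group UNIV (\<lambda>k. elliptic_curve (\<Lambda> k))"

text \<open>The complex structure of the direct sum of the curves, as the quotient of complex n-space by
  the product of the lattices.\<close>

definition curve_sum_manifold ::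
    "('n::finite \<Rightarrow> complex set) \<Rightarrow> ('n \<Rightarrow> complex set, 'n) charted_space" where
  "curve_sum_manifold \<Lambda> =
     quotient_manifold complex_space (\<lambda>z k. \<Lambda> k #>\<^bsub>complex_group\<^esub> (z $ k))"

definition nonzero_2_torsion :: "'a monoid \<Rightarrow> 'a \<Rightarrow> bool" where
  "nonzero_2_torsion G t \<longleftrightarrow> t \<in> carrier G \<and> t \<noteq> \<one>\<^bsub>G\<^esub> \<and> t [^]\<^bsub>G\<^esub> (2::nat) = \<one>\<^bsub>G\<^esub>"

definition axis_point :: "('n \<Rightarrow> complex set) \<Rightarrow> 'n \<Rightarrow> complex set \<Rightarrow> ('n \<Rightarrow> complex set)" where
  "axis_point \<Lambda> i s = (\<lambda>k. if k = i then s else \<one>\<^bsub>elliptic_curve (\<Lambda> k)\<^esub>)"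

text \<open>In the following \<open>x i k\<close> is the k-th entry of the i-th element, that is, the lower index
  comes first.\<close>

definition x_pair ::
    "('n \<Rightarrow> complex set) \<Rightarrow> ('n \<Rightarrow> 'n \<Rightarrow> complex set) \<Rightarrow> 'n \<Rightarrow> 'n \<Rightarrow> ('n \<Rightarrow> complex set)" where
  "x_pair \<Lambda> x i j = (\<lambda>k.
     if k = i \<or> k = j then \<one>\<^bsub>elliptic_curve (\<Lambda> k)\<^esub>
     else (x i k \<otimes>\<^bsub>elliptic_curve (\<Lambda> k)\<^esub> inv\<^bsub>elliptic_curve (\<Lambda> k)\<^esub> x j k)
            [^]\<^bsub>elliptic_curve (\<Lambda> k)\<^esub> (2::nat))"

text \<open>If \<open>I\<close> is \<open>{i\<^sub>1 < \<dots> < i\<^sub>m}\<close> and \<open>i = i\<^sub>k\<close>, then \<open>k - 1\<close> is the number of elements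
  of \<open>I\<close> below \<open>i\<close>.\<close>

definition alt_sign :: "'n::{finite,linorder} set \<Rightarrow> 'n \<Rightarrow> int" where
  "alt_sign I i = (-1) ^ card {l \<in> I. l < i}"

definition x_set ::
    "('n::{finite,linorder} \<Rightarrow> complex set) \<Rightarrow> ('n \<Rightarrow> 'n \<Rightarrow> complex set) \<Rightarrow> 'n set \<Rightarrow> 'n \<Rightarrow> complex set"
  where
  "x_set \<Lambda> x I j = (let E = elliptic_curve (\<Lambda> j) in
     if j \<notin> I then finprod E (\<lambda>i. x i j [^]\<^bsub>E\<^esub> alt_sign I i) I
     else finprod E (\<lambda>i. x i j [^]\<^bsub>E\<^esub> alt_sign I i) {i \<in> I. i \<le> j}
            \<otimes>\<^bsub>E\<^esub> inv\<^bsub>E\<^esub> finprod E (\<lambda>i. x i j [^]\<^bsub>E\<^esub> alt_sign I i) {i \<in> I. j < i})"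

definition f_hat ::
    "('n \<Rightarrow> complex set) \<Rightarrow> ('n \<Rightarrow> 'n \<Rightarrow> complex set) \<Rightarrow> 'n \<Rightarrow> ('n \<Rightarrow> complex set) \<Rightarrow> ('n \<Rightarrow> complex set)"
  where
  "f_hat \<Lambda> x i = (\<lambda>z \<in> carrier (curve_sum \<Lambda>). \<lambda>k.
     (if k = i then z k else inv\<^bsub>elliptic_curve (\<Lambda> k)\<^esub> z k) \<otimes>\<^bsub>elliptic_curve (\<Lambda> k)\<^esub> x i k)"

definition translation ::
    "('n \<Rightarrow> complex set) \<Rightarrow> ('n \<Rightarrow> complex set) \<Rightarrow> ('n \<Rightarrow> complex set) \<Rightarrow> ('n \<Rightarrow> complex set)" where
  "translation \<Lambda> w = (\<lambda>z \<in> carrier (curve_sum \<Lambda>). z \<otimes>\<^bsub>curve_sum \<Lambda>\<^esub> w)"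

definition G_hat ::
    "('n \<Rightarrow> complex set) \<Rightarrow> ('n \<Rightarrow> 'n \<Rightarrow> complex set) \<Rightarrow> ('n \<Rightarrow> complex set) set \<Rightarrow>
     (('n \<Rightarrow> complex set) \<Rightarrow> ('n \<Rightarrow> complex set)) set" where
  "G_hat \<Lambda> x W =
     generate (BijGroup (carrier (curve_sum \<Lambda>))) (range (f_hat \<Lambda> x) \<union> translation \<Lambda> ` W)"

definition curve_sum_quotient ::
    "('n::finite \<Rightarrow> complex set) \<Rightarrow> ('n \<Rightarrow> 'n \<Rightarrow> complex set) \<Rightarrow> ('n \<Rightarrow> complex set) set \<Rightarrow>
     (('n \<Rightarrow> complex set) set, 'n) charted_space" where
  "curve_sum_quotient \<Lambda> x W =
     quotient_manifold (curve_sum_manifold \<Lambda>)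
       (orbit ((BijGroup (carrier (curve_sum \<Lambda>)))\<lparr>carrier := G_hat \<Lambda> x W\<rparr>) (\<lambda>g. g))"

end

theory Submission
  imports Defs
begin

text \<open>The holonomy of a CHW manifold consists of commuting involutions, so after a linear change of
  coordinates it is the group of all diagonal sign matrices of determinant \<open>1\<close>, there being just
  \<open>2 ^ (n - 1)\<close> of them. As \<open>n\<close> is odd, it is generated by the matrices \<open>g i\<close> with \<open>1\<close> in position \<open>i\<close>
  and \<open>-1\<close> elsewhere. Let \<open>z \<mapsto> g i z + b i\<close> be elements of the group and \<open>L\<close> its lattice of
  translations, and let \<open>\<Lambda> i\<close> be the intersection of \<open>L\<close> with the \<open>i\<close>-th axis. For \<open>v \<in> L\<close> the vector
  \<open>v + g i v\<close> is twice the \<open>i\<close>-th component of \<open>v\<close>, so the projection of \<open>L\<close> to the axis lies between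
  \<open>\<Lambda> i\<close> and its half. It avoids the \<open>i\<close>-th component of \<open>b i\<close>, which is also half a period, because
  there is no torsion. This leaves room for a single nonzero class \<open>t i\<close>, and \<open>W\<close> is the image of \<open>L\<close>
  in the sum of the curves.

  Composing the generators over an odd set \<open>I\<close> in increasing order gives the linear part which is \<open>1\<close> on
  the axes in \<open>I\<close> and \<open>-1\<close> on the others, with translational part the element with index \<open>I\<close> of
  condition (ii). Up to \<open>L\<close> every group element is of this form, and it is torsion precisely when it is not
  the identity and its translational part vanishes on the axes in \<open>I\<close>; so (ii) says that the group is
  torsion-free. Condition (i) says that the generators commute up to \<open>L\<close>, and (iii) that their product is
  a translation in \<open>L\<close>.

  Both manifolds are then quotients of complex n-space with the same orbits up to a linear
  isomorphism, and their charts are local sections of the orbit maps, which makes them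
  biholomorphic.\<close>

section \<open>Holomorphic maps between charted spaces\<close>

text \<open>The maps generating \<open>G_hat\<close> act on the sum of the curves, and their lifts
  to complex n-space are determined only up to the product of the curve lattices. What is carried
  over between the two sides is therefore the orbit relation \<open>rel\<close> on complex n-space,
  in which all composition rules hold modulo a lattice. The atlas of a quotient consists of whatever
  local inverses exist, so it is of use only where the orbit map is locally injective. On the flat
  side this follows from torsion-freeness and a finite holonomy of involutions; it passes to the
  quotient of the curves along the common orbits. The change of coordinates need not be unitary,
  since a complex linear isomorphism is already biholomorphic. That every sign matrix occurs is a
  matter of counting: the holonomy is known only up to isomorphism, and the same target group is
  isomorphic to the full group of sign matrices. Dimension one is excluded because there the
  holonomy is trivial and every elliptic curve is a CHW manifold, whereas (iii) equates the only
  \<open>x i i\<close> with an empty sum although it has to be nonzero.\<close>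

lemma holomorphic_vec_on_continuous:
  assumes "holomorphic_vec_on f UNIV"
  shows "continuous_on UNIV f"
  using assms unfolding holomorphic_vec_on_def
  by (meson continuous_at_imp_continuous_on has_derivative_continuous)

lemma holomorphic_vec_on_compose:
  assumes "holomorphic_vec_on f UNIV" "holomorphic_vec_on g UNIV"
  shows "holomorphic_vec_on (\<lambda>z. g (f z)) UNIV"
  unfolding holomorphic_vec_on_def
proof
  fix z
  obtain D E where "(f has_derivative D) (at z)" "\<And>c v. D (c *s v) = c *s D v"
    "(g has_derivative E) (at (f z))" "\<And>c v. E (c *s v) = c *s E v"
    using assms unfolding holomorphic_vec_on_def by blast
  then show "\<exists>D. ((\<lambda>z. g (f z)) has_derivative D) (at z) \<and> (\<forall>c v. D (c *s v) = c *s D v)"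
    by (intro exI[of _ "\<lambda>v. E (D v)"]) (simp add: has_derivative_compose)
qed

text \<open>What composing holomorphic maps takes from an atlas: charts that cover and are injective
  and open. Complex manifolds have it by definition and the quotients below by their construction,
  so one composition lemma serves both.\<close>

definition section_atlas :: "('a, 'n::finite) charted_space \<Rightarrow> bool" where
  "section_atlas M \<longleftrightarrow>
     topspace (ctop M) \<subseteq> (\<Union>(U, \<phi>)\<in>charts M. U) \<and>
     (\<forall>(U, \<phi>)\<in>charts M. openin (ctop M) U \<and> inj_on \<phi> U \<and>
        (\<forall>O'. openin (ctop M) O' \<longrightarrow> O' \<subseteq> U \<longrightarrow> open (\<phi> ` O')))"

lemma complex_manifold_section_atlas:
  assumes "complex_manifold M"
  shows "section_atlas M"
  unfolding section_atlas_def
proof (intro conjI ballI, goal_cases)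
  case 1
  then show ?case using assms unfolding complex_manifold_def by auto
next
  case (2 c)
  obtain U \<phi> where c: "c = (U, \<phi>)" by (cases c)
  have U: "openin (ctop M) U" "open (\<phi> ` U)"
    and h: "homeomorphic_map (subtopology (ctop M) U) (top_of_set (\<phi> ` U)) \<phi>"
    using assms 2 c unfolding complex_manifold_def by auto
  have sub: "U \<subseteq> topspace (ctop M)" using U openin_subset by blast
  have "inj_on \<phi> U"
    using homeomorphic_imp_injective_map[OF h] sub by (simp add: Int_absorb1)
  moreover have "open (\<phi> ` O')" if "openin (ctop M) O'" "O' \<subseteq> U" for O'
  proof -
    have "openin (subtopology (ctop M) U) O'"
      using that by (simp add: openin_open_subtopology U(1))
    then have "openin (top_of_set (\<phi> ` U)) (\<phi> ` O')"
      using homeomorphic_imp_open_map[OF h] by (simp add: open_map_def)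
    then show ?thesis using U(2) by (simp add: openin_open_eq)
  qed
  ultimately show ?case unfolding c prod.case using U by blast
qed

lemma holomorphic_mapD:
  assumes "holomorphic_map M N f" "(U, \<phi>) \<in> charts M" "(V, \<psi>) \<in> charts N"
    and "x \<in> U" "f x \<in> V"
  shows "\<exists>D. ((\<psi> \<circ> f \<circ> inv_into U \<phi>) has_derivative D) (at (\<phi> x)) \<and>
    (\<forall>c v. D (c *s v) = c *s D v)"
proof -
  have "holomorphic_vec_on (\<psi> \<circ> f \<circ> inv_into U \<phi>) (\<phi> ` {x \<in> U. f x \<in> V})"
    using assms(1-3) unfolding holomorphic_map_def by auto
  moreover have "\<phi> x \<in> \<phi> ` {x \<in> U. f x \<in> V}" using assms(4,5) by blast
  ultimately show ?thesis unfolding holomorphic_vec_on_def by (rule bspec)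
qed

text \<open>The intermediate chart depends on the point: some chart of \<open>N\<close> around the
  image point is chosen, and the chain rule applies on the open set of coordinates whose points it
  can receive. Differentiability is local, so this is enough.\<close>

lemma holomorphic_map_compose:
  assumes atM: "section_atlas M" and atN: "section_atlas N"
    and f: "holomorphic_map M N f" and g: "holomorphic_map N P g"
  shows "holomorphic_map M P (g \<circ> f)"
  unfolding holomorphic_map_def
proof (intro conjI ballI, goal_cases)
  case 1
  show ?case using f g unfolding holomorphic_map_def by (blast intro: continuous_map_compose)
next
  case (2 c)
  obtain U \<phi> where c: "c = (U, \<phi>)" by (cases c)
  note U = 2[unfolded c]
  have cf: "continuous_map (ctop M) (ctop N) f" using f unfolding holomorphic_map_def by blast
  have Uo: "openin (ctop M) U" and inj: "inj_on \<phi> U"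
    and op: "\<And>O'. openin (ctop M) O' \<Longrightarrow> O' \<subseteq> U \<Longrightarrow> open (\<phi> ` O')"
    using atM U unfolding section_atlas_def by fast+
  show ?case unfolding c prod.case
  proof (rule ballI, clarify)
    fix W \<theta> assume W: "(W, \<theta>) \<in> charts P"
    show "holomorphic_vec_on (\<theta> \<circ> (g \<circ> f) \<circ> inv_into U \<phi>) (\<phi> ` {x \<in> U. (g \<circ> f) x \<in> W})"
      unfolding holomorphic_vec_on_def
    proof
      fix z assume "z \<in> \<phi> ` {x \<in> U. (g \<circ> f) x \<in> W}"
      then obtain x where x: "x \<in> U" "g (f x) \<in> W" "z = \<phi> x" by auto
      have "f x \<in> topspace (ctop N)"
        using cf Uo x(1) openin_subset by (fastforce simp: continuous_map_def)
      then obtain V \<psi> where V: "(V, \<psi>) \<in> charts N" "f x \<in> V"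
        using atN unfolding section_atlas_def by blast
      have Vo: "openin (ctop N) V" and injV: "inj_on \<psi> V"
        using atN V unfolding section_atlas_def by fast+
      define S where "S = {x \<in> U. f x \<in> V}"
      have "openin (ctop M) S"
      proof -
        have "S = U \<inter> {x \<in> topspace (ctop M). f x \<in> V}"
          using Uo openin_subset unfolding S_def by blast
        then show ?thesis using Uo Vo cf by (simp add: openin_Int openin_continuous_map_preimage)
      qed
      then have oS: "open (\<phi> ` S)" using op S_def by blast
      have zS: "z \<in> \<phi> ` S" using x V(2) unfolding S_def by blast
      let ?h1 = "\<psi> \<circ> f \<circ> inv_into U \<phi>" and ?h2 = "\<theta> \<circ> g \<circ> inv_into V \<psi>"
      have h1: "?h1 z = \<psi> (f x)" using x inj by simp
      obtain D where D: "(?h1 has_derivative D) (at z)" "\<And>c v. D (c *s v) = c *s D v"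
        using holomorphic_mapD[OF f U V(1) x(1) V(2)] unfolding x(3) by blast
      obtain E where E: "(?h2 has_derivative E) (at (?h1 z))" "\<And>c v. E (c *s v) = c *s E v"
        using holomorphic_mapD[OF g V(1) W V(2) x(2)] unfolding h1 by blast
      have "((\<lambda>z. ?h2 (?h1 z)) has_derivative (\<lambda>v. E (D v))) (at z)"
        using D(1) E(1) by (rule has_derivative_compose)
      then have "((\<theta> \<circ> (g \<circ> f) \<circ> inv_into U \<phi>) has_derivative (\<lambda>v. E (D v))) (at z)"
      proof (rule has_derivative_transform_within_open[OF _ oS zS])
        fix y assume "y \<in> \<phi> ` S"
        then obtain s where "s \<in> U" "f s \<in> V" "y = \<phi> s" unfolding S_def by auto
        then show "?h2 (?h1 y) = (\<theta> \<circ> (g \<circ> f) \<circ> inv_into U \<phi>) y"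
          using inj injV by simp
      qed
      then show "\<exists>D. ((\<theta> \<circ> (g \<circ> f) \<circ> inv_into U \<phi>) has_derivative D) (at z) \<and>
          (\<forall>c v. D (c *s v) = c *s D v)"
        using D(2) E(2) by (intro exI[of _ "\<lambda>v. E (D v)"]) simp
    qed
  qed
qed

lemma biholomorphic_trans:
  assumes "section_atlas M" "section_atlas N" "section_atlas P"
    and "biholomorphic M N" "biholomorphic N P"
  shows "biholomorphic M P"
proof -
  obtain f f' g g' where "homeomorphic_maps (ctop M) (ctop N) f f'"
      "holomorphic_map M N f" "holomorphic_map N M f'"
      "homeomorphic_maps (ctop N) (ctop P) g g'"
      "holomorphic_map N P g" "holomorphic_map P N g'"
    using assms(4,5) unfolding biholomorphic_def by blast
  then have "homeomorphic_maps (ctop M) (ctop P) (g \<circ> f) (f' \<circ> g')"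
    "holomorphic_map M P (g \<circ> f)" "holomorphic_map P M (f' \<circ> g')"
    using assms(1-3) by (blast intro: homeomorphic_maps_compose holomorphic_map_compose)+
  then show ?thesis unfolding biholomorphic_def by blast
qed

text \<open>The flat quotient and the quotient of the sum of the curves are both of this form, which makes
  them comparable although their points are of different types.\<close>

definition uniformized :: "(complex ^ 'n::finite \<Rightarrow> 'b) \<Rightarrow> ('b, 'n) charted_space \<Rightarrow> bool" where
  "uniformized p N \<longleftrightarrow>
     (\<forall>V. openin (ctop N) V \<longleftrightarrow> V \<subseteq> range p \<and> open (p -` V)) \<and>
     (\<forall>U. open U \<longrightarrow> open (p -` p ` U)) \<and>
     (\<forall>(C, \<phi>)\<in>charts N. \<exists>U. open U \<and> C = p ` U \<and> (\<forall>z\<in>U. \<phi> (p z) = z)) \<and>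
     (\<forall>z. \<exists>(C, \<phi>)\<in>charts N. p z \<in> C)"

lemma uniformized_openin:
  "uniformized p N \<Longrightarrow> openin (ctop N) V \<longleftrightarrow> V \<subseteq> range p \<and> open (p -` V)"
  unfolding uniformized_def by blast

lemma uniformized_chartE:
  assumes "uniformized p N" "(C, \<phi>) \<in> charts N"
  obtains U where "open U" "C = p ` U" "\<And>z. z \<in> U \<Longrightarrow> \<phi> (p z) = z"
proof -
  have "\<exists>U. open U \<and> C = p ` U \<and> (\<forall>z\<in>U. \<phi> (p z) = z)"
    using assms unfolding uniformized_def by fast
  then show thesis using that by blast
qed

lemma uniformized_topspace:
  assumes "uniformized p N"
  shows "topspace (ctop N) = range p"
proof
  show "topspace (ctop N) \<subseteq> range p"
    using assms openin_topspace unfolding uniformized_def by blast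
  have "openin (ctop N) (range p)"
    using assms unfolding uniformized_def by (simp add: vimage_def)
  then show "range p \<subseteq> topspace (ctop N)" by (rule openin_subset)
qed

lemma uniformized_section_atlas:
  assumes "uniformized p N"
  shows "section_atlas N"
  unfolding section_atlas_def
proof (intro conjI ballI, goal_cases)
  case 1
  show ?case
    using assms unfolding uniformized_topspace[OF assms] uniformized_def by blast
next
  case (2 c)
  obtain C \<phi> where c: "c = (C, \<phi>)" by (cases c)
  obtain U where U: "open U" "C = p ` U" "\<And>z. z \<in> U \<Longrightarrow> \<phi> (p z) = z"
    using uniformized_chartE[OF assms 2[unfolded c]] by metis
  have "openin (ctop N) C" using assms U unfolding uniformized_def by blast
  moreover have "inj_on \<phi> C" using U by (auto simp: inj_on_def)
  moreover have "open (\<phi> ` O')" if O': "openin (ctop N) O'" "O' \<subseteq> C" for O'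
  proof -
    \<comment> \<open>The chart inverts \<open>p\<close> on \<open>U\<close>, so the image of
      \<open>O'\<close> is the part of its open preimage that lies in \<open>U\<close>.\<close>
    have "\<phi> ` O' = U \<inter> p -` O'"
    proof
      show "\<phi> ` O' \<subseteq> U \<inter> p -` O'"
      proof
        fix y assume "y \<in> \<phi> ` O'"
        then obtain x where x: "x \<in> O'" "y = \<phi> x" by auto
        then obtain z where "z \<in> U" "x = p z" using O' U(2) by blast
        then show "y \<in> U \<inter> p -` O'" using x U(3) by simp
      qed
      show "U \<inter> p -` O' \<subseteq> \<phi> ` O'"
      proof
        fix z assume "z \<in> U \<inter> p -` O'"
        then show "z \<in> \<phi> ` O'" using U(3)[of z] by (metis IntE image_eqI vimageE)
      qed
    qed
    then show ?thesis using U(1) O' assms unfolding uniformized_def by auto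
  qed
  ultimately show ?case unfolding c prod.case by blast
qed

text \<open>The chart \<open>\<psi>\<close> inverts \<open>q\<close> on one sheet \<open>V\<close>,
  whereas \<open>h z\<close> may lie on another sheet over the same point. A deck transformation
  \<open>d\<close> carries \<open>h z\<close> into \<open>V\<close>, and near \<open>z\<close> the
  map read in charts is \<open>d\<close> after \<open>h\<close>.\<close>

lemma uniformized_holomorphic_map:
  fixes p :: "complex ^ 'n::finite \<Rightarrow> 'a" and q :: "complex ^ 'm::finite \<Rightarrow> 'b"
  assumes p: "uniformized p N" and q: "uniformized q N'"
    and h: "holomorphic_vec_on h UNIV" and f: "\<And>z. f (p z) = q (h z)"
    and deck: "\<And>z w. q z = q w \<Longrightarrow>
      \<exists>d. holomorphic_vec_on d UNIV \<and> d z = w \<and> (\<forall>u. q (d u) = q u)"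
  shows "holomorphic_map N N' f"
  unfolding holomorphic_map_def
proof (intro conjI ballI, goal_cases)
  case 1
  have "openin (ctop N) {x \<in> topspace (ctop N). f x \<in> V}" if "openin (ctop N') V" for V
  proof -
    have "open (q -` V)" using that uniformized_openin[OF q] by blast
    then have "open (h -` (q -` V))"
      using holomorphic_vec_on_continuous[OF h] by (simp add: continuous_on_open_vimage)
    moreover have "p -` {x \<in> range p. f x \<in> V} = h -` (q -` V)" using f by auto
    ultimately show ?thesis
      unfolding uniformized_topspace[OF p] uniformized_openin[OF p] by auto
  qed
  moreover have "f \<in> topspace (ctop N) \<rightarrow> topspace (ctop N')"
    using f by (auto simp: uniformized_topspace[OF p] uniformized_topspace[OF q])
  ultimately show ?case by (simp add: continuous_map_def)
next
  case (2 c)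
  obtain C \<phi> where c: "c = (C, \<phi>)" by (cases c)
  obtain U where U: "open U" "C = p ` U" "\<And>z. z \<in> U \<Longrightarrow> \<phi> (p z) = z"
    using uniformized_chartE[OF p 2[unfolded c]] by metis
  have inj: "inj_on \<phi> C" using U by (auto simp: inj_on_def)
  show ?case unfolding c prod.case
  proof (rule ballI, clarify)
    fix E \<psi> assume E: "(E, \<psi>) \<in> charts N'"
    show "holomorphic_vec_on (\<psi> \<circ> f \<circ> inv_into C \<phi>) (\<phi> ` {x \<in> C. f x \<in> E})"
      unfolding holomorphic_vec_on_def
    proof
      fix z assume "z \<in> \<phi> ` {x \<in> C. f x \<in> E}"
      then have z: "z \<in> U" "q (h z) \<in> E" using U f by auto
      obtain V where V: "open V" "E = q ` V" "\<And>z. z \<in> V \<Longrightarrow> \<psi> (q z) = z"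
        using uniformized_chartE[OF q E] by metis
      obtain w where w: "w \<in> V" "q (h z) = q w" using z V by auto
      obtain d where d: "holomorphic_vec_on d UNIV" "d (h z) = w" "\<And>u. q (d u) = q u"
        using deck[OF w(2)] by blast
      have hol: "holomorphic_vec_on (\<lambda>z. d (h z)) UNIV"
        using h d(1) by (rule holomorphic_vec_on_compose)
      then obtain D where D: "((\<lambda>z. d (h z)) has_derivative D) (at z)"
        "\<And>c v. D (c *s v) = c *s D v" unfolding holomorphic_vec_on_def by blast
      have o: "open (U \<inter> (\<lambda>z. d (h z)) -` V)"
        using U(1) V(1) holomorphic_vec_on_continuous[OF hol]
        by (simp add: continuous_on_open_vimage open_Int)
      have "((\<psi> \<circ> f \<circ> inv_into C \<phi>) has_derivative D) (at z)"
      proof (rule has_derivative_transform_within_open[OF D(1) o])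
        show "z \<in> U \<inter> (\<lambda>z. d (h z)) -` V" using z d w by simp
        fix y assume y: "y \<in> U \<inter> (\<lambda>z. d (h z)) -` V"
        then have "inv_into C \<phi> y = p y"
          using inj U by (metis IntD1 image_eqI inv_into_f_f)
        then show "d (h y) = (\<psi> \<circ> f \<circ> inv_into C \<phi>) y"
          using V(3)[of "d (h y)"] d(3)[of "h y"] y f by simp
      qed
      then show "\<exists>D. ((\<psi> \<circ> f \<circ> inv_into C \<phi>) has_derivative D) (at z) \<and>
          (\<forall>c v. D (c *s v) = c *s D v)" using D(2) by blast
    qed
  qed
qed

lemma biholomorphic_uniformized:
  fixes p :: "complex ^ 'n::finite \<Rightarrow> 'a" and q :: "complex ^ 'n \<Rightarrow> 'b"
  assumes p: "uniformized p N" and q: "uniformized q N'"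
    and h: "holomorphic_vec_on h UNIV" "holomorphic_vec_on h' UNIV"
      "\<And>z. h' (h z) = z" "\<And>z. h (h' z) = z"
    and fibres: "\<And>z w. p z = p w \<longleftrightarrow> q (h z) = q (h w)"
    and deck: "\<And>z w. p z = p w \<Longrightarrow>
      \<exists>d. holomorphic_vec_on d UNIV \<and> d z = w \<and> (\<forall>u. p (d u) = p u)"
  shows "biholomorphic N N'"
proof -
  \<comment> \<open>Any representative of the fibre will do, because \<open>h\<close> matches the
    fibres of \<open>p\<close> with those of \<open>q\<close>.\<close>
  define f where "f x = q (h (SOME z. p z = x))" for x
  define g where "g y = p (h' (SOME z. q z = y))" for y
  have f: "f (p z) = q (h z)" for z
    unfolding f_def using fibres by (metis (mono_tags, lifting) someI)
  have g: "g (q z) = p (h' z)" for z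
    unfolding g_def using fibres h(4) by (metis (mono_tags, lifting) someI)
  \<comment> \<open>Conjugation by \<open>h\<close> turns deck transformations of \<open>p\<close>
    into deck transformations of \<open>q\<close>.\<close>
  have deck': "\<exists>d. holomorphic_vec_on d UNIV \<and> d z = w \<and> (\<forall>u. q (d u) = q u)" if "q z = q w" for z w
  proof -
    have "p (h' z) = p (h' w)" using that fibres h(4) by simp
    then obtain d where d: "holomorphic_vec_on d UNIV" "d (h' z) = h' w" "\<And>u. p (d u) = p u"
      using deck by blast
    have "holomorphic_vec_on (\<lambda>u. h (d (h' u))) UNIV"
      by (rule holomorphic_vec_on_compose[OF holomorphic_vec_on_compose[OF h(2) d(1)] h(1)])
    moreover have "q (h (d (h' u))) = q u" for u
      using fibres[of "d (h' u)" "h' u"] d(3) h(4) by simp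
    ultimately show ?thesis using d(2) h(4)
      by (intro exI[of _ "\<lambda>u. h (d (h' u))"]) simp
  qed
  have hf: "holomorphic_map N N' f"
    by (rule uniformized_holomorphic_map[OF p q h(1) f deck'])
  have hg: "holomorphic_map N' N g"
    by (rule uniformized_holomorphic_map[OF q p h(2) g deck])
  have "homeomorphic_maps (ctop N) (ctop N') f g"
    using hf hg f g h unfolding homeomorphic_maps_def holomorphic_map_def
    by (auto simp: uniformized_topspace[OF p] uniformized_topspace[OF q])
  then show ?thesis using hf hg unfolding biholomorphic_def by blast
qed

section \<open>Elliptic curves\<close>

lemma complex_group_simps [simp]:
  "carrier complex_group = UNIV" "x \<otimes>\<^bsub>complex_group\<^esub> y = x + y" "\<one>\<^bsub>complex_group\<^esub> = 0"
  by (simp_all add: complex_group_def)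

lemma comm_group_complex_group: "comm_group complex_group"
proof (rule comm_groupI)
  show "\<exists>y\<in>carrier complex_group. y \<otimes>\<^bsub>complex_group\<^esub> x = \<one>\<^bsub>complex_group\<^esub>" for x
    by (simp add: exI[of _ "- x"])
qed (simp_all add: algebra_simps)

lemma inv_complex_group [simp]: "inv\<^bsub>complex_group\<^esub> x = - x"
proof -
  interpret comm_group complex_group by (rule comm_group_complex_group)
  show ?thesis by (rule inv_equality) simp_all
qed

lemma subgroup_complex_group_iff:
  "subgroup \<Lambda> complex_group \<longleftrightarrow>
     0 \<in> \<Lambda> \<and> (\<forall>x\<in>\<Lambda>. \<forall>y\<in>\<Lambda>. x + y \<in> \<Lambda>) \<and> (\<forall>x\<in>\<Lambda>. - x \<in> \<Lambda>)"
  by (auto simp: subgroup_def)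

lemma lattice_subgroup:
  assumes "is_lattice \<Lambda>"
  shows "subgroup \<Lambda> complex_group"
proof -
  obtain u v where L: "\<Lambda> = {of_int a * u + of_int b * v | a b. True}"
    using assms unfolding is_lattice_def by blast
  have "\<exists>c d. of_int a * u + of_int b * v + (of_int a' * u + of_int b' * v) =
      of_int c * u + of_int d * v" for a b a' b'
    by (rule exI[of _ "a + a'"], rule exI[of _ "b + b'"]) (simp add: algebra_simps)
  moreover have "\<exists>c d. - (of_int a * u + of_int b * v) = of_int c * u + of_int d * v" for a b
    by (rule exI[of _ "- a"], rule exI[of _ "- b"]) (simp add: algebra_simps)
  moreover have "\<exists>a b. 0 = of_int a * u + of_int b * v"
    by (rule exI[of _ 0], rule exI[of _ 0]) simp
  ultimately show ?thesis unfolding subgroup_complex_group_iff L by blast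
qed

abbreviation cls :: "complex set \<Rightarrow> complex \<Rightarrow> complex set" where
  "cls \<Lambda> a \<equiv> \<Lambda> #>\<^bsub>complex_group\<^esub> a"

text \<open>Only a subgroup is assumed: the intersections of a translation lattice with the axes are
  shown to be lattices with the help of computations that already take place in these
  quotients.\<close>

locale curve =
  fixes \<Lambda> :: "complex set"
  assumes sub: "subgroup \<Lambda> complex_group"
begin

lemma zero: "0 \<in> \<Lambda>" and add: "x \<in> \<Lambda> \<Longrightarrow> y \<in> \<Lambda> \<Longrightarrow> x + y \<in> \<Lambda>"
  and neg: "x \<in> \<Lambda> \<Longrightarrow> - x \<in> \<Lambda>"
  using sub unfolding subgroup_complex_group_iff by auto

lemma normal: "\<Lambda> \<lhd> complex_group"
  using comm_group.normal_iff_subgroup[OF comm_group_complex_group] sub by blast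

lemma comm_group_curve: "comm_group (elliptic_curve \<Lambda>)"
  unfolding elliptic_curve_def
  by (rule comm_group.abelian_FactGroup[OF comm_group_complex_group sub])

sublocale E: comm_group "elliptic_curve \<Lambda>" by (rule comm_group_curve)

lemma cls_eq_iff: "cls \<Lambda> a = cls \<Lambda> b \<longleftrightarrow> a - b \<in> \<Lambda>"
proof -
  have "cls \<Lambda> a = {z. z - a \<in> \<Lambda>}" for a
    by (force simp: r_coset_def algebra_simps)
  then have "cls \<Lambda> a = cls \<Lambda> b \<longleftrightarrow> (\<forall>z. z - a \<in> \<Lambda> \<longleftrightarrow> z - b \<in> \<Lambda>)" by auto
  also have "\<dots> \<longleftrightarrow> a - b \<in> \<Lambda>"
  proof
    assume "\<forall>z. z - a \<in> \<Lambda> \<longleftrightarrow> z - b \<in> \<Lambda>"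
    then show "a - b \<in> \<Lambda>" using zero by force
  next
    assume *: "a - b \<in> \<Lambda>"
    show "\<forall>z. z - a \<in> \<Lambda> \<longleftrightarrow> z - b \<in> \<Lambda>"
    proof (intro allI iffI)
      fix z
      show "z - b \<in> \<Lambda>" if "z - a \<in> \<Lambda>" using add[OF that *] by simp
      show "z - a \<in> \<Lambda>" if "z - b \<in> \<Lambda>" using add[OF that neg[OF *]] by simp
    qed
  qed
  finally show ?thesis .
qed

lemma carrier_curve: "carrier (elliptic_curve \<Lambda>) = range (cls \<Lambda>)"
  by (auto simp: elliptic_curve_def FactGroup_def RCOSETS_def)

lemma cls_closed [simp]: "cls \<Lambda> a \<in> carrier (elliptic_curve \<Lambda>)"
  by (simp add: carrier_curve)

lemma cls_mult [simp]: "cls \<Lambda> a \<otimes>\<^bsub>elliptic_curve \<Lambda>\<^esub> cls \<Lambda> b = cls \<Lambda> (a + b)"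
  using normal.rcos_sum[OF normal, of a b] by (simp add: elliptic_curve_def FactGroup_def)

lemma one_curve: "\<one>\<^bsub>elliptic_curve \<Lambda>\<^esub> = cls \<Lambda> 0"
  by (auto simp: elliptic_curve_def FactGroup_def r_coset_def)

lemma cls_inv [simp]: "inv\<^bsub>elliptic_curve \<Lambda>\<^esub> (cls \<Lambda> a) = cls \<Lambda> (- a)"
  by (rule E.inv_equality) (simp_all add: one_curve)

lemma cls_eq_one_iff [simp]: "cls \<Lambda> a = \<one>\<^bsub>elliptic_curve \<Lambda>\<^esub> \<longleftrightarrow> a \<in> \<Lambda>"
  by (simp add: one_curve cls_eq_iff)

lemma cls_nat_pow [simp]: "cls \<Lambda> a [^]\<^bsub>elliptic_curve \<Lambda>\<^esub> (n::nat) = cls \<Lambda> (of_nat n * a)"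
  by (induction n) (simp_all add: one_curve algebra_simps)

lemma cls_int_pow [simp]: "cls \<Lambda> a [^]\<^bsub>elliptic_curve \<Lambda>\<^esub> (n::int) = cls \<Lambda> (of_int n * a)"
proof (cases n rule: int_cases2)
  case (nonneg m)
  then show ?thesis by (simp add: int_pow_int)
next
  case (nonpos m)
  then show ?thesis by (simp add: E.int_pow_neg_int)
qed

lemma cls_finprod: "finprod (elliptic_curve \<Lambda>) (\<lambda>i. cls \<Lambda> (f i)) A = cls \<Lambda> (sum f A)"
  by (induction A rule: infinite_finite_induct)
    (simp_all add: one_curve)

lemma nonzero_2_torsion_cls:
  "nonzero_2_torsion (elliptic_curve \<Lambda>) (cls \<Lambda> a) \<longleftrightarrow> a \<notin> \<Lambda> \<and> 2 * a \<in> \<Lambda>"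
  by (simp add: nonzero_2_torsion_def)

end

section \<open>Affine maps with sign matrices as linear parts\<close>

definition scale_by :: "('n::finite \<Rightarrow> complex) \<Rightarrow> complex ^ 'n \<Rightarrow> complex ^ 'n" where
  "scale_by e z = (\<chi> k. e k * z $ k)"

lemma scale_by_nth [simp]: "scale_by e z $ k = e k * z $ k"
  by (simp add: scale_by_def)

lemma scale_by_add: "scale_by e (z + w) = scale_by e z + scale_by e w"
  by (simp add: vec_eq_iff algebra_simps)

lemma scale_by_diff: "scale_by e (z - w) = scale_by e z - scale_by e w"
  by (simp add: vec_eq_iff algebra_simps)

text \<open>The \<open>j\<close>-th diagonal entry of the product of the matrices \<open>g i\<close>
  over \<open>i \<in> I\<close>: every factor except \<open>g j\<close> contributes
  \<open>-1\<close>.\<close>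

definition sign_at :: "'n::finite set \<Rightarrow> 'n \<Rightarrow> complex" where
  "sign_at I j = (-1) ^ card (I - {j})"

lemma sign_at_empty [simp]: "sign_at {} j = 1"
  by (simp add: sign_at_def)

lemma sign_at_singleton [simp]: "sign_at {i} j = (if j = i then 1 else -1)"
  by (simp add: sign_at_def insert_Diff_if)

lemma sign_at_insert: "i \<notin> I \<Longrightarrow> sign_at (insert i I) j = sign_at {i} j * sign_at I j"
  by (cases "j = i") (simp_all add: sign_at_def insert_Diff_if)

lemma sign_at_square: "sign_at I j * sign_at I j = 1"
  by (simp add: sign_at_def flip: power_mult_distrib)

lemma sign_at_sym_diff: "sign_at (sym_diff I {i}) j = sign_at {i} j * sign_at I j"
proof (cases "i \<in> I")
  case True
  then have "sign_at I j = sign_at {i} j * sign_at (I - {i}) j"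
    using sign_at_insert[of i "I - {i}" j] by (simp add: insert_absorb)
  moreover have "sym_diff I {i} = I - {i}" using True by auto
  ultimately show ?thesis by simp
next
  case False
  then have "sym_diff I {i} = insert i I" by auto
  then show ?thesis using sign_at_insert[OF False] by simp
qed

text \<open>With \<open>b i\<close> a lift of the element \<open>x\<^sub>i\<close> of the paper, \<open>shift_vec b I\<close> is a lift of \<open>x\<^sub>I\<close> and
  \<open>gam b I\<close> one of the composition of the maps \<open>f\<^sub>i\<close> over \<open>i \<in> I\<close> in increasing order.\<close>

definition shift_vec ::
    "('n::{finite,linorder} \<Rightarrow> (complex, 'n) vec) \<Rightarrow> 'n set \<Rightarrow> (complex, 'n) vec" where
  "shift_vec b I =
     (\<chi> j. \<Sum>i\<in>I. of_int (alt_sign I i) * (if j \<in> I \<and> j < i then -1 else 1) * b i $ j)"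

definition gam :: "('n::{finite,linorder} \<Rightarrow> (complex, 'n) vec) \<Rightarrow> 'n set \<Rightarrow> (complex, 'n) vec \<Rightarrow> (complex, 'n) vec"
  where "gam b I z = scale_by (sign_at I) z + shift_vec b I"

lemma alt_sign_min:
  assumes "\<forall>k\<in>K. a < k"
  shows "alt_sign (insert a K) a = 1"
proof -
  have "{l \<in> insert a K. l < a} = {}" using assms by auto
  then show ?thesis by (metis alt_sign_def card.empty power_0)
qed

lemma shift_vec_empty [simp]: "shift_vec b {} = 0"
  by (simp add: shift_vec_def vec_eq_iff)

lemma shift_vec_singleton [simp]: "shift_vec b {i} = b i"
proof -
  have "alt_sign {i} i = 1" using alt_sign_min[of "{}" i] by simp
  then show ?thesis by (simp add: shift_vec_def vec_eq_iff)
qed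

lemma gam_empty [simp]: "gam b {} z = z"
  by (simp add: gam_def vec_eq_iff)

lemma gam_singleton_nth [simp]: "gam b {i} z $ k = (if k = i then z $ k else - z $ k) + b i $ k"
  by (simp add: gam_def)

lemma gam_0 [simp]: "gam b I 0 = shift_vec b I"
  by (simp add: gam_def vec_eq_iff)

lemma gam_diff: "gam b I z - gam b I w = scale_by (sign_at I) (z - w)"
  by (simp add: gam_def scale_by_diff)

lemma alt_sign_insert_min:
  assumes "\<forall>k\<in>K. a < k" "i \<in> K"
  shows "alt_sign (insert a K) i = - alt_sign K i"
proof -
  have "{l \<in> insert a K. l < i} = insert a {l \<in> K. l < i}" using assms by auto
  moreover have "a \<notin> {l \<in> K. l < i}" using assms by auto
  ultimately show ?thesis by (simp add: alt_sign_def)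
qed

text \<open>A new smallest index raises every rank by one and so flips all alternating signs. On the
  axes other than \<open>a\<close> this is the sign with which the generator \<open>a\<close> acts;
  on the axis \<open>a\<close> it is cancelled by the sign for indices above
  \<open>j = a\<close>.\<close>

lemma shift_vec_insert_min:
  assumes "\<forall>k\<in>K. a < k"
  shows "shift_vec b (insert a K) = gam b {a} (shift_vec b K)"
  unfolding vec_eq_iff
proof
  fix j
  have a: "a \<notin> K" using assms by auto
  have "shift_vec b (insert a K) $ j =
      (\<Sum>i\<in>K. of_int (alt_sign (insert a K) i) * (if j \<in> insert a K \<and> j < i then -1 else 1) * b i $ j)
        + (if j \<in> insert a K \<and> j < a then -1 else 1) * b a $ j"
    using a by (simp add: shift_vec_def alt_sign_min[OF assms])
  also have "(if j \<in> insert a K \<and> j < a then -1 else 1) * b a $ j = b a $ j"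
    using assms by auto
  also have "(\<Sum>i\<in>K. of_int (alt_sign (insert a K) i) * (if j \<in> insert a K \<and> j < i then -1 else 1) * b i $ j)
      = (\<Sum>i\<in>K. (if j = a then 1 else -1) *
          (of_int (alt_sign K i) * (if j \<in> K \<and> j < i then -1 else 1) * b i $ j))"
    using assms a by (intro sum.cong) (auto simp: alt_sign_insert_min)
  also have "\<dots> = (if j = a then 1 else -1) * shift_vec b K $ j"
    by (simp only: shift_vec_def vec_lambda_beta sum_distrib_left)
  finally show "shift_vec b (insert a K) $ j = gam b {a} (shift_vec b K) $ j" by simp
qed

text \<open>The smallest index is the outermost factor, which is why the inductions below add ever
  smaller elements.\<close>

lemma gam_insert_min:
  assumes "\<forall>k\<in>K. a < k"
  shows "gam b (insert a K) z = gam b {a} (gam b K z)"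
proof -
  have "a \<notin> K" using assms by auto
  then have "scale_by (sign_at (insert a K)) z = scale_by (sign_at {a}) (scale_by (sign_at K) z)"
    by (simp only: vec_eq_iff scale_by_nth sign_at_insert[OF \<open>a \<notin> K\<close>] mult.assoc) simp
  then show ?thesis
    unfolding gam_def[of b "insert a K"] gam_def[of b K] shift_vec_insert_min[OF assms]
    by (simp only: gam_def scale_by_add add_ac)
qed

text \<open>Modulo \<open>L\<close> the generators are commuting involutions, and they preserve
  \<open>L\<close>. Hence their products are indexed by subsets, multiplied by symmetric difference,
  whatever the exact translational parts are.\<close>

locale twisted_lattice =
  fixes b :: "'n::{finite,linorder} \<Rightarrow> (complex, 'n) vec" and L :: "(complex, 'n) vec set"
  assumes zero: "0 \<in> L" and add: "v \<in> L \<Longrightarrow> w \<in> L \<Longrightarrow> v + w \<in> L" and neg: "v \<in> L \<Longrightarrow> - v \<in> L"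
    and reflect: "v \<in> L \<Longrightarrow> scale_by (sign_at {i}) v \<in> L"
    and square: "gam b {i} (gam b {i} z) - z \<in> L"
    and commute: "i \<noteq> j \<Longrightarrow> gam b {i} (gam b {j} z) - gam b {j} (gam b {i} z) \<in> L"
begin

lemma diff: "v \<in> L \<Longrightarrow> w \<in> L \<Longrightarrow> v - w \<in> L"
  using add[of v "- w"] neg by simp

lemma cong_sym: "z - w \<in> L \<Longrightarrow> w - z \<in> L"
  using neg by fastforce

lemma cong_trans: "u - v \<in> L \<Longrightarrow> v - w \<in> L \<Longrightarrow> u - w \<in> L"
  using add[of "u - v" "v - w"] by simp

lemma scale_sign: "v \<in> L \<Longrightarrow> scale_by (sign_at I) v \<in> L"
proof (induction I arbitrary: v rule: infinite_finite_induct)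
  case (insert i I)
  have "scale_by (sign_at (insert i I)) v = scale_by (sign_at {i}) (scale_by (sign_at I) v)"
    by (simp only: vec_eq_iff scale_by_nth sign_at_insert[OF insert.hyps(2)] mult.assoc) simp
  then show ?case using insert reflect by metis
qed (simp_all add: scale_by_def)

lemma gam_cong: "z - w \<in> L \<Longrightarrow> gam b I z - gam b I w \<in> L"
  using scale_sign by (simp only: gam_diff)

text \<open>The generator \<open>i\<close> moves inwards past the smaller indices by
  \<open>commute\<close> until it reaches its place; there it either stays as the new smallest
  factor or cancels against its own copy by \<open>square\<close>.\<close>

lemma gam_singleton_mult: "gam b {i} (gam b I z) - gam b (sym_diff I {i}) z \<in> L"
proof -
  have "finite I" by simp
  then show ?thesis
  proof (induction I rule: finite_linorder_min_induct)
    case empty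
    then show ?case using zero by simp
  next
    case (insert a K)
    have K: "\<forall>k\<in>K. a < k" using insert by blast
    consider "i < a" | "i = a" | "i > a" by fastforce
    then show ?case
    proof cases
      case 1
      then have "\<forall>k\<in>insert a K. i < k" using K by auto
      then have "gam b (insert i (insert a K)) z = gam b {i} (gam b (insert a K) z)"
        by (rule gam_insert_min)
      moreover have "sym_diff (insert a K) {i} = insert i (insert a K)" using 1 K by force
      ultimately show ?thesis using zero by simp
    next
      case 2
      moreover have "sym_diff (insert a K) {a} = K" using K by auto
      ultimately show ?thesis using square by (simp add: gam_insert_min[OF K])
    next
      case 3
      have sd: "sym_diff (insert a K) {i} = insert a (sym_diff K {i})" using 3 by auto
      have "gam b {i} (gam b {a} (gam b K z)) - gam b {a} (gam b {i} (gam b K z)) \<in> L"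
        using 3 by (intro commute) auto
      moreover have "gam b {a} (gam b {i} (gam b K z)) - gam b {a} (gam b (sym_diff K {i}) z) \<in> L"
        using insert.IH by (rule gam_cong)
      moreover have "gam b (insert a (sym_diff K {i})) z = gam b {a} (gam b (sym_diff K {i}) z)"
        using K 3 by (intro gam_insert_min) auto
      ultimately show ?thesis
        unfolding sd gam_insert_min[OF K] by (metis cong_trans)
    qed
  qed
qed

lemma gam_mult: "gam b J (gam b I z) - gam b (sym_diff I J) z \<in> L"
proof -
  have "finite J" by simp
  then show ?thesis
  proof (induction J rule: finite_linorder_min_induct)
    case empty
    then show ?case using zero by simp
  next
    case (insert a K)
    have K: "\<forall>k\<in>K. a < k" using insert by blast
    have "gam b {a} (gam b K (gam b I z)) - gam b {a} (gam b (sym_diff I K) z) \<in> L"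
      using insert.IH by (rule gam_cong)
    moreover have "gam b {a} (gam b (sym_diff I K) z) - gam b (sym_diff (sym_diff I K) {a}) z \<in> L"
      by (rule gam_singleton_mult)
    moreover have "sym_diff (sym_diff I K) {a} = sym_diff I (insert a K)" using K by auto
    ultimately show ?case unfolding gam_insert_min[OF K] by (metis cong_trans)
  qed
qed

text \<open>The orbit relation on complex n-space of the group generated by \<open>L\<close> and the
  maps \<open>gam b {i}\<close>; the two quotients are compared through it.\<close>

definition rel :: "(complex, 'n) vec \<Rightarrow> (complex, 'n) vec \<Rightarrow> bool" where
  "rel z w \<longleftrightarrow> (\<exists>I. w - gam b I z \<in> L)"

lemma rel_add: "l \<in> L \<Longrightarrow> rel z (z + l)"
  unfolding rel_def by (intro exI[of _ "{}"]) simp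

lemma rel_gam: "rel z (gam b I z)"
  unfolding rel_def using zero by (metis cancel_comm_monoid_add_class.diff_cancel)

lemma rel_refl: "rel z z"
  using rel_add[OF zero] by simp

lemma rel_trans: "rel u v \<Longrightarrow> rel v w \<Longrightarrow> rel u w"
  unfolding rel_def using gam_cong gam_mult cong_trans by meson

lemma rel_sym:
  assumes "rel z w"
  shows "rel w z"
proof -
  obtain I where "w - gam b I z \<in> L" using assms unfolding rel_def by blast
  then have "gam b I w - gam b I (gam b I z) \<in> L" by (rule gam_cong)
  moreover have "gam b I (gam b I z) - z \<in> L" using gam_mult[of I I z] by simp
  ultimately show ?thesis unfolding rel_def by (metis cong_sym cong_trans)
qed

end

section \<open>The group generated by the maps and translations of the data\<close>

definition proj :: "('n::finite \<Rightarrow> complex set) \<Rightarrow> complex ^ 'n \<Rightarrow> 'n \<Rightarrow> complex set" where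
  "proj \<Lambda> z = (\<lambda>k. cls (\<Lambda> k) (z $ k))"

locale torus =
  fixes \<Lambda> :: "'n::finite \<Rightarrow> complex set"
  assumes sub: "subgroup (\<Lambda> k) complex_group"
begin

sublocale C: curve "\<Lambda> k" for k
  by (rule curve.intro) (rule sub)

lemma carrier_curve_sum: "carrier (curve_sum \<Lambda>) = range (proj \<Lambda>)"
proof
  show "carrier (curve_sum \<Lambda>) \<subseteq> range (proj \<Lambda>)"
  proof
    fix f assume "f \<in> carrier (curve_sum \<Lambda>)"
    then have "\<forall>k. \<exists>a. f k = cls (\<Lambda> k) a"
      by (auto simp: curve_sum_def C.carrier_curve PiE_iff)
    then obtain a where "\<And>k. f k = cls (\<Lambda> k) (a k)" by metis
    then have "f = proj \<Lambda> (\<chi> k. a k)" by (auto simp: proj_def)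
    then show "f \<in> range (proj \<Lambda>)" by blast
  qed
qed (auto simp: curve_sum_def proj_def C.carrier_curve)

lemma proj_closed [simp]: "proj \<Lambda> z \<in> carrier (curve_sum \<Lambda>)"
  by (simp add: carrier_curve_sum)

lemma proj_eq_iff: "proj \<Lambda> z = proj \<Lambda> w \<longleftrightarrow> (\<forall>k. z $ k - w $ k \<in> \<Lambda> k)"
  by (simp add: proj_def fun_eq_iff C.cls_eq_iff)

lemma group_curve_sum: "group (curve_sum \<Lambda>)"
  by (simp add: curve_sum_def C.E.is_group)

lemma proj_mult [simp]: "proj \<Lambda> z \<otimes>\<^bsub>curve_sum \<Lambda>\<^esub> proj \<Lambda> w = proj \<Lambda> (z + w)"
  by (simp add: curve_sum_def proj_def fun_eq_iff)

lemma one_curve_sum: "\<one>\<^bsub>curve_sum \<Lambda>\<^esub> = proj \<Lambda> 0"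
  by (simp add: curve_sum_def proj_def C.one_curve fun_eq_iff)

lemma proj_inv [simp]: "inv\<^bsub>curve_sum \<Lambda>\<^esub> (proj \<Lambda> z) = proj \<Lambda> (- z)"
  using group.inv_equality[OF group_curve_sum] by (simp add: one_curve_sum)

lemma proj_subgroup:
  "subgroup (proj \<Lambda> ` L) (curve_sum \<Lambda>)"
  if "0 \<in> L" "\<And>v w. v \<in> L \<Longrightarrow> w \<in> L \<Longrightarrow> v + w \<in> L" "\<And>v. v \<in> L \<Longrightarrow> - v \<in> L"
  using that by (intro subgroup.intro) (auto simp: one_curve_sum)

lemma curve_sum_manifold_eq: "curve_sum_manifold \<Lambda> = quotient_manifold complex_space (proj \<Lambda>)"
  by (simp add: curve_sum_manifold_def proj_def[abs_def])

end

section \<open>Lifting the points and maps of the data to complex n-space\<close>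

locale ordered_torus = torus \<Lambda>
  for \<Lambda> :: "'n::{finite,linorder} \<Rightarrow> complex set"
begin

text \<open>For \<open>j \<in> I\<close> the inverse in \<open>x_set\<close> and the extra sign in
  \<open>shift_vec\<close> affect the same indices, those above \<open>j\<close>.\<close>

lemma x_set_proj:
  "x_set \<Lambda> (\<lambda>i. proj \<Lambda> (b i)) I j = cls (\<Lambda> j) (shift_vec b I $ j)"
proof (cases "j \<in> I")
  case False
  then show ?thesis
    by (simp add: x_set_def Let_def proj_def C.cls_finprod shift_vec_def)
next
  case True
  let ?c = "\<lambda>i. of_int (alt_sign I i) * b i $ j"
  let ?A = "{i \<in> I. i \<le> j}" and ?B = "{i \<in> I. j < i}"
  have "x_set \<Lambda> (\<lambda>i. proj \<Lambda> (b i)) I j = cls (\<Lambda> j) (sum ?c ?A - sum ?c ?B)"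
    using True by (simp add: x_set_def Let_def proj_def C.cls_finprod)
  moreover have "shift_vec b I $ j = sum ?c ?A - sum ?c ?B"
  proof -
    let ?d = "\<lambda>i. of_int (alt_sign I i) * (if j < i then -1 else 1) * b i $ j"
    have "shift_vec b I $ j = sum ?d I" using True by (simp add: shift_vec_def)
    also have "\<dots> = sum ?d ?A + sum ?d ?B"
      by (subst sum.union_disjoint[symmetric]) (auto intro!: sum.cong)
    also have "sum ?d ?A = sum ?c ?A" by (intro sum.cong) auto
    also have "sum ?d ?B = - sum ?c ?B" unfolding sum_negf[symmetric] by (intro sum.cong) auto
    finally show ?thesis by simp
  qed
  ultimately show ?thesis by simp
qed

lemma x_pair_proj:
  "x_pair \<Lambda> (\<lambda>i. proj \<Lambda> (b i)) i j =
     proj \<Lambda> (\<chi> k. if k = i \<or> k = j then 0 else 2 * (b i $ k - b j $ k))"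
  by (auto simp: x_pair_def proj_def fun_eq_iff C.one_curve)

lemma f_hat_proj: "f_hat \<Lambda> (\<lambda>i. proj \<Lambda> (b i)) i (proj \<Lambda> z) = proj \<Lambda> (gam b {i} z)"
  by (auto simp: f_hat_def proj_def[abs_def] fun_eq_iff curve_sum_def)

text \<open>\<open>G_hat\<close> is generated inside the group of bijections, so its generators must
  be known to belong there before any group law applies.\<close>

lemma f_hat_Bij: "f_hat \<Lambda> (\<lambda>i. proj \<Lambda> (b i)) i \<in> Bij (carrier (curve_sum \<Lambda>))"
proof -
  have "inj_on (f_hat \<Lambda> (\<lambda>i. proj \<Lambda> (b i)) i) (range (proj \<Lambda>))"
  proof (rule inj_onI, clarify)
    fix z w
    assume "f_hat \<Lambda> (\<lambda>i. proj \<Lambda> (b i)) i (proj \<Lambda> z) = f_hat \<Lambda> (\<lambda>i. proj \<Lambda> (b i)) i (proj \<Lambda> w)"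
    then have *: "gam b {i} z $ k - gam b {i} w $ k \<in> \<Lambda> k" for k
      unfolding f_hat_proj proj_eq_iff by blast
    have "z $ k - w $ k \<in> \<Lambda> k" for k
      using *[of k] C.neg[of "w $ k - z $ k" k] by (cases "k = i") auto
    then show "proj \<Lambda> z = proj \<Lambda> w" by (simp add: proj_eq_iff)
  qed
  moreover have "f_hat \<Lambda> (\<lambda>i. proj \<Lambda> (b i)) i ` range (proj \<Lambda>) = range (proj \<Lambda>)"
  proof (rule subset_antisym)
    show "f_hat \<Lambda> (\<lambda>i. proj \<Lambda> (b i)) i ` range (proj \<Lambda>) \<subseteq> range (proj \<Lambda>)"
      by (auto simp: f_hat_proj)
    show "range (proj \<Lambda>) \<subseteq> f_hat \<Lambda> (\<lambda>i. proj \<Lambda> (b i)) i ` range (proj \<Lambda>)"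
    proof clarify
      fix z
      have "gam b {i} (scale_by (sign_at {i}) (z - b i)) = z"
        by (simp add: vec_eq_iff)
      then show "proj \<Lambda> z \<in> f_hat \<Lambda> (\<lambda>i. proj \<Lambda> (b i)) i ` range (proj \<Lambda>)"
        by (metis f_hat_proj rangeI image_eqI)
    qed
  qed
  moreover have "f_hat \<Lambda> (\<lambda>i. proj \<Lambda> (b i)) i \<in> extensional (range (proj \<Lambda>))"
    by (simp add: f_hat_def carrier_curve_sum)
  ultimately show ?thesis by (simp add: Bij_def bij_betw_def carrier_curve_sum)
qed

lemma translation_proj: "translation \<Lambda> (proj \<Lambda> l) (proj \<Lambda> z) = proj \<Lambda> (z + l)"
  by (simp add: translation_def)

lemma translation_Bij: "translation \<Lambda> (proj \<Lambda> l) \<in> Bij (carrier (curve_sum \<Lambda>))"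
proof -
  have "inj_on (translation \<Lambda> (proj \<Lambda> l)) (range (proj \<Lambda>))"
    by (rule inj_onI) (auto simp: translation_proj proj_eq_iff)
  moreover have "translation \<Lambda> (proj \<Lambda> l) ` range (proj \<Lambda>) = range (proj \<Lambda>)"
  proof (rule subset_antisym)
    show "range (proj \<Lambda>) \<subseteq> translation \<Lambda> (proj \<Lambda> l) ` range (proj \<Lambda>)"
    proof clarify
      fix z
      show "proj \<Lambda> z \<in> translation \<Lambda> (proj \<Lambda> l) ` range (proj \<Lambda>)"
        by (rule image_eqI[of _ _ "proj \<Lambda> (z - l)"]) (simp_all add: translation_proj)
    qed
  qed (auto simp: translation_proj)
  moreover have "translation \<Lambda> (proj \<Lambda> l) \<in> extensional (range (proj \<Lambda>))"
    by (simp add: translation_def carrier_curve_sum)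
  ultimately show ?thesis by (simp add: Bij_def bij_betw_def carrier_curve_sum)
qed

end

text \<open>What is needed to determine the orbits, and what both directions of the classification
  provide. The points \<open>t i\<close> survive only in \<open>W_torsion\<close>: an element of the
  group they generate has order at most two in every coordinate.\<close>

locale chw_data = ordered_torus \<Lambda>
  for \<Lambda> :: "'n::{finite,linorder} \<Rightarrow> complex set" +
  fixes b :: "'n \<Rightarrow> (complex, 'n) vec" and W :: "('n \<Rightarrow> complex set) set"
  assumes W: "subgroup W (curve_sum \<Lambda>)"
    and W_torsion: "proj \<Lambda> l \<in> W \<Longrightarrow> 2 * l $ k \<in> \<Lambda> k"
    and pair: "i \<noteq> j \<Longrightarrow> x_pair \<Lambda> (\<lambda>i. proj \<Lambda> (b i)) i j \<in> W"
    and diag_torsion: "2 * b i $ i \<in> \<Lambda> i"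
begin

text \<open>The translation lattice of the group belonging to the data. It contains the product of
  the curve lattices, with \<open>W\<close> as the quotient.\<close>

definition L :: "(complex, 'n) vec set" where "L = {v. proj \<Lambda> v \<in> W}"

lemma L_I: "(\<And>k. v $ k \<in> \<Lambda> k) \<Longrightarrow> v \<in> L"
  using subgroup.one_closed[OF W] proj_eq_iff[of v 0]
  by (simp add: L_def one_curve_sum)

lemma proj_eq_L: "proj \<Lambda> v = proj \<Lambda> w \<Longrightarrow> v - w \<in> L"
  by (intro L_I) (simp add: proj_eq_iff)

lemma W_cases:
  assumes "w \<in> W"
  obtains l where "l \<in> L" "w = proj \<Lambda> l"
  using assms subgroup.subset[OF W] carrier_curve_sum unfolding L_def by auto

lemma generator_Bij:
  assumes "h \<in> range (f_hat \<Lambda> (\<lambda>i. proj \<Lambda> (b i))) \<union> translation \<Lambda> ` W"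
  shows "h \<in> Bij (carrier (curve_sum \<Lambda>))"
  using assms f_hat_Bij translation_Bij by (auto elim: W_cases)

sublocale twisted_lattice b L
proof
  show "0 \<in> L" by (intro L_I) (simp add: C.zero)
  show add: "v + w \<in> L" if "v \<in> L" "w \<in> L" for v w
    using that subgroup.m_closed[OF W] unfolding L_def by force
  show "- v \<in> L" if "v \<in> L" for v
    using that subgroup.m_inv_closed[OF W] unfolding L_def by force
  show "scale_by (sign_at {i}) v \<in> L" if "v \<in> L" for v i
  proof -
    have "scale_by (sign_at {i}) v - v \<in> L"
    proof (rule L_I)
      fix k
      have "- (2 * v $ k) \<in> \<Lambda> k" using W_torsion that C.neg by (simp add: L_def)
      then show "(scale_by (sign_at {i}) v - v) $ k \<in> \<Lambda> k" using C.zero by simp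
    qed
    then show ?thesis using add[OF that] by force
  qed
  show "gam b {i} (gam b {i} z) - z \<in> L" for i z
    using diag_torsion[of i] C.zero by (intro L_I) simp
  show "gam b {i} (gam b {j} z) - gam b {j} (gam b {i} z) \<in> L" if "i \<noteq> j" for i j z
  proof -
    \<comment> \<open>The commutator agrees with this vector off the axes \<open>i\<close> and
      \<open>j\<close>; there it is \<open>2 * b i $ i\<close> and \<open>- 2 * b j $ j\<close>,
      which are periods by \<open>diag_torsion\<close>.\<close>
    let ?y = "\<chi> k. if k = i \<or> k = j then 0 else 2 * (b i $ k - b j $ k)"
    have "?y \<in> L" using pair[OF that] unfolding x_pair_proj L_def by simp
    moreover have "gam b {i} (gam b {j} z) - gam b {j} (gam b {i} z) - ?y \<in> L"
      using diag_torsion[of i] C.neg[OF diag_torsion[of j]] that C.zero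
      by (intro L_I) auto
    ultimately show ?thesis using add by fastforce
  qed
qed

section \<open>Orbits of the generated group, described on complex n-space\<close>

abbreviation "G \<equiv> G_hat \<Lambda> (\<lambda>i. proj \<Lambda> (b i)) W"

lemma G_subgroup: "subgroup G (BijGroup (carrier (curve_sum \<Lambda>)))"
  unfolding G_hat_def
  by (rule group.generate_is_subgroup[OF group_BijGroup])
    (auto simp: BijGroup_def generator_Bij)

lemma G_in_Bij: "g \<in> G \<Longrightarrow> g \<in> Bij (carrier (curve_sum \<Lambda>))"
  using subgroup.subset[OF G_subgroup] by (auto simp: BijGroup_def)

lemma BijGroup_mult_apply:
  "g \<in> Bij S \<Longrightarrow> h \<in> Bij S \<Longrightarrow> x \<in> S \<Longrightarrow> (g \<otimes>\<^bsub>BijGroup S\<^esub> h) x = g (h x)"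
  by (simp add: BijGroup_def compose_def)

lemma G_comp:
  assumes "g \<in> G" "h \<in> G"
  shows "\<exists>k\<in>G. \<forall>z. k (proj \<Lambda> z) = g (h (proj \<Lambda> z))"
  using assms subgroup.m_closed[OF G_subgroup assms]
  by (intro bexI[of _ "g \<otimes>\<^bsub>BijGroup (carrier (curve_sum \<Lambda>))\<^esub> h"])
    (simp_all add: BijGroup_mult_apply G_in_Bij)

lemma G_id: "\<exists>k\<in>G. \<forall>z. k (proj \<Lambda> z) = proj \<Lambda> z"
  using subgroup.one_closed[OF G_subgroup]
  by (rule bexI[rotated]) (simp add: BijGroup_def)

lemma proj_eq_rel: "proj \<Lambda> v = proj \<Lambda> w \<Longrightarrow> rel v w"
  using rel_add[OF proj_eq_L[of w v], of v] by simp

lemma generator_rel: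
  assumes "h \<in> range (f_hat \<Lambda> (\<lambda>i. proj \<Lambda> (b i))) \<union> translation \<Lambda> ` W"
  shows "\<exists>w. h (proj \<Lambda> z) = proj \<Lambda> w \<and> rel z w"
  using assms
proof
  assume "h \<in> range (f_hat \<Lambda> (\<lambda>i. proj \<Lambda> (b i)))"
  then obtain i where "h = f_hat \<Lambda> (\<lambda>i. proj \<Lambda> (b i)) i" by blast
  then have "h (proj \<Lambda> z) = proj \<Lambda> (gam b {i} z)" by (simp only: f_hat_proj)
  then show ?thesis using rel_gam by blast
next
  assume "h \<in> translation \<Lambda> ` W"
  then obtain l where "l \<in> L" "h = translation \<Lambda> (proj \<Lambda> l)" by (blast elim: W_cases)
  then show ?thesis using rel_add translation_proj by blast
qed

text \<open>A point of the sum of the curves has many lifts, but they differ by the product of the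
  lattices, which lies in \<open>L\<close>. So \<open>rel\<close> absorbs the choice, and symmetry
  and transitivity of \<open>rel\<close> handle inverses and products.\<close>

lemma G_imp_rel:
  assumes "g \<in> G"
  shows "\<exists>w. g (proj \<Lambda> z) = proj \<Lambda> w \<and> rel z w"
  using assms unfolding G_hat_def
proof (induction arbitrary: z rule: generate.induct)
  case one
  then show ?case using rel_refl by (auto simp: BijGroup_def)
next
  case (incl h)
  then show ?case by (rule generator_rel)
next
  case (inv h)
  let ?S = "carrier (curve_sum \<Lambda>)"
  have hB: "h \<in> Bij ?S" using inv by (rule generator_Bij)
  then have i: "inv\<^bsub>BijGroup ?S\<^esub> h = (\<lambda>x\<in>?S. inv_into ?S h x)" by (rule inv_BijGroup)
  have "proj \<Lambda> z \<in> h ` ?S" using hB by (simp add: Bij_def bij_betw_def)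
  then obtain w where w: "h (proj \<Lambda> w) = proj \<Lambda> z" by (auto simp: carrier_curve_sum)
  have "inv_into ?S h (proj \<Lambda> z) = proj \<Lambda> w"
    using hB unfolding w[symmetric] by (simp add: Bij_def bij_betw_def)
  then have "(inv\<^bsub>BijGroup ?S\<^esub> h) (proj \<Lambda> z) = proj \<Lambda> w" unfolding i by simp
  obtain w' where w': "h (proj \<Lambda> w) = proj \<Lambda> w'" "rel w w'"
    using generator_rel[OF inv] by blast
  have "rel w' z"
    using w w'(1) by (intro proj_eq_rel) simp
  then have "rel z w" using w'(2) rel_trans rel_sym by blast
  then show ?case
    using \<open>(inv\<^bsub>BijGroup ?S\<^esub> h) (proj \<Lambda> z) = proj \<Lambda> w\<close> by blast
next
  case (eng h1 h2)
  let ?S = "carrier (curve_sum \<Lambda>)"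
  have B: "h1 \<in> Bij ?S" "h2 \<in> Bij ?S"
    by (rule G_in_Bij, simp only: G_hat_def eng.hyps)+
  obtain w where w: "h2 (proj \<Lambda> z) = proj \<Lambda> w" "rel z w" using eng.IH(2) by blast
  obtain v where v: "h1 (proj \<Lambda> w) = proj \<Lambda> v" "rel w v" using eng.IH(1) by blast
  have "(h1 \<otimes>\<^bsub>BijGroup ?S\<^esub> h2) (proj \<Lambda> z) = proj \<Lambda> v"
    using B w v by (simp add: BijGroup_mult_apply)
  then show ?case using w v rel_trans by blast
qed

lemma gam_lift: "\<exists>g\<in>G. \<forall>z. g (proj \<Lambda> z) = proj \<Lambda> (gam b I z)"
proof -
  have "finite I" by simp
  then show ?thesis
  proof (induction I rule: finite_linorder_min_induct)
    case empty
    then show ?case using G_id by simp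
  next
    case (insert a K)
    then obtain g where g: "g \<in> G" "\<And>z. g (proj \<Lambda> z) = proj \<Lambda> (gam b K z)" by blast
    have K: "\<forall>k\<in>K. a < k" using insert by blast
    have "f_hat \<Lambda> (\<lambda>i. proj \<Lambda> (b i)) a \<in> G"
      unfolding G_hat_def by (intro generate.incl) blast
    from G_comp[OF this g(1)] show ?case
      by (simp only: g(2) f_hat_proj gam_insert_min[OF K])
  qed
qed

lemma rel_imp_G:
  assumes "rel z w"
  shows "\<exists>g\<in>G. g (proj \<Lambda> z) = proj \<Lambda> w"
proof -
  obtain I where I: "w - gam b I z \<in> L" using assms unfolding rel_def by blast
  obtain g where g: "g \<in> G" "\<And>z. g (proj \<Lambda> z) = proj \<Lambda> (gam b I z)" using gam_lift by blast
  have "translation \<Lambda> (proj \<Lambda> (w - gam b I z)) \<in> G"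
    unfolding G_hat_def using I by (intro generate.incl) (auto simp: L_def)
  from G_comp[OF this g(1)] obtain k where
    "k \<in> G" "k (proj \<Lambda> z) = translation \<Lambda> (proj \<Lambda> (w - gam b I z)) (g (proj \<Lambda> z))" by blast
  then have "k (proj \<Lambda> z) = proj \<Lambda> w" by (simp add: g(2) translation_proj)
  then show ?thesis using \<open>k \<in> G\<close> by blast
qed

text \<open>The composite of both quotient maps, from complex n-space to the sum of the curves and
  on to its orbits; it uniformizes the second quotient.\<close>

definition Q :: "(complex, 'n) vec \<Rightarrow> ('n \<Rightarrow> complex set) set" where
  "Q z = orbit ((BijGroup (carrier (curve_sum \<Lambda>)))\<lparr>carrier := G\<rparr>) (\<lambda>g. g) (proj \<Lambda> z)"

lemma Q_eq: "Q z = proj \<Lambda> ` {w. rel z w}"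
proof
  show "Q z \<subseteq> proj \<Lambda> ` {w. rel z w}"
    using G_imp_rel unfolding Q_def orbit_def by fastforce
  show "proj \<Lambda> ` {w. rel z w} \<subseteq> Q z"
  proof clarify
    fix w assume "rel z w"
    then obtain g where "g \<in> G" "g (proj \<Lambda> z) = proj \<Lambda> w" using rel_imp_G by blast
    then show "proj \<Lambda> w \<in> Q z" unfolding Q_def orbit_def by (auto intro!: exI[of _ g])
  qed
qed

lemma Q_eq_iff: "Q z = Q w \<longleftrightarrow> rel z w"
proof
  assume "Q z = Q w"
  then have "proj \<Lambda> w \<in> proj \<Lambda> ` {v. rel z v}" using rel_refl unfolding Q_eq by blast
  then obtain v where v: "rel z v" "proj \<Lambda> w = proj \<Lambda> v" by blast
  then have "rel v w" by (intro proj_eq_rel) simp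
  then show "rel z w" using v rel_trans by blast
next
  assume "rel z w"
  then have "{v. rel z v} = {v. rel w v}" using rel_trans rel_sym by blast
  then show "Q z = Q w" unfolding Q_eq by simp
qed

end

section \<open>Quotients by deck transformations\<close>

text \<open>The saturation of \<open>U\<close> is the union of the preimages of \<open>U\<close>
  under the maps in \<open>D\<close>.\<close>

lemma open_saturation:
  assumes D: "\<And>d. d \<in> D \<Longrightarrow> continuous_on UNIV d"
    and p: "\<And>z w. p z = p w \<longleftrightarrow> (\<exists>d\<in>D. d z = w)" and U: "open U"
  shows "open (p -` p ` U)"
proof -
  have "p -` p ` U = (\<Union>d\<in>D. d -` U)"
    unfolding set_eq_iff
  proof
    fix z
    have "z \<in> p -` p ` U \<longleftrightarrow> (\<exists>u\<in>U. p z = p u)" by auto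
    also have "\<dots> \<longleftrightarrow> z \<in> (\<Union>d\<in>D. d -` U)" using p by auto
    finally show "z \<in> p -` p ` U \<longleftrightarrow> z \<in> (\<Union>d\<in>D. d -` U)" .
  qed
  then show ?thesis using D U by (auto intro!: open_UN open_vimage)
qed

lemma ctop_quotient_complex_space:
  "openin (ctop (quotient_manifold complex_space p)) V \<longleftrightarrow> V \<subseteq> range p \<and> open (p -` V)"
  by (simp add: quotient_manifold_def complex_space_def openin_quot_topology vimage_def)

lemma topspace_quotient_complex_space:
  "topspace (ctop (quotient_manifold complex_space p)) = range p"
proof
  show "topspace (ctop (quotient_manifold complex_space p)) \<subseteq> range p"
    by (metis ctop_quotient_complex_space openin_topspace)
  have "openin (ctop (quotient_manifold complex_space p)) (range p)"
    unfolding ctop_quotient_complex_space by (simp add: vimage_def)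
  then show "range p \<subseteq> topspace (ctop (quotient_manifold complex_space p))" by (rule openin_subset)
qed

lemma charts_quotient_complex_space:
  "(C, \<phi>) \<in> charts (quotient_manifold complex_space p) \<longleftrightarrow>
     (\<exists>U. open U \<and> inj_on p U \<and> C = p ` U \<and> \<phi> = inv_into U p)"
  by (auto simp: quotient_manifold_def complex_space_def)

lemma uniformized_quotient:
  assumes "\<And>U. open U \<Longrightarrow> open (p -` p ` U)"
    and "\<And>z. \<exists>U. open U \<and> z \<in> U \<and> inj_on p U"
  shows "uniformized p (quotient_manifold complex_space p)"
  unfolding uniformized_def
proof (intro conjI allI impI)
  show "\<forall>(C, \<phi>)\<in>charts (quotient_manifold complex_space p).
      \<exists>U. open U \<and> C = p ` U \<and> (\<forall>z\<in>U. \<phi> (p z) = z)"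
    by (clarsimp simp: charts_quotient_complex_space) (metis inv_into_f_f)
  fix z
  obtain U where U: "open U" "z \<in> U" "inj_on p U" using assms(2) by blast
  then have "(p ` U, inv_into U p) \<in> charts (quotient_manifold complex_space p)"
    by (auto simp: charts_quotient_complex_space)
  then show "\<exists>(C, \<phi>)\<in>charts (quotient_manifold complex_space p). p z \<in> C"
    using U by blast
qed (use assms(1) in \<open>simp_all add: ctop_quotient_complex_space\<close>)

text \<open>A chart of the double quotient is a local inverse of \<open>r\<close> followed by one of
  \<open>p\<close>; it inverts the composite on the part of \<open>V\<close> that lies over
  \<open>U\<close>. Thus two successive quotients are uniformized by a single map.\<close>

lemma uniformized_iterated_quotient:
  fixes p :: "complex ^ 'n::finite \<Rightarrow> 'a" and r :: "'a \<Rightarrow> 'b"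
  defines "N \<equiv> quotient_manifold (quotient_manifold complex_space p) r"
  assumes p: "\<And>U. open U \<Longrightarrow> open (p -` p ` U)"
    and rp: "\<And>U. open U \<Longrightarrow> open ((\<lambda>z. r (p z)) -` (\<lambda>z. r (p z)) ` U)"
    and inj: "\<And>z. \<exists>U. open U \<and> z \<in> U \<and> inj_on (\<lambda>z. r (p z)) U"
  shows "uniformized (\<lambda>z. r (p z)) N"
proof -
  let ?M = "quotient_manifold complex_space p"
  have top: "openin (ctop N) V \<longleftrightarrow> V \<subseteq> range (\<lambda>z. r (p z)) \<and> open ((\<lambda>z. r (p z)) -` V)" for V
  proof -
    have "ctop N = quot_topology (ctop ?M) r" by (simp add: N_def quotient_manifold_def)
    moreover have "p -` {x \<in> range p. r x \<in> V} = (\<lambda>z. r (p z)) -` V" by auto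
    ultimately show ?thesis
      by (simp add: openin_quot_topology topspace_quotient_complex_space image_image
          ctop_quotient_complex_space)
  qed
  have charts: "(C, \<phi>) \<in> charts N \<longleftrightarrow> (\<exists>U V. open V \<and> inj_on p V \<and> U \<subseteq> p ` V \<and>
      openin (ctop ?M) U \<and> inj_on r U \<and> C = r ` U \<and> \<phi> = inv_into V p \<circ> inv_into U r)" for C \<phi>
    by (auto simp: N_def quotient_manifold_def[of "quotient_manifold complex_space p"]
        charts_quotient_complex_space)
  show ?thesis
    unfolding uniformized_def
  proof (intro conjI allI impI)
    show "\<forall>(C, \<phi>)\<in>charts N.
      \<exists>U. open U \<and> C = (\<lambda>z. r (p z)) ` U \<and> (\<forall>z\<in>U. \<phi> (r (p z)) = z)"
    proof clarify
      fix C \<phi> assume "(C, \<phi>) \<in> charts N"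
      then obtain U V where V: "open V" "inj_on p V" and U: "U \<subseteq> p ` V" "openin (ctop ?M) U"
        "inj_on r U" and C: "C = r ` U" "\<phi> = inv_into V p \<circ> inv_into U r"
        unfolding charts by blast
      have "open (V \<inter> p -` U)" using V U(2) by (auto simp: ctop_quotient_complex_space)
      moreover have "C = (\<lambda>z. r (p z)) ` (V \<inter> p -` U)" using U(1) C(1) by auto
      moreover have "\<forall>z\<in>V \<inter> p -` U. \<phi> (r (p z)) = z" using U V C by auto
      ultimately show "\<exists>U. open U \<and> C = (\<lambda>z. r (p z)) ` U \<and> (\<forall>z\<in>U. \<phi> (r (p z)) = z)" by blast
    qed
    fix z
    obtain V where V: "open V" "z \<in> V" "inj_on (\<lambda>z. r (p z)) V" using inj by blast
    have "inj_on p V" "inj_on r (p ` V)" using V(3) by (auto simp: inj_on_def)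
    then have "(r ` p ` V, inv_into V p \<circ> inv_into (p ` V) r) \<in> charts N"
      unfolding charts using V(1) p by (fastforce simp: ctop_quotient_complex_space)
    then show "\<exists>(C, \<phi>)\<in>charts N. r (p z) \<in> C" by (rule rev_bexI) (use V(2) in auto)
  qed (use top rp in auto)
qed

section \<open>The unitary affine group\<close>

lemma bounded_linear_matrix: "bounded_linear (\<lambda>z. A *v (z :: complex ^ 'n::finite))"
proof -
  have "linear (\<lambda>z. A *v z)"
    by (rule linearI) (auto simp: vec_eq_iff matrix_vector_mult_def algebra_simps
        sum.distrib scaleR_sum_right)
  then show ?thesis by (simp add: linear_conv_bounded_linear)
qed

lemma matrix_vector_minus: "A *v (- x) = - (A *v (x :: complex ^ 'n::finite))"
  by (metis vector_scalar_commute vector_sneg_minus1)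

lemma holomorphic_vec_on_affine: "holomorphic_vec_on (\<lambda>z. A *v z + c) UNIV"
  unfolding holomorphic_vec_on_def
proof (intro ballI exI conjI allI)
  fix z
  show "((\<lambda>z. A *v z + c) has_derivative (\<lambda>z. A *v z)) (at z)"
    using bounded_linear_imp_has_derivative[OF bounded_linear_matrix] by (intro has_derivative_add_const) blast
  show "A *v (c *s v) = c *s (A *v v)" for c v
    by (rule vector_scalar_commute)
qed

definition conj_transpose :: "complex ^ 'n ^ 'n::finite \<Rightarrow> complex ^ 'n ^ 'n" where
  "conj_transpose A = transpose (\<chi> i j. cnj (A $ i $ j))"

lemma conj_transpose_mult: "conj_transpose (A ** B) = conj_transpose B ** conj_transpose A"
  by (simp add: conj_transpose_def transpose_def matrix_matrix_mult_def vec_eq_iff mult.commute)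

lemma conj_transpose_involution [simp]: "conj_transpose (conj_transpose A) = A"
  by (simp add: conj_transpose_def transpose_def vec_eq_iff)

lemma unitary_iff: "unitary A \<longleftrightarrow> A ** conj_transpose A = mat 1"
  by (simp add: unitary_def conj_transpose_def)

lemma unitary_mult: "unitary A \<Longrightarrow> unitary B \<Longrightarrow> unitary (A ** B)"
  unfolding unitary_iff conj_transpose_mult
  by (metis matrix_mul_assoc matrix_mul_rid)

lemma unitary_one: "unitary (mat 1)"
proof -
  have "conj_transpose (mat 1) = mat 1"
    by (simp add: conj_transpose_def transpose_def mat_def vec_eq_iff)
  then show ?thesis by (simp add: unitary_iff)
qed

lemma unitary_conj_transpose: "unitary A \<Longrightarrow> unitary (conj_transpose A)"
  by (simp add: unitary_iff matrix_left_right_inverse)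

lemma uag_simps [simp]:
  "\<gamma> \<in> carrier unitary_affine_group \<longleftrightarrow> unitary (fst \<gamma>)"
  "(A, v) \<otimes>\<^bsub>unitary_affine_group\<^esub> (B, w) = (A ** B, A *v w + v)"
  "\<one>\<^bsub>unitary_affine_group\<^esub> = (mat 1, 0)"
  by (auto simp: unitary_affine_group_def)

lemma group_unitary_affine_group: "group (unitary_affine_group :: ((complex ^ 'n ^ 'n::finite) \<times> _) monoid)"
proof (rule groupI)
  fix x :: "(complex ^ 'n ^ 'n) \<times> (complex ^ 'n)"
  assume x: "x \<in> carrier unitary_affine_group"
  obtain A v where xA: "x = (A, v)" by (cases x)
  have "unitary A" using x xA by simp
  then have "conj_transpose A ** A = mat 1" by (simp add: unitary_iff matrix_left_right_inverse)
  moreover have "unitary (conj_transpose A)" using \<open>unitary A\<close> by (rule unitary_conj_transpose)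
  ultimately show "\<exists>y\<in>carrier unitary_affine_group.
      y \<otimes>\<^bsub>unitary_affine_group\<^esub> x = \<one>\<^bsub>unitary_affine_group\<^esub>"
    by (intro bexI[of _ "(conj_transpose A, - (conj_transpose A *v v))"]) (simp_all add: xA)
qed (auto simp: unitary_mult unitary_one matrix_mul_assoc matrix_vector_mul_assoc
    matrix_vector_right_distrib)

lemma affine_act_Pair [simp]: "affine_act (A, v) z = A *v z + v"
  by (simp add: affine_act_def)

lemma affine_act_mult:
  "affine_act (\<gamma> \<otimes>\<^bsub>unitary_affine_group\<^esub> \<delta>) z = affine_act \<gamma> (affine_act \<delta> z)"
  by (cases \<gamma>; cases \<delta>) (simp add: matrix_vector_mul_assoc matrix_vector_right_distrib add.assoc)

definition flat_orbit ::
    "((complex ^ 'n ^ 'n::finite) \<times> (complex ^ 'n)) set \<Rightarrow> complex ^ 'n \<Rightarrow> (complex ^ 'n) set" where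
  "flat_orbit \<Gamma> = orbit (unitary_affine_group\<lparr>carrier := \<Gamma>\<rparr>) affine_act"

lemma flat_quotient_eq: "flat_quotient \<Gamma> = quotient_manifold complex_space (flat_orbit \<Gamma>)"
  by (simp add: flat_quotient_def flat_orbit_def)

lemma flat_orbit_eq: "flat_orbit \<Gamma> z = (\<lambda>\<gamma>. affine_act \<gamma> z) ` \<Gamma>"
  unfolding flat_orbit_def orbit_def Setcompr_eq_image by simp

context
  fixes \<Gamma> :: "((complex ^ 'n ^ 'n::finite) \<times> (complex ^ 'n)) set"
  assumes \<Gamma>: "subgroup \<Gamma> unitary_affine_group"
begin

lemma affine_inverse:
  assumes "\<gamma> \<in> \<Gamma>"
  shows "\<exists>\<delta>\<in>\<Gamma>. \<delta> \<otimes>\<^bsub>unitary_affine_group\<^esub> \<gamma> = \<one>\<^bsub>unitary_affine_group\<^esub> \<and>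
    (\<forall>z. affine_act \<delta> (affine_act \<gamma> z) = z)"
proof (intro bexI conjI allI)
  let ?\<delta> = "inv\<^bsub>unitary_affine_group\<^esub> \<gamma>"
  show "?\<delta> \<in> \<Gamma>" using \<Gamma> assms by (rule subgroup.m_inv_closed)
  show eq: "?\<delta> \<otimes>\<^bsub>unitary_affine_group\<^esub> \<gamma> = \<one>\<^bsub>unitary_affine_group\<^esub>"
    using subgroup.mem_carrier[OF \<Gamma> assms] by (rule group.l_inv[OF group_unitary_affine_group])
  show "affine_act ?\<delta> (affine_act \<gamma> z) = z" for z
    unfolding affine_act_mult[symmetric] eq by simp
qed

lemma flat_orbit_eq_iff: "flat_orbit \<Gamma> z = flat_orbit \<Gamma> w \<longleftrightarrow> (\<exists>\<gamma>\<in>\<Gamma>. affine_act \<gamma> z = w)"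
proof
  assume *: "flat_orbit \<Gamma> z = flat_orbit \<Gamma> w"
  have "(mat 1, 0) \<in> \<Gamma>" using subgroup.one_closed[OF \<Gamma>] by simp
  then have "w \<in> flat_orbit \<Gamma> w" unfolding flat_orbit_eq by (rule rev_image_eqI) simp
  then have "w \<in> flat_orbit \<Gamma> z" using * by simp
  then show "\<exists>\<gamma>\<in>\<Gamma>. affine_act \<gamma> z = w" unfolding flat_orbit_eq by blast
next
  have sub: "flat_orbit \<Gamma> (affine_act \<gamma> z) \<subseteq> flat_orbit \<Gamma> z" if "\<gamma> \<in> \<Gamma>" for \<gamma> z
  proof
    fix v assume "v \<in> flat_orbit \<Gamma> (affine_act \<gamma> z)"
    then obtain \<delta> where "\<delta> \<in> \<Gamma>" "v = affine_act (\<delta> \<otimes>\<^bsub>unitary_affine_group\<^esub> \<gamma>) z"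
      unfolding flat_orbit_eq affine_act_mult by blast
    then show "v \<in> flat_orbit \<Gamma> z"
      unfolding flat_orbit_eq using subgroup.m_closed[OF \<Gamma> _ that] by blast
  qed
  assume "\<exists>\<gamma>\<in>\<Gamma>. affine_act \<gamma> z = w"
  then obtain \<gamma> where \<gamma>: "\<gamma> \<in> \<Gamma>" "affine_act \<gamma> z = w" by (rule bexE)
  then obtain \<delta> where \<delta>: "\<delta> \<in> \<Gamma>" "affine_act \<delta> w = z" using affine_inverse by metis
  show "flat_orbit \<Gamma> z = flat_orbit \<Gamma> w"
    using sub[OF \<gamma>(1), of z] sub[OF \<delta>(1), of w] unfolding \<gamma>(2) \<delta>(2) by blast
qed

lemma flat_orbit_deck:
  assumes "flat_orbit \<Gamma> z = flat_orbit \<Gamma> w"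
  shows "\<exists>d. holomorphic_vec_on d UNIV \<and> d z = w \<and> (\<forall>u. flat_orbit \<Gamma> (d u) = flat_orbit \<Gamma> u)"
proof -
  obtain \<gamma> where \<gamma>: "\<gamma> \<in> \<Gamma>" "affine_act \<gamma> z = w" using assms flat_orbit_eq_iff by blast
  have "holomorphic_vec_on (affine_act \<gamma>) UNIV"
    unfolding affine_act_def by (cases \<gamma>) (simp add: holomorphic_vec_on_affine)
  then show ?thesis using \<gamma> flat_orbit_eq_iff by metis
qed

lemma flat_orbit_open:
  assumes "open U"
  shows "open (flat_orbit \<Gamma> -` flat_orbit \<Gamma> ` U)"
proof (rule open_saturation[OF _ _ assms])
  show "flat_orbit \<Gamma> z = flat_orbit \<Gamma> w \<longleftrightarrow> (\<exists>d\<in>affine_act ` \<Gamma>. d z = w)" for z w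
    by (simp add: flat_orbit_eq_iff)
  fix d assume "d \<in> affine_act ` \<Gamma>"
  then obtain A v where "d = (\<lambda>z. A *v z + v)" by (auto simp: affine_act_def)
  then show "continuous_on UNIV d"
    using holomorphic_vec_on_continuous holomorphic_vec_on_affine by blast
qed

text \<open>For two elements with the same linear part, \<open>(A, v)\<close> times the inverse of
  \<open>(A, w)\<close> is the translation by \<open>v - w\<close>, so isolation of the identity
  separates \<open>v\<close> from \<open>w\<close>.\<close>

lemma translation_gap:
  assumes "discrete \<Gamma>"
  obtains e where "e > 0"
    "\<And>A v w. (A, v) \<in> \<Gamma> \<Longrightarrow> (A, w) \<in> \<Gamma> \<Longrightarrow> norm (v - w) < e \<Longrightarrow> v = w"
proof -
  have "(mat 1, 0) isolated_in \<Gamma>"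
    using assms subgroup.one_closed[OF \<Gamma>] by (simp add: discrete_def)
  then obtain e where e: "e > 0" "\<And>\<gamma>. \<gamma> \<in> \<Gamma> \<Longrightarrow> dist (mat 1, 0) \<gamma> < e \<Longrightarrow> \<gamma> = (mat 1, 0)"
    unfolding isolated_in_dist_Ex_iff by blast
  have "v = w" if vw: "(A, v) \<in> \<Gamma>" "(A, w) \<in> \<Gamma>" "norm (v - w) < e" for A v w
  proof -
    obtain B u where B: "(B, u) \<in> \<Gamma>" "(B, u) \<otimes>\<^bsub>unitary_affine_group\<^esub> (A, w) = (mat 1, 0)"
      using affine_inverse[OF vw(2)] by (metis surj_pair uag_simps(3))
    then have BA: "B ** A = mat 1" "u = - (B *v w)" by (auto simp: eq_neg_iff_add_eq_0 add.commute)
    then have AB: "A ** B = mat 1" by (simp add: matrix_left_right_inverse)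
    have "(A, v) \<otimes>\<^bsub>unitary_affine_group\<^esub> (B, u) \<in> \<Gamma>"
      using subgroup.m_closed[OF \<Gamma> vw(1) B(1)] .
    moreover have "(A, v) \<otimes>\<^bsub>unitary_affine_group\<^esub> (B, u) = (mat 1, v - w)"
      by (simp add: AB BA(2) matrix_vector_minus matrix_vector_mul_assoc)
    ultimately show "v = w" using e(2)[of "(mat 1, v - w)"] vw(3)
      by (simp add: dist_Pair_Pair dist_norm norm_minus_commute)
  qed
  then show thesis using e(1) that by blast
qed

end

text \<open>For each linear part there is a radius such that an element moving some point of the
  ball around \<open>z\<close> to another point of it must fix \<open>z\<close>. The smallest of
  these finitely many radii works for the whole group; an element that fixes \<open>z\<close> and
  has an involution as linear part squares to the identity, so torsion-freeness makes it
  trivial.\<close>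

lemma flat_local_injectivity:
  assumes flat: "flat_kaehler_group \<Gamma>" and fin: "finite (fst ` \<Gamma>)"
    and sq: "\<And>A. A \<in> fst ` \<Gamma> \<Longrightarrow> A ** A = mat 1"
  shows "\<exists>U. open U \<and> z \<in> U \<and> inj_on (flat_orbit \<Gamma>) U"
proof -
  have \<Gamma>: "subgroup \<Gamma> unitary_affine_group" and disc: "discrete \<Gamma>"
    and tf: "\<And>\<gamma> k::nat. \<gamma> \<in> \<Gamma> \<Longrightarrow> \<gamma> \<noteq> \<one>\<^bsub>unitary_affine_group\<^esub> \<Longrightarrow> k > 0 \<Longrightarrow>
      \<gamma> [^]\<^bsub>unitary_affine_group\<^esub> k \<noteq> \<one>\<^bsub>unitary_affine_group\<^esub>"
    using flat unfolding flat_kaehler_group_def by auto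
  obtain e where e: "e > 0"
    "\<And>A v w. (A, v) \<in> \<Gamma> \<Longrightarrow> (A, w) \<in> \<Gamma> \<Longrightarrow> norm (v - w) < e \<Longrightarrow> v = w"
    using translation_gap[OF \<Gamma> disc] by blast
  have "\<exists>r>0. \<forall>v u. (A, v) \<in> \<Gamma> \<and> u \<in> ball z r \<and> A *v u + v \<in> ball z r \<longrightarrow> A *v z + v = z" for A
  proof -
    have "\<exists>d>0. \<forall>v. (A, v) \<in> \<Gamma> \<and> norm (A *v z + v - z) < d \<longrightarrow> A *v z + v = z"
    proof (cases "\<exists>v. (A, v) \<in> \<Gamma> \<and> norm (A *v z + v - z) < e / 2 \<and> A *v z + v \<noteq> z")
      case False
      then show ?thesis using e(1) by (intro exI[of _ "e / 2"]) auto
    next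
      case True
      then obtain w where w: "(A, w) \<in> \<Gamma>" "norm (A *v z + w - z) < e / 2" "A *v z + w \<noteq> z" by blast
      show ?thesis
      \<comment> \<open>Elements with linear part \<open>A\<close> that move \<open>z\<close> by
        less than \<open>e / 2\<close> coincide. Hence none moves \<open>z\<close> by less than
        \<open>w\<close> does, and the claim holds vacuously with this bound.\<close>
      proof (intro exI[of _ "norm (A *v z + w - z)"] conjI allI impI)
        fix v assume v: "(A, v) \<in> \<Gamma> \<and> norm (A *v z + v - z) < norm (A *v z + w - z)"
        have "norm (v - w) \<le> norm (A *v z + v - z) + norm (A *v z + w - z)"
          using norm_triangle_ineq4[of "A *v z + v - z" "A *v z + w - z"] by simp
        then have "v = w" using e(2)[of A v w] v w by linarith
        then show "A *v z + v = z" using v by simp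
      qed (use w in simp)
    qed
    then obtain d where d: "d > 0"
      "\<And>v. (A, v) \<in> \<Gamma> \<Longrightarrow> norm (A *v z + v - z) < d \<Longrightarrow> A *v z + v = z" by blast
    obtain K where K: "K > 0" "\<And>v. norm (A *v v) \<le> norm v * K"
      using bounded_linear.pos_bounded[OF bounded_linear_matrix[of A]] by blast
    \<comment> \<open>Replacing \<open>z\<close> by \<open>u\<close> changes the image by at most
      \<open>K * ?r\<close>, and the image of \<open>u\<close> is within \<open>?r\<close> of
      \<open>z\<close>; the total is \<open>d\<close>.\<close>
    let ?r = "d / (K + 1)"
    show ?thesis
    proof (intro exI[of _ ?r] conjI allI impI)
      show "?r > 0" using d K by simp
      fix v u assume *: "(A, v) \<in> \<Gamma> \<and> u \<in> ball z ?r \<and> A *v u + v \<in> ball z ?r"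
      have "A *v z + v - z = A *v (z - u) + (A *v u + v - z)"
        by (simp add: matrix_vector_mult_diff_distrib)
      then have "norm (A *v z + v - z) \<le> norm (A *v (z - u)) + norm (A *v u + v - z)"
        by (metis norm_triangle_ineq)
      also have "norm (A *v (z - u)) \<le> ?r * K"
        using K(2)[of "z - u"] * K(1) by (intro order_trans[OF K(2)] mult_right_mono)
          (auto simp: dist_norm)
      also have "norm (A *v u + v - z) < ?r" using * by (simp add: dist_norm norm_minus_commute)
      also have "?r * K + ?r = ?r * (K + 1)" by (simp only: distrib_left mult_1_right)
      also have "\<dots> = d" using K(1) by simp
      finally show "A *v z + v = z" using d(2) * by simp
    qed
  qed
  then have "\<forall>A. \<exists>r. r > 0 \<and> (\<forall>v u. (A, v) \<in> \<Gamma> \<and> u \<in> ball z r \<and> A *v u + v \<in> ball z r \<longrightarrow>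
      A *v z + v = z)" by blast
  from choice[OF this] obtain r where r: "\<And>A. r A > 0"
    "\<And>A v u. (A, v) \<in> \<Gamma> \<Longrightarrow> u \<in> ball z (r A) \<Longrightarrow> A *v u + v \<in> ball z (r A) \<Longrightarrow> A *v z + v = z"
    by blast
  define \<rho> where "\<rho> = Min (insert 1 (r ` fst ` \<Gamma>))"
  have \<rho>: "\<rho> > 0" using fin r(1) by (simp add: \<rho>_def)
  have \<rho>_le: "\<rho> \<le> r A" if "(A, v) \<in> \<Gamma>" for A v
    unfolding \<rho>_def using fin that by (intro Min_le) force+
  have "inj_on (flat_orbit \<Gamma>) (ball z \<rho>)"
  proof (rule inj_onI)
    fix u w assume u: "u \<in> ball z \<rho>" and w: "w \<in> ball z \<rho>" and "flat_orbit \<Gamma> u = flat_orbit \<Gamma> w"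
    then obtain A v where Av: "(A, v) \<in> \<Gamma>" "A *v u + v = w"
      using flat_orbit_eq_iff[OF \<Gamma>] by (metis affine_act_Pair surj_pair)
    have "A *v z + v = z" using r(2)[OF Av(1), of u] \<rho>_le[OF Av(1)] u w Av(2) by auto
    \<comment> \<open>With this \<open>v\<close> the translational part \<open>A *v v + v\<close> of
      the square vanishes, because \<open>A ** A\<close> is the identity.\<close>
    then have v: "v = z - A *v z" by (simp add: algebra_simps)
    have AA: "A ** A = mat 1" using sq Av(1) by force
    have "(A, v) [^]\<^bsub>unitary_affine_group\<^esub> (2::nat) = (mat 1, 0)"
      by (simp add: numeral_2_eq_2 nat_pow_def AA v matrix_vector_mult_diff_distrib
          matrix_vector_mul_assoc)
    then have "(A, v) = (mat 1, 0)" using tf[OF Av(1), of 2] by auto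
    then show "u = w" using Av(2) by simp
  qed
  then show ?thesis using \<rho> by (intro exI[of _ "ball z \<rho>"]) simp
qed

lemma uniformized_flat_quotient:
  assumes "flat_kaehler_group \<Gamma>" and "finite (fst ` \<Gamma>)"
    and "\<And>A. A \<in> fst ` \<Gamma> \<Longrightarrow> A ** A = mat 1"
  shows "uniformized (flat_orbit \<Gamma>) (flat_quotient \<Gamma>)"
  unfolding flat_quotient_eq using assms flat_orbit_open
  by (intro uniformized_quotient flat_local_injectivity) (auto simp: flat_kaehler_group_def)

section \<open>Diagonal matrices\<close>

definition diag_mat :: "('n::finite \<Rightarrow> complex) \<Rightarrow> complex ^ 'n ^ 'n" where
  "diag_mat e = (\<chi> i j. if i = j then e i else 0)"

lemma diag_mat_nth [simp]: "diag_mat e $ i $ j = (if i = j then e i else 0)"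
  by (simp add: diag_mat_def)

lemma diag_mat_eq_iff: "diag_mat e = diag_mat f \<longleftrightarrow> e = f"
proof
  assume "diag_mat e = diag_mat f"
  then have "diag_mat e $ i $ i = diag_mat f $ i $ i" for i by simp
  then show "e = f" by (simp add: fun_eq_iff)
qed simp

lemma diag_mat_mult_vec [simp]: "diag_mat e *v z = scale_by e z"
proof -
  have "(\<Sum>j\<in>UNIV. (if i = j then e i else 0) * z $ j) = (\<Sum>j\<in>UNIV. if j = i then e i * z $ i else 0)" for i
    by (intro sum.cong) auto
  then show ?thesis by (simp add: vec_eq_iff matrix_vector_mult_def)
qed

lemma diag_mat_mult: "diag_mat e ** diag_mat f = diag_mat (\<lambda>k. e k * f k)"
proof -
  have "(\<Sum>k\<in>UNIV. (if i = k then e i else 0) * (if k = j then f k else 0)) =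
      (if i = j then e i * f i else 0)" for i j
  proof -
    have "(\<Sum>k\<in>UNIV. (if i = k then e i else 0) * (if k = j then f k else 0)) =
        (\<Sum>k\<in>UNIV. if k = i then (if i = j then e i * f i else 0) else 0)"
      by (intro sum.cong) auto
    then show ?thesis by simp
  qed
  then show ?thesis by (simp add: vec_eq_iff matrix_matrix_mult_def)
qed

lemma diag_mat_1: "diag_mat (\<lambda>_. 1) = mat 1"
  by (simp add: diag_mat_def mat_def)

lemma det_diag_mat: "det (diag_mat e) = prod e UNIV"
  by (subst det_diagonal) simp_all

lemma unitary_diag_mat:
  assumes "\<And>k. e k * cnj (e k) = 1"
  shows "unitary (diag_mat e)"
proof -
  have "conj_transpose (diag_mat e) = diag_mat (\<lambda>k. cnj (e k))"
    by (auto simp: conj_transpose_def transpose_def vec_eq_iff)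
  then show ?thesis by (simp add: unitary_iff diag_mat_mult assms diag_mat_1)
qed

lemma scale_by_1: "(\<And>k. e k = 1) \<Longrightarrow> scale_by e z = z"
  by (simp add: vec_eq_iff)

definition sign_vec :: "('n::finite \<Rightarrow> complex) \<Rightarrow> bool" where
  "sign_vec e \<longleftrightarrow> (\<forall>k. e k = 1 \<or> e k = -1) \<and> prod e UNIV = 1"

lemma sign_vec_values: "sign_vec e \<Longrightarrow> e k = 1 \<or> e k = -1"
  by (simp add: sign_vec_def)

lemma sign_at_values: "sign_at I k = 1 \<or> sign_at I k = -1"
  by (auto simp: sign_at_def power_minus1_odd uminus_power_if)

text \<open>A generator has \<open>CARD('n) - 1\<close> entries equal to \<open>-1\<close>. That
  number is even because the dimension is odd, so the generators have determinant one.\<close>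

lemma sign_vec_sign_at:
  fixes I :: "'n::finite set"
  assumes "odd CARD('n)"
  shows "sign_vec (sign_at I)"
proof -
  have "prod (sign_at I) UNIV = 1"
  proof -
    have "finite I" by simp
    then show ?thesis
    proof (induction I rule: finite_induct)
      case empty
      then show ?case by simp
    next
      case (insert i I)
      have "prod (sign_at {i}) UNIV = (-1::complex) ^ (CARD('n) - 1)"
      proof -
        have "prod (sign_at {i}) UNIV = prod (sign_at {i}) (insert i (UNIV - {i}))"
          by (simp add: insert_absorb)
        also have "\<dots> = (\<Prod>j\<in>UNIV - {i}. -1)"
          by (subst prod.insert) (auto intro!: prod.cong)
        finally show ?thesis by (simp add: card_Diff_singleton)
      qed
      also have "\<dots> = 1" using assms by simp
      finally have "prod (sign_at {i}) UNIV = 1" .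
      moreover have "sign_at (insert i I) = (\<lambda>j. sign_at {i} j * sign_at I j)"
        using sign_at_insert[OF insert.hyps(2)] by blast
      ultimately show ?case using insert.IH by (simp only: prod.distrib mult_1)
    qed
  qed
  then show ?thesis using sign_at_values unfolding sign_vec_def by blast
qed

text \<open>Determinant one makes the number of entries \<open>-1\<close> even, hence that of
  entries \<open>1\<close> odd. Removing one element from an odd set leaves an even one, so
  \<open>sign_at\<close> of this set is \<open>1\<close> exactly on it: odd index sets parametrize
  all sign matrices.\<close>

lemma sign_vec_cases:
  fixes e :: "'n::finite \<Rightarrow> complex"
  assumes "odd CARD('n)" and e: "sign_vec e"
  shows "odd (card {k. e k = 1})" and "e = sign_at {k. e k = 1}"
proof -
  let ?I = "{k. e k = 1}"
  have "prod e UNIV = prod e ?I * prod e (UNIV - ?I)"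
    by (subst prod.subset_diff[of ?I UNIV]) (auto simp: mult.commute)
  also have "prod e ?I = 1" by (intro prod.neutral) auto
  also have "prod e (UNIV - ?I) = (\<Prod>k\<in>UNIV - ?I. -1)"
    using sign_vec_values[OF e] by (intro prod.cong) auto
  finally have "(-1::complex) ^ card (UNIV - ?I) = 1" using e by (simp add: sign_vec_def)
  then have "even (card (UNIV - ?I))"
    by (simp add: uminus_power_if split: if_splits)
  moreover have "CARD('n) = card ?I + card (UNIV - ?I)"
    using card_Int_Diff[of UNIV ?I] by simp
  ultimately show odd: "odd (card ?I)" using assms(1) by simp
  show "e = sign_at ?I"
  proof
    fix k
    show "e k = sign_at ?I k"
    proof (cases "e k = 1")
      case True
      then have "card (?I - {k}) = card ?I - 1" by (simp add: card_Diff_singleton)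
      then show ?thesis using odd True by (simp add: sign_at_def)
    next
      case False
      then have "?I - {k} = ?I" "e k = -1" using sign_vec_values[OF e, of k] by auto
      then show ?thesis using odd by (simp add: sign_at_def)
    qed
  qed
qed

lemma finite_sign_vecs: "odd CARD('n) \<Longrightarrow> finite {e :: 'n::finite \<Rightarrow> complex. sign_vec e}"
  by (rule finite_subset[of _ "range sign_at"]) (use sign_vec_cases(2) in auto)

lemma sign_vec_square:
  assumes "sign_vec e"
  shows "(\<lambda>k. e k * e k) = (\<lambda>_. 1)"
proof
  show "e k * e k = 1" for k using sign_vec_values[OF assms, of k] by auto
qed

lemma sign_vec_mult:
  assumes e: "sign_vec e" and f: "sign_vec f"
  shows "sign_vec (\<lambda>k. e k * f k)"
proof -
  have "e k * f k = 1 \<or> e k * f k = -1" for k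
    using sign_vec_values[OF e, of k] sign_vec_values[OF f, of k] by auto
  then show ?thesis using e f by (simp add: sign_vec_def prod.distrib)
qed

lemma sign_vec_determined:
  assumes e: "sign_vec e" and f: "sign_vec f" and eq: "\<And>k. k \<noteq> m \<Longrightarrow> e k = f k"
  shows "e = f"
proof -
  have "prod e (UNIV - {m}) = prod f (UNIV - {m})" using eq by (intro prod.cong) auto
  moreover have "e m * prod e (UNIV - {m}) = 1" "f m * prod f (UNIV - {m}) = 1"
    using e f prod.remove[of UNIV m e] prod.remove[of UNIV m f] by (simp_all add: sign_vec_def)
  ultimately have "e m = f m" by (metis mult.left_commute mult.right_neutral)
  then show ?thesis using eq by (metis ext)
qed

text \<open>All signs but one can be prescribed freely and the determinant forces the remaining one.
  The map \<open>\<phi>\<close> reads the free signs as 0 or 1, with \<open>m\<close> the axis left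
  out.\<close>

lemma sign_group_iso:
  fixes S :: "(complex ^ 'n ^ 'n::finite) set"
  defines "S \<equiv> {diag_mat e | e. sign_vec e}"
  shows "unitary_group\<lparr>carrier := S\<rparr> \<cong>
    product_group {..<CARD('n) - 1} (\<lambda>_. integer_mod_group 2)"
proof -
  let ?n = "CARD('n)" and ?P = "product_group {..<CARD('n) - 1} (\<lambda>_. integer_mod_group 2)"
  obtain h :: "nat \<Rightarrow> 'n" where h: "bij_betw h {..<?n} UNIV"
    using ex_bij_betw_nat_finite[of "UNIV :: 'n set"] by (auto simp: atLeast0LessThan)
  have n: "?n > 0" by simp
  define m where "m = h (?n - 1)"
  have ne_m: "\<exists>i<?n - 1. k = h i" if "k \<noteq> m" for k
  proof -
    have "k \<in> h ` {..<?n}" using h by (simp add: bij_betw_def)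
    then obtain i where i: "i < ?n" "k = h i" by auto
    moreover have "i \<noteq> ?n - 1" using i that m_def by auto
    ultimately show ?thesis by (metis Suc_diff_1 less_SucE n)
  qed
  have h_m: "h i \<noteq> m" if "i < ?n - 1" for i
    using h that inj_onD[of h "{..<?n}" i "?n - 1"] unfolding m_def bij_betw_def by force
  have h_inj: "h i = h j \<longleftrightarrow> i = j" if "i < ?n - 1" "j < ?n - 1" for i j
    using h that inj_onD[of h "{..<?n}" i j] unfolding bij_betw_def by force
  define \<phi> :: "complex ^ 'n ^ 'n \<Rightarrow> nat \<Rightarrow> int" where
    "\<phi> A = (\<lambda>i\<in>{..<?n - 1}. if A $ h i $ h i = 1 then 0 else 1)" for A
  have carrier_P: "carrier ?P = {..<?n - 1} \<rightarrow>\<^sub>E {0, 1}"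
  proof -
    have "{0..<2::int} = {0, 1}" by auto
    then show ?thesis by (simp add: carrier_integer_mod_group)
  qed
  have \<phi>_mem: "\<phi> A \<in> carrier ?P" for A
    unfolding carrier_P \<phi>_def restrict_PiE_iff by simp
  have "\<phi> \<in> hom (unitary_group\<lparr>carrier := S\<rparr>) ?P"
  proof (rule homI)
    fix A B assume "A \<in> carrier (unitary_group\<lparr>carrier := S\<rparr>)" "B \<in> carrier (unitary_group\<lparr>carrier := S\<rparr>)"
    then obtain e f where e: "A = diag_mat e" "sign_vec e" and f: "B = diag_mat f" "sign_vec f"
      by (auto simp: S_def)
    have "(if e k * f k = 1 then 0 else 1 :: int) =
        ((if e k = 1 then 0 else 1) + (if f k = 1 then 0 else 1)) mod 2" for k
      using sign_vec_values[OF e(2), of k] sign_vec_values[OF f(2), of k] by auto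
    then show "\<phi> (A \<otimes>\<^bsub>unitary_group\<lparr>carrier := S\<rparr>\<^esub> B) = \<phi> A \<otimes>\<^bsub>?P\<^esub> \<phi> B"
      by (auto simp: unitary_group_def e f diag_mat_mult \<phi>_def mult_integer_mod_group fun_eq_iff)
  next
    fix A show "\<phi> A \<in> carrier ?P" by (rule \<phi>_mem)
  qed
  moreover have "bij_betw \<phi> S (carrier ?P)"
  proof (rule bij_betw_imageI)
    show "inj_on \<phi> S"
    proof (rule inj_onI)
      fix A B assume "A \<in> S" "B \<in> S" and eq: "\<phi> A = \<phi> B"
      then obtain e f where e: "A = diag_mat e" "sign_vec e" and f: "B = diag_mat f" "sign_vec f"
        by (auto simp: S_def)
      have "e k = f k" if km: "k \<noteq> m" for k
      proof -
        obtain i where i: "i < ?n - 1" "k = h i" using ne_m[OF km] by blast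
        have "\<phi> A i = \<phi> B i" using eq by simp
        then have "e k = 1 \<longleftrightarrow> f k = 1" using i e f by (auto simp: \<phi>_def split: if_splits)
        then show ?thesis using sign_vec_values[OF e(2), of k] sign_vec_values[OF f(2), of k] by auto
      qed
      then show "A = B" using sign_vec_determined[OF e(2) f(2)] e f by blast
    qed
    show "\<phi> ` S = carrier ?P"
    proof
      show "\<phi> ` S \<subseteq> carrier ?P" using \<phi>_mem by blast
      show "carrier ?P \<subseteq> \<phi> ` S"
      proof
        fix g assume "g \<in> carrier ?P"
        then have g: "g \<in> {..<?n - 1} \<rightarrow>\<^sub>E {0, 1}" unfolding carrier_P .
        define c where "c k = (if g (the_inv_into {..<?n} h k) = 0 then 1 else -1 :: complex)" for k
        define p where "p = prod c (UNIV - {m})"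
        \<comment> \<open>With the product of the other signs in position \<open>m\<close> the
          determinant is \<open>p * p\<close>, and \<open>p\<close> is a sign.\<close>
        define e where "e = c(m := p)"
        have c: "c k = 1 \<or> c k = -1" for k by (simp add: c_def)
        have sgn: "prod c A = 1 \<or> prod c A = -1" for A
        proof (induction A rule: infinite_finite_induct)
          case (insert x F)
          then show ?case using c[of x] by auto
        qed simp_all
        have "prod e UNIV = e m * prod e (UNIV - {m})" by (simp add: prod.remove[of UNIV m])
        also have "prod e (UNIV - {m}) = p" unfolding p_def e_def by (intro prod.cong) auto
        finally have "sign_vec e" using c sgn[of "UNIV - {m}"]
          by (auto simp: sign_vec_def e_def p_def[symmetric])
        moreover have "\<phi> (diag_mat e) = g"
        proof
          fix i
          show "\<phi> (diag_mat e) i = g i"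
          proof (cases "i < ?n - 1")
            case True
            have "the_inv_into {..<?n} h (h i) = i"
              using h True by (intro the_inv_into_f_f) (auto simp: bij_betw_def)
            moreover have "g i = 0 \<or> g i = 1" using g True by (auto simp: PiE_iff)
            ultimately show ?thesis using True h_m[OF True] by (auto simp: \<phi>_def e_def c_def)
          next
            case False
            then show ?thesis using g by (auto simp: \<phi>_def PiE_iff extensional_def)
          qed
        qed
        ultimately show "g \<in> \<phi> ` S" unfolding S_def by blast
      qed
    qed
  qed
  ultimately have "\<phi> \<in> iso (unitary_group\<lparr>carrier := S\<rparr>) ?P" by (simp add: iso_def)
  then show ?thesis by (rule is_isoI)
qed

section \<open>Lattices in the complex plane\<close>

text \<open>\<open>Im (cnj u * v)\<close> is the determinant of \<open>u\<close> and
  \<open>v\<close> as vectors of the real plane.\<close>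

lemma independent_iff_Im:
  fixes u v :: complex
  shows "u \<noteq> v \<and> independent {u, v} \<longleftrightarrow> Im (cnj u * v) \<noteq> 0"
proof
  assume *: "u \<noteq> v \<and> independent {u, v}"
  show "Im (cnj u * v) \<noteq> 0"
  proof
    assume 0: "Im (cnj u * v) = 0"
    then have h: "Re u * Im v = Im u * Re v" by simp
    \<comment> \<open>If the determinant vanishes, the squared norm of \<open>u\<close> times
      \<open>v\<close> is the inner product of \<open>u\<close> and \<open>v\<close> times
      \<open>u\<close>.\<close>
    have "((Re u)\<^sup>2 + (Im u)\<^sup>2) * Re v = (Re u * Re v + Im u * Im v) * Re u"
      "((Re u)\<^sup>2 + (Im u)\<^sup>2) * Im v = (Re u * Re v + Im u * Im v) * Im u"
      using h by algebra+
    then have "(norm u)\<^sup>2 *\<^sub>R v = Re (cnj u * v) *\<^sub>R u"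
      by (simp add: complex_eq_iff cmod_power2)
    moreover have "u \<noteq> 0" using * dependent_zero[of "{u, v}"] by auto
    ultimately have "v = (Re (cnj u * v) / (norm u)\<^sup>2) *\<^sub>R u"
      by (simp add: eq_vector_fraction_iff)
    then have "v \<in> span {u}" by (metis span_base span_scale insertI1)
    then show False using * by (auto simp: insert_commute[of u v] independent_insert split: if_splits)
  qed
next
  assume *: "Im (cnj u * v) \<noteq> 0"
  have "u \<noteq> v" using * by (auto simp: algebra_simps)
  moreover have "independent {u, v}"
  proof
    assume "dependent {u, v}"
    then obtain a b where ab: "a *\<^sub>R u + b *\<^sub>R v = 0" "a \<noteq> 0 \<or> b \<noteq> 0"
      using \<open>u \<noteq> v\<close> by (auto simp: dependent_finite)
    have "Im (cnj u * (a *\<^sub>R u + b *\<^sub>R v)) = b * Im (cnj u * v)"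
      "Im (cnj v * (a *\<^sub>R u + b *\<^sub>R v)) = - a * Im (cnj u * v)"
      by (simp_all add: algebra_simps)
    then show False using ab * by simp
  qed
  ultimately show "u \<noteq> v \<and> independent {u, v}" by blast
qed

lemma is_lattice_iff:
  "is_lattice \<Lambda> \<longleftrightarrow> (\<exists>u v. Im (cnj u * v) \<noteq> 0 \<and>
     \<Lambda> = {of_int a * u + of_int b * v | a b. True})"
  unfolding is_lattice_def independent_iff_Im[symmetric] by blast

text \<open>Cramer's rule for the basis \<open>u\<close>, \<open>v\<close> of the real
  plane.\<close>

lemma complex_coordinates:
  fixes u v z :: complex
  assumes "Im (cnj u * v) \<noteq> 0"
  defines "a \<equiv> - Im (cnj v * z) / Im (cnj u * v)" and "b \<equiv> Im (cnj u * z) / Im (cnj u * v)"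
  shows "z = of_real a * u + of_real b * v"
proof -
  let ?d = "Im (cnj u * v)"
  have "of_real ?d * z = of_real (- Im (cnj v * z)) * u + of_real (Im (cnj u * z)) * v"
    by (simp add: complex_eq_iff algebra_simps)
  then have "z = (of_real (- Im (cnj v * z)) * u + of_real (Im (cnj u * z)) * v) / of_real ?d"
    using assms(1) by (metis nonzero_mult_div_cancel_left of_real_eq_0_iff)
  then show ?thesis unfolding a_def b_def of_real_divide
    by (simp only: add_divide_distrib times_divide_eq_left)
qed

text \<open>The determinants of \<open>c\<close> with \<open>u\<close> and with \<open>v\<close> are
  integer multiples of that of \<open>u\<close> and \<open>v\<close>. They are at most
  \<open>?M * norm c\<close>, so for a norm below \<open>?d / ?M\<close> both integers
  vanish.\<close>

lemma lattice_gap: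
  assumes "is_lattice \<Lambda>"
  obtains e where "e > 0" "\<And>c. c \<in> \<Lambda> \<Longrightarrow> norm c < e \<Longrightarrow> c = 0"
proof -
  obtain u v where uv: "Im (cnj u * v) \<noteq> 0"
    and \<Lambda>: "\<Lambda> = {of_int a * u + of_int b * v | a b. True}"
    using assms unfolding is_lattice_iff by blast
  let ?d = "\<bar>Im (cnj u * v)\<bar>" and ?M = "norm u + norm v"
  have M: "?M > 0" using uv by (metis add_nonneg_eq_0_iff complex_cnj_zero less_le
        mult_zero_left norm_eq_zero norm_ge_zero zero_complex.sel(2) add_nonneg_nonneg)
  have "c = 0" if c: "c \<in> \<Lambda>" "norm c < ?d / ?M" for c
  proof -
    obtain a b where ab: "c = of_int a * u + of_int b * v" using c(1) \<Lambda> by blast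
    have small: "\<bar>Im (cnj w * c)\<bar> < ?d" if "w = u \<or> w = v" for w
    proof -
      have "\<bar>Im (cnj w * c)\<bar> \<le> norm w * norm c"
        by (metis abs_Im_le_cmod complex_mod_cnj norm_mult)
      also have "\<dots> \<le> ?M * norm c" using that by (intro mult_right_mono) auto
      also have "\<dots> < ?d" using c(2) M by (simp add: field_simps)
      finally show ?thesis .
    qed
    have "Im (cnj u * c) = of_int b * Im (cnj u * v)" "Im (cnj v * c) = - of_int a * Im (cnj u * v)"
      unfolding ab by (simp_all add: algebra_simps)
    then have "\<bar>of_int b\<bar> * ?d < ?d" "\<bar>of_int a\<bar> * ?d < ?d"
      using small[of u] small[of v] by (simp_all add: abs_mult)
    then have "\<bar>real_of_int a\<bar> < 1" "\<bar>real_of_int b\<bar> < 1" using uv by auto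
    then have "a = 0" "b = 0" by linarith+
    then show "c = 0" using ab by simp
  qed
  moreover have "?d / ?M > 0" using M uv by simp
  ultimately show thesis using that by blast
qed

lemma lattice_cocompact:
  assumes "is_lattice \<Lambda>"
  obtains R where "\<And>z. \<exists>c\<in>\<Lambda>. norm (z - c) \<le> R"
proof -
  obtain u v where uv: "Im (cnj u * v) \<noteq> 0"
    and \<Lambda>: "\<Lambda> = {of_int a * u + of_int b * v | a b. True}"
    using assms unfolding is_lattice_iff by blast
  have "\<exists>c\<in>\<Lambda>. norm (z - c) \<le> norm u + norm v" for z
  proof -
    obtain a b :: real where ab: "z = of_real a * u + of_real b * v"
      using complex_coordinates[OF uv] by blast
    have "z - (of_int \<lfloor>a\<rfloor> * u + of_int \<lfloor>b\<rfloor> * v) = of_real (frac a) * u + of_real (frac b) * v"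
      by (simp add: ab frac_def algebra_simps)
    also have "norm \<dots> \<le> frac a * norm u + frac b * norm v"
      by (rule order_trans[OF norm_triangle_ineq]) (simp add: norm_mult)
    also have "\<dots> \<le> 1 * norm u + 1 * norm v"
      by (intro add_mono mult_right_mono) (auto simp: frac_lt_1 less_imp_le)
    finally show ?thesis using \<Lambda> by auto
  qed
  then show thesis using that by blast
qed

section \<open>From the data to a flat Kaehler manifold\<close>

lemma biholomorphic_sym: "biholomorphic M N \<Longrightarrow> biholomorphic N M"
  unfolding biholomorphic_def using homeomorphic_maps_sym by blast

text \<open>In the product of all generators every axis collects \<open>CARD('n) - 1\<close> signs,
  an even number. That product has trivial linear part, and so the first \<open>n - 1\<close>
  factors have the linear part of the last.\<close>

lemma sign_at_below_Max:
  fixes j :: "'n::{finite,linorder}"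
  assumes odd_dim: "odd CARD('n)"
  shows "sign_at {i. i < Max (UNIV :: 'n set)} j = sign_at {Max UNIV} j"
proof -
  let ?m = "Max (UNIV :: 'n set)" and ?J = "{i. i < Max (UNIV :: 'n set)}"
  have J: "?J = UNIV - {?m}"
    using Max_ge[of "UNIV :: 'n set"] by (auto simp: less_le)
  have card: "card (UNIV - {?m}) = CARD('n) - 1" by (simp add: card_Diff_singleton)
  show ?thesis
  proof (cases "j = ?m")
    case True
    then show ?thesis using odd_dim card unfolding J by (simp add: sign_at_def)
  next
    case False
    have "card (UNIV - {?m} - {j}) = CARD('n) - 1 - 1"
      using False by (subst card_Diff_singleton) (auto simp: card)
    \<comment> \<open>Truncated subtraction: the second axis \<open>j\<close> ensures that
      \<open>CARD('n) - 1\<close> is a positive even number, so its predecessor is odd.\<close>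
    moreover have "CARD('n) - 1 > 0"
      unfolding card[symmetric] card_gt_0_iff using False by auto
    then have "odd (CARD('n) - 1 - 1)" using odd_dim by simp
    ultimately show ?thesis using False unfolding J by (simp add: sign_at_def)
  qed
qed

context torus
begin

lemma proj_saturation:
  assumes "open U"
  shows "open (proj \<Lambda> -` proj \<Lambda> ` U)"
proof (rule open_saturation[OF _ _ assms])
  let ?D = "{\<lambda>z. z + l | l. \<forall>k. l $ k \<in> \<Lambda> k}"
  show "continuous_on UNIV d" if "d \<in> ?D" for d :: "complex ^ 'n \<Rightarrow> complex ^ 'n"
    using that by (auto intro!: continuous_intros)
  show "proj \<Lambda> z = proj \<Lambda> w \<longleftrightarrow> (\<exists>d\<in>?D. d z = w)" for z w
  proof
    assume "proj \<Lambda> z = proj \<Lambda> w"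
    then have "\<forall>k. (w - z) $ k \<in> \<Lambda> k" using proj_eq_iff[of w z] by simp
    then show "\<exists>d\<in>?D. d z = w" by (intro bexI[of _ "\<lambda>u. u + (w - z)"]) auto
  next
    assume "\<exists>d\<in>?D. d z = w"
    then obtain l where "\<forall>k. l $ k \<in> \<Lambda> k" "w = z + l" by auto
    then show "proj \<Lambda> z = proj \<Lambda> w" using proj_eq_iff[of w z] by simp
  qed
qed

end

section \<open>Comparison with a flat quotient, and the affine group of the data\<close>

context chw_data
begin

lemma rel_iff_deck:
  "rel z w \<longleftrightarrow> (\<exists>I. \<exists>l\<in>L. diag_mat (sign_at I) *v z + (shift_vec b I + l) = w)"
proof -
  have "w - gam b I z \<in> L \<longleftrightarrow> (\<exists>l\<in>L. diag_mat (sign_at I) *v z + (shift_vec b I + l) = w)" for I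
  proof
    assume "w - gam b I z \<in> L"
    then show "\<exists>l\<in>L. diag_mat (sign_at I) *v z + (shift_vec b I + l) = w"
      by (rule rev_bexI) (simp add: gam_def)
  next
    assume "\<exists>l\<in>L. diag_mat (sign_at I) *v z + (shift_vec b I + l) = w"
    then show "w - gam b I z \<in> L" by (auto simp: gam_def)
  qed
  then show ?thesis by (simp add: rel_def)
qed

lemma Q_saturation:
  assumes "open U"
  shows "open (Q -` Q ` U)"
proof (rule open_saturation[OF _ _ assms])
  let ?D = "{\<lambda>z. diag_mat (sign_at I) *v z + (shift_vec b I + l) | I l. l \<in> L}"
  show "continuous_on UNIV d" if "d \<in> ?D" for d
    using that holomorphic_vec_on_continuous[OF holomorphic_vec_on_affine] by blast
  show "Q z = Q w \<longleftrightarrow> (\<exists>d\<in>?D. d z = w)" for z w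
  proof
    assume "Q z = Q w"
    then obtain I l where l: "l \<in> L" "diag_mat (sign_at I) *v z + (shift_vec b I + l) = w"
      unfolding Q_eq_iff rel_iff_deck by (elim exE bexE)
    show "\<exists>d\<in>?D. d z = w"
      by (rule bexI[of _ "\<lambda>z. diag_mat (sign_at I) *v z + (shift_vec b I + l)"]) (use l in blast)+
  next
    assume "\<exists>d\<in>?D. d z = w"
    then show "Q z = Q w" unfolding Q_eq_iff rel_iff_deck by blast
  qed
qed

abbreviation "N \<equiv> curve_sum_quotient \<Lambda> (\<lambda>i. proj \<Lambda> (b i)) W"

lemma uniformized_Q:
  assumes "\<And>z. \<exists>U. open U \<and> z \<in> U \<and> inj_on Q U"
  shows "uniformized Q N"
proof -
  let ?r = "orbit ((BijGroup (carrier (curve_sum \<Lambda>)))\<lparr>carrier := G\<rparr>) (\<lambda>g. g)"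
  have Q: "Q = (\<lambda>z. ?r (proj \<Lambda> z))" by (simp add: Q_def[abs_def])
  show ?thesis
    unfolding curve_sum_quotient_def curve_sum_manifold_eq Q
    using proj_saturation Q_saturation assms unfolding Q
    by (intro uniformized_iterated_quotient) auto
qed

text \<open>Used in both directions, with \<open>P\<close> the identity for the group built from the
  data and a diagonalizing matrix for a given group. Local injectivity of \<open>Q\<close> is not
  proved directly but transported from the flat side.\<close>

lemma biholomorphic_flat_quotient:
  fixes P P' :: "((complex, 'n) vec, 'n) vec"
  assumes \<Gamma>: "flat_kaehler_group \<Gamma>" and fin: "finite (fst ` \<Gamma>)"
    and sq: "\<And>A. A \<in> fst ` \<Gamma> \<Longrightarrow> A ** A = mat 1"
    and P: "P ** P' = mat 1" "P' ** P = mat 1"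
    and fibres: "\<And>z w. (\<exists>\<gamma>\<in>\<Gamma>. affine_act \<gamma> z = w) \<longleftrightarrow> rel (P *v z) (P *v w)"
    and M: "complex_manifold M"
  shows "biholomorphic M (flat_quotient \<Gamma>) \<longleftrightarrow> biholomorphic M N"
proof -
  have sub: "subgroup \<Gamma> unitary_affine_group" using \<Gamma> by (simp add: flat_kaehler_group_def)
  have fibres': "flat_orbit \<Gamma> z = flat_orbit \<Gamma> w \<longleftrightarrow> Q (P *v z) = Q (P *v w)" for z w
    unfolding Q_eq_iff flat_orbit_eq_iff[OF sub] by (rule fibres)
  have PP: "P *v (P' *v z) = z" "P' *v (P *v z) = z" for z
    by (simp_all add: matrix_vector_mul_assoc P)
  have hol: "holomorphic_vec_on (\<lambda>z. P *v z) UNIV" "holomorphic_vec_on (\<lambda>z. P' *v z) UNIV"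
    using holomorphic_vec_on_affine[of P 0] holomorphic_vec_on_affine[of P' 0] by simp_all
  have flat: "uniformized (flat_orbit \<Gamma>) (flat_quotient \<Gamma>)"
    using \<Gamma> fin sq by (rule uniformized_flat_quotient)
  have "\<exists>U. open U \<and> z \<in> U \<and> inj_on Q U" for z
  proof -
    obtain U where U: "open U" "P' *v z \<in> U" "inj_on (flat_orbit \<Gamma>) U"
      using flat_local_injectivity[OF \<Gamma> fin sq] by blast
    have "open ((\<lambda>z. P' *v z) -` U)"
      using U(1) holomorphic_vec_on_continuous[OF hol(2)] by (rule open_vimage)
    moreover have "inj_on Q ((\<lambda>z. P' *v z) -` U)"
    proof (rule inj_onI)
      fix u w assume "u \<in> (\<lambda>z. P' *v z) -` U" "w \<in> (\<lambda>z. P' *v z) -` U" "Q u = Q w"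
      then have "P' *v u = P' *v w"
        using fibres'[of "P' *v u" "P' *v w"] inj_onD[OF U(3)] by (simp add: PP)
      then show "u = w" by (metis PP(1))
    qed
    ultimately show ?thesis using U(2) by blast
  qed
  then have Q: "uniformized Q N" by (rule uniformized_Q)
  have bih: "biholomorphic (flat_quotient \<Gamma>) N"
    using flat Q hol PP(2,1) fibres' flat_orbit_deck[OF sub] by (rule biholomorphic_uniformized)
  note atlas = complex_manifold_section_atlas[OF M]
    uniformized_section_atlas[OF flat] uniformized_section_atlas[OF Q]
  show ?thesis
    using biholomorphic_trans[OF atlas(1,2,3) _ bih]
      biholomorphic_trans[OF atlas(1,3,2) _ biholomorphic_sym[OF bih]] by blast
qed

text \<open>The candidate for the fundamental group: the maps \<open>gam b I\<close> followed by
  translations in \<open>L\<close>, as pairs of a linear and a translational part.\<close>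

definition \<Gamma> :: "(((complex, 'n) vec, 'n) vec \<times> (complex, 'n) vec) set" where
  "\<Gamma> = {(diag_mat (sign_at I), shift_vec b I + l) | I l. l \<in> L}"

lemma \<Gamma>_orbit: "(\<exists>\<gamma>\<in>\<Gamma>. affine_act \<gamma> z = w) \<longleftrightarrow> rel z w"
  unfolding rel_iff_deck \<Gamma>_def by (auto simp del: diag_mat_mult_vec)

lemma sign_at_sym_diff_mult: "sign_at (sym_diff I J) j = sign_at J j * sign_at I j"
proof (induction J rule: infinite_finite_induct)
  case (insert i J)
  have "sym_diff I (insert i J) = sym_diff (sym_diff I J) {i}" using insert.hyps by auto
  then show ?case using insert.IH
    by (simp only: sign_at_sym_diff sign_at_insert[OF insert.hyps(2)] mult.assoc)
qed simp_all

lemma \<Gamma>_mult: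
  assumes "l \<in> L" "l' \<in> L"
  shows "\<exists>m\<in>L. (diag_mat (sign_at J), shift_vec b J + l) \<otimes>\<^bsub>unitary_affine_group\<^esub>
      (diag_mat (sign_at I), shift_vec b I + l') =
      (diag_mat (sign_at (sym_diff I J)), shift_vec b (sym_diff I J) + m)"
proof
  \<comment> \<open>The difference is the defect of \<open>gam\<close> as a homomorphism, evaluated
    at the origin; the other terms carry along the two lattice vectors.\<close>
  let ?m = "gam b J (gam b I 0) - gam b (sym_diff I J) 0 + scale_by (sign_at J) l' + l"
  show "?m \<in> L" by (rule add[OF add[OF gam_mult scale_sign[OF assms(2)]] assms(1)])
  have "diag_mat (sign_at J) ** diag_mat (sign_at I) = diag_mat (sign_at (sym_diff I J))"
    unfolding diag_mat_mult diag_mat_eq_iff by (simp only: fun_eq_iff sign_at_sym_diff_mult) simp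
  then show "(diag_mat (sign_at J), shift_vec b J + l) \<otimes>\<^bsub>unitary_affine_group\<^esub>
      (diag_mat (sign_at I), shift_vec b I + l') =
      (diag_mat (sign_at (sym_diff I J)), shift_vec b (sym_diff I J) + ?m)"
    by (simp add: scale_by_add gam_def[of b J])
qed

lemma unitary_sign_at: "unitary (diag_mat (sign_at I))"
proof (rule unitary_diag_mat)
  fix k show "sign_at I k * cnj (sign_at I k) = 1" using sign_at_values[of I k] by auto
qed

lemma \<Gamma>_translation: "l \<in> L \<Longrightarrow> (mat 1, l) \<in> \<Gamma>"
  unfolding \<Gamma>_def by (rule CollectI, rule exI[of _ "{}"], rule exI[of _ l])
    (simp add: diag_mat_1[symmetric] diag_mat_eq_iff fun_eq_iff)

lemma subgroup_\<Gamma>: "subgroup \<Gamma> unitary_affine_group"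
proof (rule subgroup.intro)
  show "\<Gamma> \<subseteq> carrier unitary_affine_group" by (auto simp: \<Gamma>_def unitary_sign_at)
  show m_closed: "\<gamma> \<otimes>\<^bsub>unitary_affine_group\<^esub> \<delta> \<in> \<Gamma>" if "\<gamma> \<in> \<Gamma>" "\<delta> \<in> \<Gamma>" for \<gamma> \<delta>
    using that \<Gamma>_mult unfolding \<Gamma>_def by blast
  show "\<one>\<^bsub>unitary_affine_group\<^esub> \<in> \<Gamma>" using \<Gamma>_translation[OF zero] by simp
  fix \<gamma> assume \<gamma>: "\<gamma> \<in> \<Gamma>"
  obtain I l where Il: "\<gamma> = (diag_mat (sign_at I), shift_vec b I + l)" "l \<in> L"
    using \<gamma> unfolding \<Gamma>_def by blast
  have car: "\<Gamma> \<subseteq> carrier unitary_affine_group" by (auto simp: \<Gamma>_def unitary_sign_at)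
  obtain m where m: "m \<in> L" "\<gamma> \<otimes>\<^bsub>unitary_affine_group\<^esub> \<gamma> = (mat 1, m)"
  proof -
    obtain m where "m \<in> L" "\<gamma> \<otimes>\<^bsub>unitary_affine_group\<^esub> \<gamma> =
      (diag_mat (sign_at (sym_diff I I)), shift_vec b (sym_diff I I) + m)"
      using \<Gamma>_mult[OF Il(2) Il(2)] Il(1) by blast
    moreover have "diag_mat (sign_at {}) = mat 1"
      by (simp add: diag_mat_1[symmetric] diag_mat_eq_iff fun_eq_iff)
    ultimately show thesis using that by simp
  qed
  \<comment> \<open>Every element squares to a translation \<open>m\<close> in \<open>L\<close>, so
    an inverse is obtained by undoing that translation after one more application.\<close>
  let ?\<delta> = "(mat 1, - m) \<otimes>\<^bsub>unitary_affine_group\<^esub> \<gamma>"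
  have \<delta>: "?\<delta> \<in> \<Gamma>" using m_closed \<Gamma>_translation[OF neg[OF m(1)]] \<gamma> by blast
  interpret U: group "unitary_affine_group :: ((((complex, 'n) vec, 'n) vec) \<times> _) monoid"
    by (rule group_unitary_affine_group)
  have "?\<delta> \<otimes>\<^bsub>unitary_affine_group\<^esub> \<gamma> =
      (mat 1, - m) \<otimes>\<^bsub>unitary_affine_group\<^esub> (\<gamma> \<otimes>\<^bsub>unitary_affine_group\<^esub> \<gamma>)"
    using car \<gamma> \<Gamma>_translation[OF neg[OF m(1)]] by (intro U.m_assoc) blast+
  also have "\<dots> = \<one>\<^bsub>unitary_affine_group\<^esub>" by (simp add: m(2))
  finally have "inv\<^bsub>unitary_affine_group\<^esub> \<gamma> = ?\<delta>"
    using car \<gamma> \<delta> by (intro U.inv_equality) blast+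
  then show "inv\<^bsub>unitary_affine_group\<^esub> \<gamma> \<in> \<Gamma>" using \<delta> by simp
qed

end

text \<open>The lattices give discreteness and cocompactness, \<open>last\<close> reduces all index
  sets to odd ones, and \<open>generic\<close> excludes torsion.\<close>

locale chw_full = chw_data \<Lambda> b W
  for \<Lambda> :: "'n::{finite,linorder} \<Rightarrow> complex set" and b W +
  assumes lattice: "is_lattice (\<Lambda> k)" and odd_dim: "odd CARD('n)"
    and generic: "odd (card I) \<Longrightarrow> I \<noteq> UNIV \<Longrightarrow> y \<in> W \<Longrightarrow>
      \<exists>j\<in>I. x_set \<Lambda> (\<lambda>i. proj \<Lambda> (b i)) I j \<noteq> y j"
    and last: "proj \<Lambda> (b (Max UNIV)) j = x_set \<Lambda> (\<lambda>i. proj \<Lambda> (b i)) {i. i < Max UNIV} j"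
begin

text \<open>The product of all the generators is a translation by an element of \<open>L\<close>: up to \<open>L\<close> its first
  \<open>n - 1\<close> factors multiply to the last one, and the generators are involutions.\<close>

lemma gam_UNIV: "gam b UNIV z - z \<in> L"
proof -
  let ?m = "Max (UNIV :: 'n set)" and ?J = "{i. i < Max (UNIV :: 'n set)}"
  have J: "?J = UNIV - {?m}"
    using Max_ge[of "UNIV :: 'n set"] by (auto simp: less_le)
  have "gam b ?J z - gam b {?m} z \<in> L"
  proof (rule L_I)
    fix k
    have "b ?m $ k - shift_vec b ?J $ k \<in> \<Lambda> k"
      using last[of k] unfolding x_set_proj by (simp add: proj_def C.cls_eq_iff)
    then have "shift_vec b ?J $ k - b ?m $ k \<in> \<Lambda> k" using C.neg by fastforce
    then show "(gam b ?J z - gam b {?m} z) $ k \<in> \<Lambda> k"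
      by (simp add: gam_def sign_at_below_Max[OF odd_dim] del: gam_singleton_nth)
  qed
  then have "gam b {?m} (gam b ?J z) - gam b {?m} (gam b {?m} z) \<in> L" by (rule gam_cong)
  moreover have "gam b {?m} (gam b {?m} z) - z \<in> L" by (rule square)
  moreover have "gam b {?m} (gam b ?J z) - gam b UNIV z \<in> L"
  proof -
    have "sym_diff ?J {?m} = UNIV" using J by auto
    then show ?thesis using gam_singleton_mult[of ?m ?J z] by simp
  qed
  ultimately show ?thesis using cong_sym cong_trans by meson
qed

text \<open>Condition (ii) speaks of odd index sets only. In odd dimension the complement of an even
  set is odd, and passing to it costs just an element of \<open>L\<close>, since the product of all
  generators is a translation in \<open>L\<close>.\<close>

lemma \<Gamma>_odd_representative:
  assumes "\<gamma> \<in> \<Gamma>"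
  obtains I l where "odd (card I)" "l \<in> L" "\<gamma> = (diag_mat (sign_at I), shift_vec b I + l)"
proof -
  obtain I l where Il: "l \<in> L" "\<gamma> = (diag_mat (sign_at I), shift_vec b I + l)"
    using assms unfolding \<Gamma>_def by blast
  show thesis
  proof (cases "odd (card I)")
    case True
    then show thesis using Il that by blast
  next
    case False
    let ?J = "UNIV - I"
    have "CARD('n) = card I + card ?J" using card_Int_Diff[of UNIV I] by simp
    then have odd: "odd (card ?J)" using False odd_dim by simp
    have sd: "sym_diff I UNIV = ?J" by auto
    have "gam b UNIV (gam b I 0) - gam b I 0 \<in> L" by (rule gam_UNIV)
    moreover have "gam b UNIV (gam b I 0) - gam b ?J 0 \<in> L" using gam_mult[of UNIV I 0] sd by simp
    ultimately have "gam b I 0 - gam b ?J 0 \<in> L" using cong_sym cong_trans by meson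
    then have "shift_vec b I - shift_vec b ?J + l \<in> L" using Il(1) add by simp
    moreover have "sign_at I = sign_at ?J"
    proof
      fix j
      have "sign_at ?J j = sign_at UNIV j * sign_at I j"
        using sign_at_sym_diff_mult[of I UNIV j] sd by simp
      moreover have "sign_at UNIV j = 1"
        using odd_dim by (simp add: sign_at_def card_Diff_singleton)
      ultimately show "sign_at I j = sign_at ?J j" by simp
    qed
    ultimately show thesis using that[OF odd, of "shift_vec b I - shift_vec b ?J + l"] Il(2) by simp
  qed
qed

lemma sign_at_odd: "odd (card I) \<Longrightarrow> sign_at I j = (if j \<in> I then 1 else -1)"
  by (auto simp: sign_at_def card_Diff_singleton)

lemma power_translation_coordinate:
  assumes "e j = 1"
  shows "affine_act ((diag_mat e, v) [^]\<^bsub>unitary_affine_group\<^esub> (k::nat)) z $ j = z $ j + of_nat k * v $ j"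
proof (induction k arbitrary: z)
  case 0
  then show ?case by (simp add: nat_pow_def)
next
  case (Suc k)
  have "(diag_mat e, v) [^]\<^bsub>unitary_affine_group\<^esub> Suc k =
      (diag_mat e, v) [^]\<^bsub>unitary_affine_group\<^esub> k \<otimes>\<^bsub>unitary_affine_group\<^esub> (diag_mat e, v)"
    by (simp add: nat_pow_def)
  then show ?case by (simp only: affine_act_mult Suc) (simp add: assms algebra_simps)
qed

text \<open>For odd \<open>I\<close> the axes in \<open>I\<close> are exactly those with sign
  \<open>1\<close>. On one of them the element translates by a nonzero amount, and its
  \<open>k\<close>-th power translates by \<open>k\<close> times that amount.\<close>

lemma \<Gamma>_torsion_free:
  assumes "\<gamma> \<in> \<Gamma>" "\<gamma> \<noteq> \<one>\<^bsub>unitary_affine_group\<^esub>" "k > (0::nat)"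
  shows "\<gamma> [^]\<^bsub>unitary_affine_group\<^esub> k \<noteq> \<one>\<^bsub>unitary_affine_group\<^esub>"
proof
  assume pow: "\<gamma> [^]\<^bsub>unitary_affine_group\<^esub> k = \<one>\<^bsub>unitary_affine_group\<^esub>"
  obtain I l where I: "odd (card I)" and l: "l \<in> L"
    and \<gamma>: "\<gamma> = (diag_mat (sign_at I), shift_vec b I + l)"
    using assms(1) by (rule \<Gamma>_odd_representative)
  obtain j where j: "j \<in> I" "(shift_vec b I + l) $ j \<noteq> 0"
  proof (cases "I = UNIV")
    case True
    then have "sign_at I = (\<lambda>_. 1)" using sign_at_odd[OF I] by auto
    then have "shift_vec b I + l \<noteq> 0" using assms(2) \<gamma> by (auto simp: diag_mat_1)
    then show thesis using that True by (auto simp: vec_eq_iff)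
  next
    case False
    \<comment> \<open>Condition (ii) for this point of \<open>W\<close> says that
      \<open>shift_vec b I + l\<close> avoids the lattice on some axis in \<open>I\<close>; in
      particular it is nonzero there.\<close>
    have "proj \<Lambda> (- l) \<in> W" using neg[OF l] by (simp add: L_def)
    then obtain j where j: "j \<in> I" "x_set \<Lambda> (\<lambda>i. proj \<Lambda> (b i)) I j \<noteq> proj \<Lambda> (- l) j"
      using generic[OF I False] by blast
    then have "shift_vec b I $ j - (- l) $ j \<notin> \<Lambda> j"
      unfolding x_set_proj by (simp add: proj_def C.cls_eq_iff)
    then have "(shift_vec b I + l) $ j \<noteq> 0" using C.zero by auto
    then show thesis using that j by blast
  qed
  have "sign_at I j = 1" using sign_at_odd[OF I] j by simp
  then have "affine_act (\<gamma> [^]\<^bsub>unitary_affine_group\<^esub> k) 0 $ j = of_nat k * (shift_vec b I + l) $ j"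
    unfolding \<gamma> by (subst power_translation_coordinate) simp_all
  moreover have "affine_act (\<gamma> [^]\<^bsub>unitary_affine_group\<^esub> k) 0 $ j = 0" by (simp add: pow)
  ultimately show False using j assms(3) by simp
qed

section \<open>Discreteness and cocompactness\<close>

lemma L_gap: "\<exists>e>0. \<forall>l\<in>L. norm l < e \<longrightarrow> l = 0"
proof -
  have "\<forall>k. \<exists>e>0. \<forall>c\<in>\<Lambda> k. norm c < e \<longrightarrow> c = 0"
    using lattice_gap[OF lattice] by metis
  from choice[OF this] obtain e where e: "\<And>k. e k > 0"
    "\<And>k c. c \<in> \<Lambda> k \<Longrightarrow> norm c < e k \<Longrightarrow> c = 0" by blast
  \<comment> \<open>Only the double of an element of \<open>L\<close> has its coordinates in the
    curve lattices, hence half of their smallest gap.\<close>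
  let ?e = "Min (range e) / 2"
  have "l = 0" if l: "l \<in> L" "norm l < ?e" for l
  proof -
    have "l $ k = 0" for k
    proof -
      have "norm (2 * l $ k) \<le> 2 * norm l"
        using Finite_Cartesian_Product.norm_nth_le[of l k] by (simp add: norm_mult)
      also have "\<dots> < Min (range e)" using l(2) by linarith
      also have "\<dots> \<le> e k" by simp
      finally show ?thesis using e(2)[of "2 * l $ k" k] W_torsion l(1) by (simp add: L_def)
    qed
    then show ?thesis by (simp add: vec_eq_iff)
  qed
  moreover have "?e > 0" using e(1) by simp
  ultimately show ?thesis by blast
qed

text \<open>Different signs are at distance 2, and no entry of a matrix exceeds its norm.\<close>

lemma diag_mat_sign_dist:
  assumes "dist (diag_mat (sign_at I)) (diag_mat (sign_at J)) < 2"
  shows "sign_at I = sign_at J"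
proof
  fix k
  have "norm ((diag_mat (sign_at I) - diag_mat (sign_at J)) $ k $ k) < 2"
    using Finite_Cartesian_Product.norm_nth_le[of "diag_mat (sign_at I) - diag_mat (sign_at J)" k]
      Finite_Cartesian_Product.norm_nth_le[of "(diag_mat (sign_at I) - diag_mat (sign_at J)) $ k" k]
      assms by (simp add: dist_norm)
  then show "sign_at I k = sign_at J k"
    using sign_at_values[of I k] sign_at_values[of J k] by auto
qed

text \<open>Odd representatives matter here: complementary sets give the same signs, but among odd
  sets the linear part determines the set. Close elements thus share their index set and differ by a
  short vector of \<open>L\<close>.\<close>

lemma discrete_\<Gamma>: "discrete \<Gamma>"
proof -
  obtain e where e: "e > 0" "\<And>l. l \<in> L \<Longrightarrow> norm l < e \<Longrightarrow> l = 0" using L_gap by blast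
  have "\<gamma> = \<delta>" if \<gamma>: "\<gamma> \<in> \<Gamma>" and \<delta>: "\<delta> \<in> \<Gamma>" and d: "dist \<gamma> \<delta> < min e 2" for \<gamma> \<delta>
  proof -
    obtain I l where I: "odd (card I)" "l \<in> L" "\<gamma> = (diag_mat (sign_at I), shift_vec b I + l)"
      using \<gamma> by (rule \<Gamma>_odd_representative)
    obtain J m where J: "odd (card J)" "m \<in> L" "\<delta> = (diag_mat (sign_at J), shift_vec b J + m)"
      using \<delta> by (rule \<Gamma>_odd_representative)
    have "dist (fst \<gamma>) (fst \<delta>) < 2" "dist (snd \<gamma>) (snd \<delta>) < e"
      using d dist_fst_le[of \<gamma> \<delta>] dist_snd_le[of \<gamma> \<delta>] by linarith+
    then have s: "sign_at I = sign_at J" and n: "norm (shift_vec b I + l - (shift_vec b J + m)) < e"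
      using diag_mat_sign_dist I(3) J(3) by (simp_all add: dist_norm)
    have "i \<in> I \<longleftrightarrow> i \<in> J" for i
      using s sign_at_odd[OF I(1), of i] sign_at_odd[OF J(1), of i] by (auto split: if_splits)
    then have "I = J" by blast
    then have "l - m = 0" using e(2)[of "l - m"] n I(2) J(2) diff by simp
    then show "\<gamma> = \<delta>" using I(3) J(3) \<open>I = J\<close> by simp
  qed
  then have "uniform_discrete \<Gamma>" unfolding uniform_discrete_def using e(1)
    by (intro exI[of _ "min e 2"]) auto
  then show ?thesis by (rule uniform_discrete_imp_discrete)
qed

text \<open>Translations by the product of the lattices already bring every point into a fixed
  closed ball, so the quotient is the continuous image of a compact set.\<close>

lemma compact_flat_quotient: "compact_space (ctop (flat_quotient \<Gamma>))"
proof -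
  have "\<forall>k. \<exists>R. \<forall>z. \<exists>c\<in>\<Lambda> k. norm (z - c) \<le> R"
    using lattice_cocompact[OF lattice] by metis
  from choice[OF this] obtain R where R: "\<And>k z. \<exists>c\<in>\<Lambda> k. norm (z - c) \<le> R k" by blast
  let ?K = "cball (0 :: (complex, 'n) vec) (sum R UNIV)" and ?p = "flat_orbit \<Gamma>"
  have "\<exists>w\<in>?K. ?p z = ?p w" for z
  proof -
    have "\<forall>k. \<exists>c\<in>\<Lambda> k. norm (z $ k - c) \<le> R k" using R by blast
    then obtain c where c: "\<And>k. c k \<in> \<Lambda> k" "\<And>k. norm (z $ k - c k) \<le> R k" by metis
    let ?l = "\<chi> k. - c k"
    have "?l \<in> L" using c(1) C.neg by (intro L_I) simp
    then have "?p z = ?p (z + ?l)"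
      unfolding flat_orbit_eq_iff[OF subgroup_\<Gamma>] \<Gamma>_orbit by (rule rel_add)
    moreover have "norm (z + ?l) \<le> (\<Sum>k\<in>UNIV. norm ((z + ?l) $ k))"
      unfolding norm_vec_def by (rule L2_set_le_sum) simp
    then have "z + ?l \<in> ?K" using c(2) sum_mono[of UNIV "\<lambda>k. norm ((z + ?l) $ k)" R] by simp
    ultimately show ?thesis by blast
  qed
  then have range: "topspace (ctop (flat_quotient \<Gamma>)) = ?p ` ?K"
    unfolding flat_quotient_eq topspace_quotient_complex_space by blast
  have "continuous_map euclidean (ctop (flat_quotient \<Gamma>)) ?p"
    by (simp add: continuous_map_def flat_quotient_eq topspace_quotient_complex_space
        ctop_quotient_complex_space vimage_def)
  moreover have "compactin euclidean ?K" by simp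
  ultimately have "compactin (ctop (flat_quotient \<Gamma>)) (?p ` ?K)" by (intro image_compactin)
  then show ?thesis unfolding compact_space_def range .
qed

lemma flat_kaehler_group_\<Gamma>: "flat_kaehler_group \<Gamma>"
  unfolding flat_kaehler_group_def
  using subgroup_\<Gamma> discrete_\<Gamma> compact_flat_quotient \<Gamma>_torsion_free by blast

lemma linear_parts: "fst ` \<Gamma> = {diag_mat e | e. sign_vec e}"
proof
  show "fst ` \<Gamma> \<subseteq> {diag_mat e | e. sign_vec e}"
    using sign_vec_sign_at[OF odd_dim] by (auto simp: \<Gamma>_def)
  show "{diag_mat e | e. sign_vec e} \<subseteq> fst ` \<Gamma>"
  proof clarify
    fix e :: "'n \<Rightarrow> complex" assume "sign_vec e"
    then have "e = sign_at {k. e k = 1}" by (rule sign_vec_cases(2)[OF odd_dim])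
    moreover have "(diag_mat (sign_at {k. e k = 1}), shift_vec b {k. e k = 1} + 0) \<in> \<Gamma>"
      unfolding \<Gamma>_def using zero by blast
    ultimately show "diag_mat e \<in> fst ` \<Gamma>" by (metis fst_conv image_eqI)
  qed
qed

lemma chw_manifold_if:
  assumes "complex_manifold M" and "biholomorphic M N"
  shows "chw_manifold M"
  unfolding chw_manifold_def
proof (intro exI[of _ \<Gamma>] conjI ballI)
  show "flat_kaehler_group \<Gamma>" by (rule flat_kaehler_group_\<Gamma>)
  show "holonomy_group \<Gamma> \<cong> product_group {..<CARD('n) - 1} (\<lambda>_. integer_mod_group 2)"
    unfolding holonomy_group_def linear_parts by (rule sign_group_iso)
  show "det A = 1" if "A \<in> carrier (holonomy_group \<Gamma>)" for A
    using that unfolding holonomy_group_def linear_parts by (auto simp: det_diag_mat sign_vec_def)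
  have "fst ` \<Gamma> = (\<lambda>I. diag_mat (sign_at I)) ` UNIV"
    using zero by (force simp: \<Gamma>_def)
  then have "finite (fst ` \<Gamma>)" by simp
  moreover have "A ** A = mat 1" if "A \<in> fst ` \<Gamma>" for A
  proof -
    obtain I where "A = diag_mat (sign_at I)" using \<open>A \<in> fst ` \<Gamma>\<close> by (auto simp: \<Gamma>_def)
    then show ?thesis by (simp add: diag_mat_mult sign_at_square diag_mat_1)
  qed
  ultimately have "biholomorphic M (flat_quotient \<Gamma>) \<longleftrightarrow> biholomorphic M N"
    by (rule biholomorphic_flat_quotient[OF flat_kaehler_group_\<Gamma>, where P = "mat 1" and P' = "mat 1"])
      (simp_all add: \<Gamma>_orbit assms(1))
  then show "biholomorphic M (flat_quotient \<Gamma>)" using assms(2) by blast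
qed

end

section \<open>Recognizing lattices\<close>

text \<open>The squared norm of \<open>cnj x * y\<close> is the sum of the squares of its two parts,
  so a nonzero imaginary part makes the Cauchy-Schwarz inequality strict.\<close>

lemma norm_add_less:
  fixes x y :: complex
  assumes "Im (cnj x * y) \<noteq> 0"
  shows "norm (x + y) < norm x + norm y"
proof (rule power2_less_imp_less)
  have "(Re (cnj x * y))\<^sup>2 < (Re (cnj x * y))\<^sup>2 + (Im (cnj x * y))\<^sup>2" using assms by simp
  also have "\<dots> = (norm x * norm y)\<^sup>2"
    by (metis cmod_power2 complex_mod_cnj norm_mult)
  finally have "Re (cnj x * y) < norm x * norm y"
    by (rule power2_less_imp_less) simp
  moreover have "(norm (x + y))\<^sup>2 = (norm x)\<^sup>2 + (norm y)\<^sup>2 + 2 * Re (cnj x * y)"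
    unfolding cmod_power2 by (simp add: power2_eq_square algebra_simps)
  ultimately show "(norm (x + y))\<^sup>2 < (norm x + norm y)\<^sup>2"
    by (simp add: power2_sum)
qed simp

text \<open>A basis consists of a shortest nonzero vector \<open>u\<close> and a shortest vector \<open>v\<close> off the line
  through \<open>u\<close>: an element reduced to coordinates of absolute value at most \<open>1/2\<close> is shorter than \<open>v\<close>,
  hence on the line, and then shorter than \<open>u\<close>.\<close>

lemma is_lattice_if_discrete_cocompact:
  assumes sub: "subgroup \<Lambda> complex_group"
    and gap: "e > 0" "\<And>c. c \<in> \<Lambda> \<Longrightarrow> norm c < e \<Longrightarrow> c = 0"
    and dense: "\<And>z. \<exists>c\<in>\<Lambda>. norm (z - c) \<le> R"
  shows "is_lattice \<Lambda>"
proof -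
  interpret curve \<Lambda> using sub by (rule curve.intro)
  have diff: "x - y \<in> \<Lambda>" if "x \<in> \<Lambda>" "y \<in> \<Lambda>" for x y
    using add[OF that(1) neg[OF that(2)]] by simp
  have int_mult: "of_int m * x \<in> \<Lambda>" if "x \<in> \<Lambda>" for m x
  proof (induction m rule: int_induct[of _ 0])
    case (step1 i)
    then show ?case using add[OF _ that] by (simp only: of_int_add of_int_1 distrib_right mult_1_left)
  next
    case (step2 i)
    then show ?case using diff[OF _ that] by (simp only: of_int_diff of_int_1 left_diff_distrib mult_1_left)
  qed (use zero in simp)
  have fin: "finite {c \<in> \<Lambda>. norm c \<le> r}" for r
  proof -
    have "uniform_discrete {c \<in> \<Lambda>. norm c \<le> r}"
      unfolding uniform_discrete_def
    proof (intro exI[of _ e] conjI ballI impI)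
      fix x y assume "x \<in> {c \<in> \<Lambda>. norm c \<le> r}" "y \<in> {c \<in> \<Lambda>. norm c \<le> r}" "dist x y < e"
      then have "x - y = 0" by (intro gap(2) diff) (auto simp: dist_norm)
      then show "x = y" by simp
    qed (use gap in simp)
    moreover have "bounded {c \<in> \<Lambda>. norm c \<le> r}" by (auto intro!: boundedI)
    ultimately show ?thesis using uniform_discrete_finite_iff by blast
  qed
  have shortest: "\<exists>u\<in>\<Lambda>. P u \<and> (\<forall>c\<in>\<Lambda>. P c \<longrightarrow> norm u \<le> norm c)" if ex: "\<exists>c\<in>\<Lambda>. P c" for P
  proof -
    obtain c0 where c0: "c0 \<in> \<Lambda>" "P c0" using ex by blast
    let ?S = "{c \<in> \<Lambda>. norm c \<le> norm c0 \<and> P c}"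
    have "finite ?S" by (rule finite_subset[OF _ fin[of "norm c0"]]) auto
    moreover have "?S \<noteq> {}" using c0 by auto
    ultimately obtain u where u: "u \<in> ?S" "\<And>c. c \<in> ?S \<Longrightarrow> norm u \<le> norm c"
      using that[of "arg_min_on norm ?S"] arg_min_if_finite(1)[of ?S norm]
        arg_min_least[of ?S _ norm] by blast
    have "norm u \<le> norm c" if "c \<in> \<Lambda>" "P c" for c
      using u(1) u(2)[of c] that by (cases "norm c \<le> norm c0") auto
    then show ?thesis using u(1) by blast
  qed
  have R: "R \<ge> 0" using dense[of 0] by (metis norm_ge_zero order_trans)
  \<comment> \<open>The point \<open>R + 1\<close> is further than \<open>R\<close> from the origin,
    so the lattice point near it is nonzero.\<close>
  obtain c where "c \<in> \<Lambda>" "norm (of_real (R + 1) - c) \<le> R" using dense by blast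
  then have "c \<in> \<Lambda> \<and> c \<noteq> 0" using R by (auto simp del: of_real_add)
  then obtain u where u: "u \<in> \<Lambda>" "u \<noteq> 0" "\<And>c. c \<in> \<Lambda> \<Longrightarrow> c \<noteq> 0 \<Longrightarrow> norm u \<le> norm c"
    using shortest[of "\<lambda>c. c \<noteq> 0"] by blast
  \<comment> \<open>A vector perpendicular to \<open>u\<close> of length \<open>R + 1\<close>:
    whatever lies within \<open>R\<close> of it is off the line through \<open>u\<close>.\<close>
  define z where "z = \<i> * u * of_real ((R + 1) / norm u)"
  obtain c' where c': "c' \<in> \<Lambda>" "norm (z - c') \<le> R" using dense by blast
  have "Im (cnj u * c') \<noteq> 0"
  proof
    assume "Im (cnj u * c') = 0"
    moreover have "cnj u * z = \<i> * of_real (norm u * (R + 1))"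
    proof -
      have "cnj u * z = \<i> * (u * cnj u) * of_real ((R + 1) / norm u)" by (simp add: z_def mult_ac)
      also have "u * cnj u = of_real (norm u * norm u)"
        by (metis complex_norm_square of_real_power power2_eq_square)
      also have "\<i> * of_real (norm u * norm u) * of_real ((R + 1) / norm u) =
          \<i> * of_real (norm u * norm u * ((R + 1) / norm u))"
        by (simp only: of_real_mult mult.assoc)
      also have "norm u * norm u * ((R + 1) / norm u) = norm u * (R + 1)" using u(2) by simp
      finally show ?thesis .
    qed
    ultimately have "Im (cnj u * (z - c')) = norm u * (R + 1)" by (simp add: right_diff_distrib)
    moreover have "\<bar>Im (cnj u * (z - c'))\<bar> \<le> norm u * norm (z - c')"
      by (metis abs_Im_le_cmod complex_mod_cnj norm_mult)
    moreover have "norm u * norm (z - c') \<le> norm u * R" using c'(2) by (intro mult_left_mono) auto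
    ultimately have "norm u * (R + 1) \<le> norm u * R" by linarith
    then show False using u(2) by simp
  qed
  then obtain v where v: "v \<in> \<Lambda>" "Im (cnj u * v) \<noteq> 0"
    "\<And>c. c \<in> \<Lambda> \<Longrightarrow> Im (cnj u * c) \<noteq> 0 \<Longrightarrow> norm v \<le> norm c"
    using shortest[of "\<lambda>c. Im (cnj u * c) \<noteq> 0"] c'(1) by blast
  have "v \<noteq> 0" using v(2) by auto
  then have uv: "norm u \<le> norm v" using u(3) v(1) by blast
  have "\<exists>m n. c = of_int m * u + of_int n * v" if c: "c \<in> \<Lambda>" for c
  proof -
    obtain a b :: real where ab: "c = of_real a * u + of_real b * v"
      using complex_coordinates[OF v(2)] by blast
    define a' where "a' = a - of_int (round a)"
    define b' where "b' = b - of_int (round b)"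
    have small: "\<bar>a'\<bar> \<le> 1 / 2" "\<bar>b'\<bar> \<le> 1 / 2"
      unfolding a'_def b'_def using of_int_round_abs_le[of a] of_int_round_abs_le[of b]
      by (simp_all add: abs_minus_commute)
    define d where "d = of_real a' * u + of_real b' * v"
    have d: "d = c - (of_int (round a) * u + of_int (round b) * v)"
      by (simp add: d_def a'_def b'_def ab algebra_simps)
    have "d \<in> \<Lambda>" unfolding d using c u(1) v(1) by (intro diff add int_mult)
    have Im_d: "Im (cnj u * d) = b' * Im (cnj u * v)" by (simp add: d_def algebra_simps)
    have norm_bound: "\<bar>a'\<bar> * norm u + \<bar>b'\<bar> * norm v \<le> norm v"
    proof -
      have "\<bar>a'\<bar> * norm u \<le> 1 / 2 * norm v" using small uv by (intro mult_mono) auto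
      moreover have "\<bar>b'\<bar> * norm v \<le> 1 / 2 * norm v" using small by (intro mult_right_mono) auto
      ultimately show ?thesis by simp
    qed
    have "b' = 0"
    proof (rule ccontr)
      assume b': "b' \<noteq> 0"
      have "norm d < norm v"
      \<comment> \<open>The bound above yields only \<open>norm d \<le> norm v\<close>, with
        equality conceivable if \<open>u\<close> and \<open>v\<close> are equally long. Strictness
        comes from the strict triangle inequality, or from the single factor \<open>1/2\<close> if
        \<open>a'\<close> vanishes.\<close>
      proof (cases "a' = 0")
        case True
        then have "norm d = \<bar>b'\<bar> * norm v" by (simp add: d_def norm_mult)
        also have "\<dots> \<le> 1 / 2 * norm v" using small by (intro mult_right_mono) auto
        finally show ?thesis using \<open>v \<noteq> 0\<close> zero_less_norm_iff[of v] by linarith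
      next
        case False
        have "Im (cnj (of_real a' * u) * (of_real b' * v)) = a' * b' * Im (cnj u * v)"
          by (simp add: algebra_simps)
        then have "norm d < norm (of_real a' * u) + norm (of_real b' * v)"
          unfolding d_def using False b' v(2) by (intro norm_add_less) simp
        then show ?thesis using norm_bound by (simp add: norm_mult)
      qed
      moreover have "Im (cnj u * d) \<noteq> 0" unfolding Im_d using b' v(2) by (metis mult_eq_0_iff)
      then have "norm v \<le> norm d" by (rule v(3)[OF \<open>d \<in> \<Lambda>\<close>])
      ultimately show False by simp
    qed
    then have "norm d = \<bar>a'\<bar> * norm u" by (simp add: d_def norm_mult)
    also have "\<dots> \<le> 1 / 2 * norm u" using small by (intro mult_right_mono) auto
    finally have "norm d < norm u" using u(2) zero_less_norm_iff[of u] by linarith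
    then have "d = 0" using u(3)[OF \<open>d \<in> \<Lambda>\<close>] by fastforce
    then show ?thesis using d by auto
  qed
  then have "\<Lambda> = {of_int a * u + of_int b * v | a b. True}"
    using add[OF int_mult[OF u(1)] int_mult[OF v(1)]] by blast
  then show ?thesis unfolding is_lattice_iff using v(2) by blast
qed

text \<open>Half periods are encoded by two integers of which only the parities matter, so questions
  about 2-torsion become a finite check.\<close>

lemma lattice_half_points:
  assumes "is_lattice \<Lambda>"
  obtains u v where "\<And>x. 2 * x \<in> \<Lambda> \<Longrightarrow> \<exists>m n. 2 * x = of_int m * u + of_int n * v"
    "\<And>x m n. 2 * x = of_int m * u + of_int n * v \<Longrightarrow> x \<in> \<Lambda> \<longleftrightarrow> even m \<and> even n"
    "u \<in> \<Lambda>" "v \<in> \<Lambda>"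
proof -
  obtain u v where uv: "Im (cnj u * v) \<noteq> 0"
    and \<Lambda>: "\<Lambda> = {of_int a * u + of_int b * v | a b. True}"
    using assms unfolding is_lattice_iff by blast
  have mem: "x \<in> \<Lambda> \<longleftrightarrow> even m \<and> even n" if x: "2 * x = of_int m * u + of_int n * v" for x m n
  proof
    assume "x \<in> \<Lambda>"
    then obtain a b where ab: "x = of_int a * u + of_int b * v" using \<Lambda> by blast
    have eq: "of_int m * u + of_int n * v = of_int (2 * a) * u + of_int (2 * b) * v"
      using x ab by (simp add: algebra_simps)
    have Im: "Im (cnj u * (of_int m * u + of_int n * v)) = of_int n * Im (cnj u * v)"
      "Im (cnj v * (of_int m * u + of_int n * v)) = - of_int m * Im (cnj u * v)" for m n
      by (simp_all add: algebra_simps)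
    have "of_int n * Im (cnj u * v) = of_int (2 * b) * Im (cnj u * v)"
      "- of_int m * Im (cnj u * v) = - of_int (2 * a) * Im (cnj u * v)"
      using arg_cong[OF eq, of "\<lambda>z. Im (cnj u * z)"] arg_cong[OF eq, of "\<lambda>z. Im (cnj v * z)"]
      unfolding Im by simp_all
    then have "real_of_int n = of_int (2 * b)" "real_of_int m = of_int (2 * a)" using uv by simp_all
    then show "even m \<and> even n" by (metis dvd_triv_left of_int_eq_iff)
  next
    assume "even m \<and> even n"
    then obtain a b where "m = 2 * a" "n = 2 * b" by (auto elim!: evenE)
    then have "2 * x = 2 * (of_int a * u + of_int b * v)" using x by (simp add: algebra_simps)
    then have "x = of_int a * u + of_int b * v" by (simp only: mult_cancel_left) simp
    then show "x \<in> \<Lambda>" using \<Lambda> by blast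
  qed
  have "u = of_int 1 * u + of_int 0 * v" "v = of_int 0 * u + of_int 1 * v" by simp_all
  then have "u \<in> \<Lambda>" "v \<in> \<Lambda>" unfolding \<Lambda> by blast+
  then show thesis
  proof (rule that[rotated 2])
    show "\<exists>m n. 2 * x = of_int m * u + of_int n * v" if "2 * x \<in> \<Lambda>" for x
      using \<open>2 * x \<in> \<Lambda>\<close> \<Lambda> by blast
  qed (rule mem)
qed

text \<open>The three nonzero 2-torsion points sum to zero, so that a group \<open>A\<close> avoiding \<open>\<beta>\<close> contains at
  most one of them.\<close>

lemma lattice_half_point_choice:
  assumes lat: "is_lattice \<Lambda>" and A: "\<Lambda> \<subseteq> A" "\<And>x y. x \<in> A \<Longrightarrow> y \<in> A \<Longrightarrow> x - y \<in> A"
      "\<And>x. x \<in> A \<Longrightarrow> 2 * x \<in> \<Lambda>"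
    and \<beta>: "\<beta> \<notin> A" "2 * \<beta> \<in> \<Lambda>"
  obtains \<tau> where "\<tau> \<notin> \<Lambda>" "2 * \<tau> \<in> \<Lambda>" "\<beta> - \<tau> \<notin> \<Lambda>" "\<And>a. a \<in> A \<Longrightarrow> a \<in> \<Lambda> \<or> a - \<tau> \<in> \<Lambda>"
proof -
  obtain u v where half: "\<And>x. 2 * x \<in> \<Lambda> \<Longrightarrow> \<exists>m n. 2 * x = of_int m * u + of_int n * v"
    and mem: "\<And>x m n. 2 * x = of_int m * u + of_int n * v \<Longrightarrow> x \<in> \<Lambda> \<longleftrightarrow> even m \<and> even n"
    and uv: "u \<in> \<Lambda>" "v \<in> \<Lambda>"
    using lattice_half_points[OF lat] by blast
  show thesis
  proof (cases "A \<subseteq> \<Lambda>")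
    case True
    \<comment> \<open>Here \<open>A\<close> singles out no class, and \<open>\<tau>\<close> only has
      to avoid that of \<open>\<beta>\<close>. The half periods \<open>u / 2\<close> and
      \<open>v / 2\<close> are not congruent, so one of them does.\<close>
    have "2 * (u / 2 - v / 2) = of_int 1 * u + of_int (-1) * v" by (simp add: algebra_simps)
    then have "u / 2 - v / 2 \<notin> \<Lambda>" using mem[of "u / 2 - v / 2" 1 "-1"] by simp
    moreover have "u / 2 - v / 2 = (\<beta> - v / 2) - (\<beta> - u / 2)" by simp
    ultimately have "\<beta> - v / 2 \<notin> \<Lambda> \<or> \<beta> - u / 2 \<notin> \<Lambda>"
      using True A by (metis subsetD)
    moreover have "2 * (u / 2) = of_int 1 * u + of_int 0 * v" "2 * (v / 2) = of_int 0 * u + of_int 1 * v"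
      by simp_all
    then have "u / 2 \<notin> \<Lambda>" "v / 2 \<notin> \<Lambda>"
      using mem[of "u / 2" 1 0] mem[of "v / 2" 0 1] by simp_all
    moreover have "2 * (u / 2) \<in> \<Lambda>" "2 * (v / 2) \<in> \<Lambda>" using uv by simp_all
    ultimately show thesis using that True by blast
  next
    case False
    then obtain \<tau> where \<tau>: "\<tau> \<in> A" "\<tau> \<notin> \<Lambda>" by blast
    have diff: "\<beta> - x \<notin> \<Lambda>" if "x \<in> A" for x
    proof
      assume "\<beta> - x \<in> \<Lambda>"
      \<comment> \<open>Closure is available for differences: \<open>x - x - x\<close> is the
        negative of \<open>x\<close>, and subtracting it from \<open>\<beta> - x\<close> would give
        \<open>\<beta> \<in> A\<close>.\<close>
      moreover have "x - x \<in> A" using that that by (rule A(2))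
      then have "x - x - x \<in> A" using that by (rule A(2))
      ultimately have "\<beta> - x - (x - x - x) \<in> A" using A(2)[OF subsetD[OF A(1)]] by blast
      then show False using \<beta>(1) by simp
    qed
    have "a \<in> \<Lambda> \<or> a - \<tau> \<in> \<Lambda>" if a: "a \<in> A" for a
    proof (rule ccontr)
      assume *: "\<not> (a \<in> \<Lambda> \<or> a - \<tau> \<in> \<Lambda>)"
      obtain m1 n1 where 1: "2 * a = of_int m1 * u + of_int n1 * v" using half A(3)[OF a] by blast
      obtain m2 n2 where 2: "2 * \<tau> = of_int m2 * u + of_int n2 * v" using half A(3)[OF \<tau>(1)] by blast
      obtain m3 n3 where 3: "2 * \<beta> = of_int m3 * u + of_int n3 * v" using half \<beta>(2) by blast
      \<comment> \<open>If \<open>a\<close> and \<open>\<tau>\<close> were distinct nonzero classes,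
        every half period would be congruent to 0, \<open>a\<close>, \<open>\<tau>\<close> or
        \<open>a + \<tau>\<close>. All four are excluded for \<open>\<beta>\<close>, which the
        parities turn into a contradiction; the sum is written as a difference.\<close>
      have "2 * (a - \<tau>) = of_int (m1 - m2) * u + of_int (n1 - n2) * v"
        "2 * (\<beta> - a) = of_int (m3 - m1) * u + of_int (n3 - n1) * v"
        "2 * (\<beta> - \<tau>) = of_int (m3 - m2) * u + of_int (n3 - n2) * v"
        "2 * (\<beta> - (a - (0 - \<tau>))) = of_int (m3 - m1 - m2) * u + of_int (n3 - n1 - n2) * v"
        using 1 2 3 by (simp_all add: algebra_simps)
      note parity = mem[OF 1] mem[OF 2] mem[OF 3] mem[OF this(1)] mem[OF this(2)] mem[OF this(3)] mem[OF this(4)]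
      have "0 - \<tau> \<in> A" using A(2)[OF \<tau>(1) \<tau>(1)] A(2)[OF _ \<tau>(1), of 0] by simp
      then have "a - (0 - \<tau>) \<in> A" using a A(2) by blast
      then have "\<beta> - (a - (0 - \<tau>)) \<notin> \<Lambda>" by (rule diff)
      moreover have "\<beta> \<notin> \<Lambda>" using \<beta>(1) A(1) by blast
      ultimately show False using * \<tau>(2) diff[OF a] diff[OF \<tau>(1)] unfolding parity by auto
    qed
    then show thesis using that \<tau> diff A(3) by blast
  qed
qed

section \<open>Simultaneous diagonalization of commuting involutions\<close>

text \<open>A common eigenvector \<open>u\<close> of \<open>F\<close> is the sum of
  \<open>(u + A u) / 2\<close> and \<open>(u - A u) / 2\<close>, eigenvectors of the involution
  \<open>A\<close>. Since \<open>A\<close> commutes with \<open>F\<close>, they remain eigenvectors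
  of \<open>F\<close>.\<close>

lemma common_eigenvectors_span:
  fixes F :: "(complex ^ 'n ^ 'n::finite) set"
  assumes "finite F" "\<And>A. A \<in> F \<Longrightarrow> A ** A = mat 1"
    and "\<And>A B. A \<in> F \<Longrightarrow> B \<in> F \<Longrightarrow> A ** B = B ** A"
  shows "vec.span {v. \<forall>A\<in>F. A *v v = v \<or> A *v v = - v} = UNIV"
  using assms
proof (induction F rule: finite_induct)
  case empty
  then show ?case by simp
next
  case (insert A F)
  let ?E = "\<lambda>F. {v. \<forall>A\<in>F. A *v v = v \<or> A *v v = - v}"
  have scale: "c *s x \<in> ?E X" if x: "x \<in> ?E X" for X c and x :: "complex ^ 'n"
  proof clarify
    fix B assume "B \<in> X" "B *v (c *s x) \<noteq> - (c *s x)"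
    then show "B *v (c *s x) = c *s x"
      using x by (auto simp: vector_scalar_commute)
  qed
  have "u \<in> vec.span (?E (insert A F))" if u: "u \<in> ?E F" for u
  proof -
    have AA: "A *v (A *v u) = u" using insert.prems(1)[of A] by (simp add: matrix_vector_mul_assoc)
    have "(1/2) *s (u + A *v u) \<in> ?E (insert A F)" "(1/2) *s (u - A *v u) \<in> ?E (insert A F)"
    proof -
      have *: "B *v u = u \<and> B *v (A *v u) = A *v u \<or> B *v u = - u \<and> B *v (A *v u) = - (A *v u)"
        if "B \<in> F" for B
      proof -
        have "B *v (A *v u) = A *v (B *v u)"
          using insert.prems(2)[of B A] that by (simp add: matrix_vector_mul_assoc)
        moreover have "B *v u = u \<or> B *v u = - u" using u that by blast
        ultimately show ?thesis by (auto simp: matrix_vector_minus)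
      qed
      have "B *v (u + A *v u) = u + A *v u \<or> B *v (u + A *v u) = - (u + A *v u)"
        "B *v (u - A *v u) = u - A *v u \<or> B *v (u - A *v u) = - (u - A *v u)" if "B \<in> F" for B
        using *[OF that] by (auto simp: matrix_vector_right_distrib matrix_vector_mult_diff_distrib)
      moreover have "A *v (u + A *v u) = u + A *v u" "A *v (u - A *v u) = - (u - A *v u)"
        by (simp_all add: matrix_vector_right_distrib matrix_vector_mult_diff_distrib AA)
      ultimately have "u + A *v u \<in> ?E (insert A F)" "u - A *v u \<in> ?E (insert A F)"
        by (intro CollectI ballI; elim insertE; simp)+
      then show "(1/2) *s (u + A *v u) \<in> ?E (insert A F)" "(1/2) *s (u - A *v u) \<in> ?E (insert A F)"
        using scale[of "u + A *v u" "insert A F" "1/2"] scale[of "u - A *v u" "insert A F" "1/2"]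
        by blast+
    qed
    then have "(1/2) *s (u + A *v u) + (1/2) *s (u - A *v u) \<in> vec.span (?E (insert A F))"
      by (intro vec.span_add vec.span_base)
    moreover have "(1/2) *s (u + A *v u) + (1/2) *s (u - A *v u) = u"
      by (simp add: vec_eq_iff algebra_simps)
    ultimately show ?thesis by simp
  qed
  then have "vec.span (?E F) \<subseteq> vec.span (?E (insert A F))"
    by (intro vec.span_minimal) (auto simp: vec.subspace_span)
  then show ?case using insert.IH insert.prems by auto
qed

text \<open>The columns of \<open>P\<close> are a basis picked from the spanning set of common
  eigenvectors.\<close>

lemma simultaneous_diagonalization:
  fixes H :: "(complex ^ 'n ^ 'n::finite) set"
  assumes "finite H" "\<And>A. A \<in> H \<Longrightarrow> A ** A = mat 1"
    and "\<And>A B. A \<in> H \<Longrightarrow> B \<in> H \<Longrightarrow> A ** B = B ** A"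
  obtains P P' :: "complex ^ 'n ^ 'n" where "P ** P' = mat 1" "P' ** P = mat 1"
    "\<And>A. A \<in> H \<Longrightarrow> \<exists>e. (\<forall>k. e k = 1 \<or> e k = -1) \<and> A = P ** diag_mat e ** P'"
proof -
  let ?E = "{v. \<forall>A\<in>H. A *v v = v \<or> A *v v = - v}"
  obtain B where B: "B \<subseteq> ?E" "vec.independent B" "?E \<subseteq> vec.span B"
    using vec.maximal_independent_subset[of ?E] by blast
  have span: "vec.span B = UNIV"
    using common_eigenvectors_span[OF assms] B(3) vec.span_minimal[OF B(3) vec.subspace_span] by auto
  have "card B = vec.dim (UNIV :: (complex ^ 'n) set)"
    using vec.basis_card_eq_dim[of B UNIV] B(2) span by auto
  then have "card B = CARD('n)" by (simp only: vec_dim_card)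
  then obtain g :: "'n \<Rightarrow> complex ^ 'n" where g: "bij_betw g UNIV B"
    using finite_same_card_bij[of "UNIV :: 'n set" B] vec.finiteI_independent[OF B(2)] by auto
  define P :: "complex ^ 'n ^ 'n" where "P = (\<chi> i j. g j $ i)"
  have col: "column j P = g j" for j by (simp add: column_def P_def vec_eq_iff)
  have "columns P = B"
    using g unfolding columns_def col bij_betw_def by auto
  then obtain P' where P': "P ** P' = mat 1"
    using matrix_right_invertible_span_columns[of P] span by blast
  then have P'P: "P' ** P = mat 1" by (simp add: matrix_left_right_inverse)
  have diag: "\<exists>e. (\<forall>k. e k = 1 \<or> e k = -1) \<and> A = P ** diag_mat e ** P'" if A: "A \<in> H" for A
  proof -
    have "\<forall>j. \<exists>s. (s = 1 \<or> s = -1) \<and> A *v g j = s *s g j"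
    proof
      fix j
      have "g j \<in> ?E" using g B(1) bij_betwE by blast
      then have "A *v g j = g j \<or> A *v g j = - g j" using A by blast
      then have "A *v g j = 1 *s g j \<or> A *v g j = (-1) *s g j" by simp
      then show "\<exists>s. (s = 1 \<or> s = -1) \<and> A *v g j = s *s g j" by blast
    qed
    then obtain e where e: "\<And>j. e j = 1 \<or> e j = -1" "\<And>j. A *v g j = e j *s g j" by metis
    have "A ** P = P ** diag_mat e"
      unfolding vec_eq_iff
    proof (intro allI)
      fix i j
      have "(A ** P) $ i $ j = (A *v g j) $ i"
        by (simp add: matrix_matrix_mult_def matrix_vector_mult_def P_def)
      also have "\<dots> = g j $ i * e j" by (simp add: e(2))
      also have "\<dots> = (\<Sum>k\<in>UNIV. if k = j then g j $ i * e j else 0)" by simp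
      also have "\<dots> = (\<Sum>k\<in>UNIV. g k $ i * (if k = j then e k else 0))"
        by (intro sum.cong) auto
      also have "\<dots> = (P ** diag_mat e) $ i $ j"
        by (simp only: matrix_matrix_mult_def P_def vec_lambda_beta diag_mat_nth)
      finally show "(A ** P) $ i $ j = (P ** diag_mat e) $ i $ j" .
    qed
    then have "A ** (P ** P') = P ** diag_mat e ** P'" by (simp add: matrix_mul_assoc)
    then show ?thesis using e(1) P' by auto
  qed
  show thesis
  proof (rule that[OF P' P'P])
    show "\<exists>e. (\<forall>k. e k = 1 \<or> e k = -1) \<and> A = P ** diag_mat e ** P'" if "A \<in> H" for A
      using \<open>A \<in> H\<close> by (rule diag)
  qed
qed

section \<open>From a diagonalized group to the data\<close>

text \<open>\<open>T e v\<close> states that the map \<open>z \<mapsto> e z + v\<close> (with \<open>e\<close> acting diagonally) belongs to the group.\<close>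

locale sign_crystal =
  fixes T :: "('n::{finite,linorder} \<Rightarrow> complex) \<Rightarrow> (complex, 'n) vec \<Rightarrow> bool"
  assumes T_sign: "T e v \<Longrightarrow> sign_vec e"
    and T_ex: "sign_vec e \<Longrightarrow> \<exists>v. T e v"
    and T_mult: "T e v \<Longrightarrow> T f w \<Longrightarrow> T (\<lambda>k. e k * f k) (scale_by e w + v)"
    and T_inv: "T e v \<Longrightarrow> T e (- scale_by e v)"
    and T_free: "T e v \<Longrightarrow> scale_by e v + v = 0 \<Longrightarrow> e = (\<lambda>_. 1)"
    and T_gap: "\<exists>r>0. \<forall>v. T (\<lambda>_. 1) v \<and> norm v < r \<longrightarrow> v = 0"
    and T_cocompact: "\<exists>R. \<forall>z. \<exists>e v. T e v \<and> norm (scale_by e z + v) \<le> R"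
    and odd_dim: "odd CARD('n)" and dim: "CARD('n) \<noteq> 1"
begin

lemma sign_square: "T e v \<Longrightarrow> (\<lambda>k. e k * e k) = (\<lambda>_. 1)"
  by (rule sign_vec_square[OF T_sign])

lemma scale_by_square: "T e v \<Longrightarrow> scale_by e (scale_by e z) = z"
  using fun_cong[OF sign_square, of e v] by (simp add: vec_eq_iff flip: mult.assoc)

text \<open>The translation lattice of the group; it turns out to be the lattice \<open>L\<close> of
  the data constructed from it.\<close>

definition K :: "(complex, 'n) vec set" where "K = {v. T (\<lambda>_. 1) v}"

lemma T_diff:
  assumes "T e u" "T e v"
  shows "u - v \<in> K"
proof -
  have "T (\<lambda>_. 1) (scale_by e (- scale_by e v) + u)"
    using T_mult[OF assms(1) T_inv[OF assms(2)]] unfolding sign_square[OF assms(1)] .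
  moreover have "scale_by e (- scale_by e v) = - scale_by e (scale_by e v)"
    by (simp add: vec_eq_iff)
  ultimately show ?thesis using assms(2) by (simp add: K_def scale_by_square)
qed

lemma K_zero: "0 \<in> K"
proof -
  obtain v where "T (\<lambda>_. 1) v" using T_ex[of "\<lambda>_. 1"] by (auto simp: sign_vec_def)
  then show ?thesis using T_diff by fastforce
qed

lemma K_diff: "v \<in> K \<Longrightarrow> w \<in> K \<Longrightarrow> v - w \<in> K"
  using T_diff by (simp add: K_def)

lemma K_neg: "v \<in> K \<Longrightarrow> - v \<in> K"
  using K_diff[OF K_zero] by fastforce

lemma K_add: "v \<in> K \<Longrightarrow> w \<in> K \<Longrightarrow> v + w \<in> K"
  using K_diff[of v "- w"] K_neg by simp

lemma T_add: "T e v \<Longrightarrow> l \<in> K \<Longrightarrow> T e (v + l)"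
  using T_mult[of "\<lambda>_. 1" l e v] by (simp add: K_def scale_by_1)

lemma K_scale: "sign_vec e \<Longrightarrow> l \<in> K \<Longrightarrow> scale_by e l \<in> K"
proof -
  assume "sign_vec e" "l \<in> K"
  then obtain v where v: "T e v" using T_ex by blast
  have "T e (scale_by e l + v)" using T_mult[OF v, of "\<lambda>_. 1" l] \<open>l \<in> K\<close> by (simp add: K_def)
  then show ?thesis using T_diff[OF _ v] by fastforce
qed

lemma sign_vec_sign: "sign_vec (sign_at (I :: 'n set))"
  by (rule sign_vec_sign_at[OF odd_dim])

text \<open>In dimension one the only generator has trivial linear part, and torsion-freeness would
  say nothing about \<open>b i\<close>.\<close>

lemma sign_at_nontrivial: "sign_at {i :: 'n} \<noteq> (\<lambda>_. 1)"
proof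
  assume *: "sign_at {i} = (\<lambda>_. 1)"
  have "k = i" for k
    using fun_cong[OF *, of k] by (simp split: if_splits)
  then have "UNIV = {i}" by blast
  then show False using dim by (metis card_1_singleton_iff One_nat_def)
qed

definition ax :: "'n \<Rightarrow> complex \<Rightarrow> (complex, 'n) vec" where
  "ax i c = (\<chi> k. if k = i then c else 0)"

lemma ax_nth [simp]: "ax i c $ k = (if k = i then c else 0)"
  by (simp add: ax_def)

definition \<Lambda> :: "'n \<Rightarrow> complex set" where "\<Lambda> i = {c. ax i c \<in> K}"

lemma \<Lambda>_subgroup: "subgroup (\<Lambda> i) complex_group"
proof -
  have "ax i 0 = 0" "ax i (x + y) = ax i x + ax i y" "ax i (- x) = - ax i x" for x y
    by (simp_all add: vec_eq_iff)
  then show ?thesis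
    unfolding subgroup_complex_group_iff \<Lambda>_def using K_zero K_add K_neg by simp
qed

sublocale ordered_torus \<Lambda>
  by (intro ordered_torus.intro torus.intro) (rule \<Lambda>_subgroup)

lemma K_I: "(\<And>k. v $ k \<in> \<Lambda> k) \<Longrightarrow> v \<in> K"
proof -
  assume *: "\<And>k. v $ k \<in> \<Lambda> k"
  have "(\<chi> k. if k \<in> S then v $ k else 0) \<in> K" for S
  proof (induction S rule: infinite_finite_induct)
    case (insert i S)
    have "(\<chi> k. if k \<in> insert i S then v $ k else 0) = ax i (v $ i) + (\<chi> k. if k \<in> S then v $ k else 0)"
      using insert.hyps by (auto simp: vec_eq_iff)
    then show ?case using *[of i] insert.IH K_add by (simp add: \<Lambda>_def)
  qed (use K_zero in \<open>simp_all add: zero_vec_def\<close>)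
  from this[of UNIV] show ?thesis by (simp add: vec_eq_iff)
qed

lemma double_coordinate: "v \<in> K \<Longrightarrow> 2 * v $ i \<in> \<Lambda> i"
proof -
  assume v: "v \<in> K"
  have "v + scale_by (sign_at {i}) v = ax i (2 * v $ i)" by (simp add: vec_eq_iff)
  then show ?thesis using K_add[OF v K_scale[OF sign_vec_sign v, of "{i}"]] by (simp add: \<Lambda>_def)
qed

lemma proj_K_iff: "proj \<Lambda> v \<in> proj \<Lambda> ` K \<longleftrightarrow> v \<in> K"
proof
  assume "proj \<Lambda> v \<in> proj \<Lambda> ` K"
  then obtain w where w: "w \<in> K" "proj \<Lambda> v = proj \<Lambda> w" by blast
  then have "v - w \<in> K" by (intro K_I) (simp add: proj_eq_iff)
  then show "v \<in> K" using K_add[OF _ w(1)] by fastforce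
qed blast

text \<open>The gap is inherited from the group. For density on the axis, some group element brings
  \<open>z / 2\<close> near the origin and can be traded for a translation at bounded cost; only
  twice the coordinate of that translation is a period, which explains the halved point and the
  factor 2.\<close>

lemma lattice: "is_lattice (\<Lambda> i)"
proof -
  obtain r where r: "r > 0" "\<And>v. v \<in> K \<Longrightarrow> norm v < r \<Longrightarrow> v = 0"
    using T_gap unfolding K_def by blast
  obtain R where R: "\<And>z. \<exists>e v. T e v \<and> norm (scale_by e z + v) \<le> R" using T_cocompact by blast
  have norm_ax: "norm (ax i c) = norm c" for c
    unfolding norm_vec_def L2_set_def by (simp add: if_distrib[of norm] if_distrib[of "\<lambda>x. x\<^sup>2"] cong: if_cong)
  have ax_0: "ax i c = 0 \<Longrightarrow> c = 0" for c by (metis ax_nth zero_index)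
  have "\<forall>e. \<exists>v. sign_vec e \<longrightarrow> T e v" using T_ex by blast
  then obtain s where s: "\<And>e. sign_vec e \<Longrightarrow> T e (s e)" by metis
  \<comment> \<open>One group element is fixed for each of the finitely many linear parts; replacing
    \<open>v\<close> by the translation \<open>v - s e\<close> changes it by at most
    \<open>S\<close>.\<close>
  define S where "S = Max (insert 0 ((\<lambda>e. norm (s e)) ` {e. sign_vec e}))"
  have S: "norm (s e) \<le> S" if "sign_vec e" for e
    unfolding S_def using finite_sign_vecs[OF odd_dim] that by (intro Max_ge) auto
  have "\<exists>c\<in>\<Lambda> i. norm (z - c) \<le> 2 * (R + S)" for z
  proof -
    obtain e v where e: "T e v" "norm (scale_by e (ax i (z / 2)) + v) \<le> R" using R by blast
    have sgn: "sign_vec e" using e(1) by (rule T_sign)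
    define l where "l = v - s e"
    have l: "l \<in> K" unfolding l_def using e(1) s[OF sgn] by (rule T_diff)
    have "norm (e i * (z / 2) + v $ i) \<le> R"
      using Finite_Cartesian_Product.norm_nth_le[of "scale_by e (ax i (z / 2)) + v" i] e(2) by simp
    moreover have "norm (s e $ i) \<le> S"
      using Finite_Cartesian_Product.norm_nth_le[of "s e" i] S[OF sgn] by simp
    moreover have eq: "e i * (z / 2) + l $ i = (e i * (z / 2) + v $ i) - s e $ i"
      by (simp add: l_def)
    ultimately have bound: "norm (e i * (z / 2) + l $ i) \<le> R + S"
      using norm_triangle_ineq4[of "e i * (z / 2) + v $ i" "s e $ i"] unfolding eq by linarith
    have two: "2 * l $ i \<in> \<Lambda> i" using l by (rule double_coordinate)
    have ei: "e i = 1 \<or> e i = -1" using sgn by (rule sign_vec_values)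
    show ?thesis
    \<comment> \<open>Multiplying the small quantity \<open>e i * (z / 2) + l $ i\<close> by
      \<open>2 * e i\<close> gives \<open>z\<close> plus \<open>e i\<close> times the period
      \<open>2 * l $ i\<close>.\<close>
    proof (rule bexI[of _ "- e i * (2 * l $ i)"])
      show "- e i * (2 * l $ i) \<in> \<Lambda> i" using two C.neg[OF two] ei by auto
      have "z - (- e i * (2 * l $ i)) = 2 * e i * (e i * (z / 2) + l $ i)"
        using ei by (auto simp: algebra_simps)
      then have "norm (z - (- e i * (2 * l $ i))) = 2 * norm (e i) * norm (e i * (z / 2) + l $ i)"
        by (simp only: norm_mult) simp
      then show "norm (z - (- e i * (2 * l $ i))) \<le> 2 * (R + S)" using bound ei by auto
    qed
  qed
  then show ?thesis
    using r norm_ax ax_0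
    by (intro is_lattice_if_discrete_cocompact[OF \<Lambda>_subgroup r(1), of _ "2 * (R + S)"])
      (auto simp: \<Lambda>_def)
qed

section \<open>Construction of the data from the group\<close>

lemma T_shift_vec:
  assumes "\<And>i. i \<in> I \<Longrightarrow> T (sign_at {i}) (b i)"
  shows "T (sign_at I) (shift_vec b I)"
proof -
  have "finite I" by simp
  then show ?thesis using assms
  proof (induction I rule: finite_linorder_min_induct)
    case empty
    have "sign_at ({} :: 'n set) = (\<lambda>_. 1)" by auto
    then show ?case using K_zero by (simp add: K_def)
  next
    case (insert a I)
    have a: "a \<notin> I" and min: "\<forall>k\<in>I. a < k" using insert.hyps by auto
    have "T (\<lambda>k. sign_at {a} k * sign_at I k) (scale_by (sign_at {a}) (shift_vec b I) + b a)"
      using insert by (intro T_mult) auto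
    moreover have "(\<lambda>k. sign_at {a} k * sign_at I k) = sign_at (insert a I)"
      by (simp only: fun_eq_iff sign_at_insert[OF a]) simp
    ultimately show ?case unfolding shift_vec_insert_min[OF min] by (simp add: gam_def)
  qed
qed

text \<open>Condition (iii) is an equality, so the last generator is not chosen but defined as the
  product of the others, which has the right linear part. The indices in that product lie below the
  last one, so the definition is not circular.\<close>

lemma generators_exist:
  obtains b where "\<And>i. T (sign_at {i}) (b i)" "b (Max UNIV) = shift_vec b {i. i < Max UNIV}"
proof -
  let ?m = "Max (UNIV :: 'n set)"
  have "\<forall>i. \<exists>v. T (sign_at {i}) v" using T_ex[OF sign_vec_sign] by blast
  from choice[OF this] obtain \<beta> where \<beta>: "\<And>i. T (sign_at {i}) (\<beta> i)" by blast
  define b where "b = \<beta>(?m := shift_vec \<beta> {i. i < ?m})"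
  have "shift_vec b {i. i < ?m} = shift_vec \<beta> {i. i < ?m}"
    unfolding shift_vec_def b_def by (auto simp: vec_eq_iff intro!: sum.cong)
  then have b_max: "b ?m = shift_vec b {i. i < ?m}" by (simp add: b_def)
  have "T (sign_at {?m}) (b ?m)"
  proof -
    have "sign_at {i. i < ?m} = sign_at {?m}" using sign_at_below_Max[OF odd_dim] by blast
    then show ?thesis using T_shift_vec[of "{i. i < ?m}" \<beta>] \<beta> by (simp add: b_def)
  qed
  then have "T (sign_at {i}) (b i)" for i using \<beta> by (cases "i = ?m") (simp_all add: b_def)
  then show thesis using that b_max by blast
qed

lemma finite_axis_product_in_generate:
  fixes t :: "'n \<Rightarrow> complex set"
  assumes "\<And>i. t i \<in> carrier (elliptic_curve (\<Lambda> i))"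
  shows "(\<lambda>k. if k \<in> S then t k else \<one>\<^bsub>elliptic_curve (\<Lambda> k)\<^esub>) \<in>
    generate (curve_sum \<Lambda>) (range (\<lambda>i. axis_point \<Lambda> i (t i)))"
proof (induction S rule: infinite_finite_induct)
  case empty
  have "(\<lambda>k. \<one>\<^bsub>elliptic_curve (\<Lambda> k)\<^esub>) = \<one>\<^bsub>curve_sum \<Lambda>\<^esub>"
    by (simp add: curve_sum_def fun_eq_iff)
  then show ?case using generate.one by simp
next
  case (insert a S)
  let ?f = "\<lambda>k. if k \<in> S then t k else \<one>\<^bsub>elliptic_curve (\<Lambda> k)\<^esub>"
  have "axis_point \<Lambda> a (t a) \<otimes>\<^bsub>curve_sum \<Lambda>\<^esub> ?f \<in>
      generate (curve_sum \<Lambda>) (range (\<lambda>i. axis_point \<Lambda> i (t i)))"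
    by (rule generate.eng[OF generate.incl insert.IH]) simp
  moreover have "axis_point \<Lambda> a (t a) \<otimes>\<^bsub>curve_sum \<Lambda>\<^esub> ?f =
      (\<lambda>k. if k \<in> insert a S then t k else \<one>\<^bsub>elliptic_curve (\<Lambda> k)\<^esub>)"
    using insert.hyps assms by (auto simp: axis_point_def curve_sum_def fun_eq_iff C.E.one_closed)
  ultimately show ?case by simp
qed simp

lemma axis_point_proj: "axis_point \<Lambda> i (cls (\<Lambda> i) c) = proj \<Lambda> (ax i c)"
  by (auto simp: axis_point_def proj_def fun_eq_iff C.one_curve)

text \<open>The last clause is what the comparison of the quotients requires: the orbits determined
  by the constructed data are those of the group.\<close>

theorem data_exist:
  "\<exists>t b W. chw_data \<Lambda> b W \<and>
     (\<forall>i. nonzero_2_torsion (elliptic_curve (\<Lambda> i)) (t i)) \<and>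
     W \<subseteq> generate (curve_sum \<Lambda>) (range (\<lambda>i. axis_point \<Lambda> i (t i))) \<and>
     (\<forall>i. axis_point \<Lambda> i (t i) \<notin> W) \<and>
     (\<forall>i. nonzero_2_torsion (elliptic_curve (\<Lambda> i)) (proj \<Lambda> (b i) i) \<and> proj \<Lambda> (b i) i \<noteq> t i) \<and>
     (\<forall>I. I \<subset> UNIV \<and> odd (card I) \<longrightarrow>
        (\<forall>y\<in>W. \<exists>j\<in>I. x_set \<Lambda> (\<lambda>i. proj \<Lambda> (b i)) I j \<noteq> y j)) \<and>
     (\<forall>j. proj \<Lambda> (b (Max UNIV)) j = x_set \<Lambda> (\<lambda>i. proj \<Lambda> (b i)) {i. i < Max UNIV} j) \<and>
     (\<forall>z w. twisted_lattice.rel b (chw_data.L \<Lambda> W) z w \<longleftrightarrow> (\<exists>e v. T e v \<and> scale_by e z + v = w))"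
proof -
  obtain b where b: "\<And>i. T (sign_at {i}) (b i)"
    and b_max: "b (Max UNIV) = shift_vec b {i. i < Max UNIV}"
    using generators_exist by blast
  let ?W = "proj \<Lambda> ` K"
  have diag: "2 * b i $ i \<in> \<Lambda> i" for i
  proof -
    have "T (\<lambda>_. 1) (scale_by (sign_at {i}) (b i) + b i)"
      using T_mult[OF b b, of i i] unfolding sign_square[OF b] .
    moreover have "scale_by (sign_at {i}) (b i) + b i = ax i (2 * b i $ i)"
      by (simp add: vec_eq_iff)
    ultimately show ?thesis by (simp add: \<Lambda>_def K_def)
  qed
  have free: "b i $ i \<noteq> v $ i" if v: "v \<in> K" for i v
  proof
    assume eq: "b i $ i = v $ i"
    \<comment> \<open>The square of this element is the translation by twice its \<open>i\<close>-th
      coordinate along that axis; if the coordinate vanished, the element would be torsion.\<close>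
    have "T (sign_at {i}) (b i + - v)" using b K_neg[OF v] by (rule T_add)
    moreover have "scale_by (sign_at {i}) (b i + - v) + (b i + - v) = 0"
      using eq by (simp add: vec_eq_iff)
    ultimately show False using T_free sign_at_nontrivial by blast
  qed
  have "\<exists>\<tau>. \<tau> \<notin> \<Lambda> i \<and> 2 * \<tau> \<in> \<Lambda> i \<and> b i $ i - \<tau> \<notin> \<Lambda> i \<and>
      (\<forall>v\<in>K. v $ i \<in> \<Lambda> i \<or> v $ i - \<tau> \<in> \<Lambda> i)" for i
  proof -
    \<comment> \<open>The projection of the lattice to the axis, which plays the role of
      \<open>A\<close> in \<open>lattice_half_point_choice\<close>, with the coordinate of
      \<open>b i\<close> as \<open>\<beta>\<close>.\<close>
    let ?A = "(\<lambda>v. v $ i) ` K"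
    have A: "x - y \<in> ?A" if xy: "x \<in> ?A" "y \<in> ?A" for x y
    proof -
      obtain v w where "v \<in> K" "w \<in> K" "x = v $ i" "y = w $ i" using xy by blast
      then show ?thesis using K_diff by (intro image_eqI[of _ _ "v - w"]) auto
    qed
    have "\<Lambda> i \<subseteq> ?A"
      unfolding \<Lambda>_def by (auto intro!: image_eqI[of _ _ "ax i _"])
    moreover have "2 * x \<in> \<Lambda> i" if "x \<in> ?A" for x using that double_coordinate by blast
    moreover have "b i $ i \<notin> ?A" using free by blast
    ultimately obtain \<tau> where "\<tau> \<notin> \<Lambda> i" "2 * \<tau> \<in> \<Lambda> i" "b i $ i - \<tau> \<notin> \<Lambda> i"
      "\<And>a. a \<in> ?A \<Longrightarrow> a \<in> \<Lambda> i \<or> a - \<tau> \<in> \<Lambda> i"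
      using lattice_half_point_choice[OF lattice[of i] _ A, of "b i $ i"] diag by metis
    then show ?thesis by blast
  qed
  then have "\<forall>i. \<exists>\<tau>. \<tau> \<notin> \<Lambda> i \<and> 2 * \<tau> \<in> \<Lambda> i \<and> b i $ i - \<tau> \<notin> \<Lambda> i \<and>
      (\<forall>v\<in>K. v $ i \<in> \<Lambda> i \<or> v $ i - \<tau> \<in> \<Lambda> i)" by blast
  from choice[OF this] obtain \<tau> where \<tau>: "\<And>i. \<tau> i \<notin> \<Lambda> i" "\<And>i. 2 * \<tau> i \<in> \<Lambda> i"
    "\<And>i. b i $ i - \<tau> i \<notin> \<Lambda> i" "\<And>i v. v \<in> K \<Longrightarrow> v $ i \<in> \<Lambda> i \<or> v $ i - \<tau> i \<in> \<Lambda> i" by blast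
  define t where "t i = cls (\<Lambda> i) (\<tau> i)" for i
  have data: "chw_data \<Lambda> b ?W"
  proof (intro chw_data.intro chw_data_axioms.intro)
    show "ordered_torus \<Lambda>" by (rule ordered_torus_axioms)
    show "subgroup ?W (curve_sum \<Lambda>)" by (rule proj_subgroup[OF K_zero K_add K_neg])
    show "2 * l $ k \<in> \<Lambda> k" if "proj \<Lambda> l \<in> ?W" for l k
      using that double_coordinate unfolding proj_K_iff by blast
    show "2 * b i $ i \<in> \<Lambda> i" for i by (rule diag)
    show "x_pair \<Lambda> (\<lambda>i. proj \<Lambda> (b i)) i j \<in> ?W" if "i \<noteq> j" for i j
    proof -
      let ?y = "\<chi> k. if k = i \<or> k = j then 0 else 2 * (b i $ k - b j $ k)"
      have "T (\<lambda>k. sign_at {i} k * sign_at {j} k) (gam b {i} (b j))"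
        "T (\<lambda>k. sign_at {j} k * sign_at {i} k) (gam b {j} (b i))"
        using T_mult[OF b[of i] b[of j]] T_mult[OF b[of j] b[of i]] by (simp_all add: gam_def)
      then have "gam b {i} (b j) - gam b {j} (b i) \<in> K"
        by (intro T_diff) (simp_all only: mult.commute)
      moreover have "?y - (gam b {i} (b j) - gam b {j} (b i)) \<in> K"
        using that diag[of j] C.neg[OF diag[of i]] C.zero by (intro K_I) auto
      ultimately have "?y \<in> K" using K_add by fastforce
      then show ?thesis unfolding x_pair_proj by blast
    qed
  qed
  interpret D: chw_data \<Lambda> b ?W by (rule data)
  have L: "D.L = K" by (simp add: D.L_def proj_K_iff)
  have rel: "D.rel z w \<longleftrightarrow> (\<exists>I. w - gam b I z \<in> K)" for z w
    unfolding D.rel_def unfolding L by (rule refl)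
  have shift: "T (sign_at I) (shift_vec b I)" for I using b by (rule T_shift_vec)
  have "?W \<subseteq> generate (curve_sum \<Lambda>) (range (\<lambda>i. axis_point \<Lambda> i (t i)))"
  proof clarify
    fix v assume v: "v \<in> K"
    \<comment> \<open>Each coordinate of an element of \<open>W\<close> is either zero or
      \<open>t k\<close>, by the choice of \<open>\<tau>\<close>, so the element is a sum of the
      points \<open>t k\<close> over a set of axes.\<close>
    have "proj \<Lambda> v k = (if k \<in> {k. v $ k \<notin> \<Lambda> k} then t k else \<one>\<^bsub>elliptic_curve (\<Lambda> k)\<^esub>)" for k
      using \<tau>(4)[OF v, of k] by (auto simp: proj_def t_def C.cls_eq_iff)
    then have eq: "proj \<Lambda> v =
        (\<lambda>k. if k \<in> {k. v $ k \<notin> \<Lambda> k} then t k else \<one>\<^bsub>elliptic_curve (\<Lambda> k)\<^esub>)"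
      by blast
    show "proj \<Lambda> v \<in> generate (curve_sum \<Lambda>) (range (\<lambda>i. axis_point \<Lambda> i (t i)))"
      unfolding eq by (rule finite_axis_product_in_generate) (simp add: t_def)
  qed
  moreover have "axis_point \<Lambda> i (t i) \<notin> ?W" for i
    using \<tau>(1)[of i] unfolding t_def axis_point_proj proj_K_iff by (simp add: \<Lambda>_def)
  moreover have "nonzero_2_torsion (elliptic_curve (\<Lambda> i)) (t i)" for i
    using \<tau>(1,2) by (simp add: t_def C.nonzero_2_torsion_cls)
  moreover have "nonzero_2_torsion (elliptic_curve (\<Lambda> i)) (proj \<Lambda> (b i) i) \<and> proj \<Lambda> (b i) i \<noteq> t i" for i
  proof -
    have "b i $ i \<notin> \<Lambda> i" using free[of "ax i (b i $ i)" i] by (auto simp: \<Lambda>_def)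
    then show ?thesis
      using diag \<tau>(3) by (simp add: proj_def C.nonzero_2_torsion_cls t_def C.cls_eq_iff)
  qed
  moreover have "\<exists>j\<in>I. x_set \<Lambda> (\<lambda>i. proj \<Lambda> (b i)) I j \<noteq> y j"
    if I: "I \<subset> UNIV" "odd (card I)" and y: "y \<in> ?W" for I y
  proof (rule ccontr)
    assume "\<not> (\<exists>j\<in>I. x_set \<Lambda> (\<lambda>i. proj \<Lambda> (b i)) I j \<noteq> y j)"
    then have eq: "\<And>j. j \<in> I \<Longrightarrow> cls (\<Lambda> j) (shift_vec b I $ j) = y j" unfolding x_set_proj by blast
    obtain l where l: "l \<in> K" "y = proj \<Lambda> l" using y by blast
    \<comment> \<open>Equality in the curves gives vanishing on the axes in \<open>I\<close> only
      modulo periods; subtracting the period vector \<open>u\<close> as well makes it exact, and the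
      square becomes the identity.\<close>
    define u where "u = (\<chi> k. if k \<in> I then shift_vec b I $ k - l $ k else 0)"
    have "u \<in> K"
      using eq l(2) C.zero by (intro K_I) (auto simp: u_def proj_def C.cls_eq_iff)
    then have "T (sign_at I) (shift_vec b I + - (l + u))"
      using T_add[OF shift] K_neg[OF K_add[OF l(1)]] by blast
    moreover have "scale_by (sign_at I) (shift_vec b I + - (l + u)) + (shift_vec b I + - (l + u)) = 0"
      using I(2) by (simp add: vec_eq_iff u_def sign_at_def card_Diff_singleton)
    ultimately have *: "sign_at I = (\<lambda>_. 1)" by (rule T_free)
    obtain k where "k \<notin> I" using I(1) by blast
    then have "sign_at I k = -1" using I(2) by (simp add: sign_at_def)
    then show False using * by simp
  qed
  moreover have "proj \<Lambda> (b (Max UNIV)) j = x_set \<Lambda> (\<lambda>i. proj \<Lambda> (b i)) {i. i < Max UNIV} j" for j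
    unfolding x_set_proj b_max[symmetric] by (simp add: proj_def)
  moreover have "D.rel z w \<longleftrightarrow> (\<exists>e v. T e v \<and> scale_by e z + v = w)" for z w
  proof
    assume "D.rel z w"
    then obtain I where "w - gam b I z \<in> K" unfolding rel by blast
    then have "T (sign_at I) (shift_vec b I + (w - gam b I z))" by (rule T_add[OF shift])
    moreover have "scale_by (sign_at I) z + (shift_vec b I + (w - gam b I z)) = w"
      by (simp add: gam_def)
    ultimately show "\<exists>e v. T e v \<and> scale_by e z + v = w" by blast
  next
    assume "\<exists>e v. T e v \<and> scale_by e z + v = w"
    then obtain e v where e: "T e v" "scale_by e z + v = w" by blast
    define I where "I = {k. e k = 1}"
    have "e = sign_at I" unfolding I_def by (rule sign_vec_cases(2)[OF odd_dim T_sign[OF e(1)]])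
    then have "v - shift_vec b I \<in> K" using e(1) shift[of I] by (intro T_diff[of e]) auto
    moreover have "w - gam b I z = v - shift_vec b I"
      using e(2) \<open>e = sign_at I\<close> by (auto simp: gam_def)
    ultimately show "D.rel z w" unfolding rel by metis
  qed
  ultimately show ?thesis using data by (intro exI[of _ t] exI[of _ b] exI[of _ ?W]) blast
qed

end

section \<open>From a complex Hantzsche-Wendt manifold to a diagonalized group\<close>

text \<open>The images of the balls around the origin form an open cover of the compact quotient;
  the largest radius in a finite subcover bounds a representative of every orbit.\<close>

lemma flat_cocompact:
  assumes \<Gamma>: "subgroup \<Gamma> unitary_affine_group" and comp: "compact_space (ctop (flat_quotient \<Gamma>))"
  obtains R where "\<And>z. \<exists>\<gamma>\<in>\<Gamma>. norm (affine_act \<gamma> z) \<le> R"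
proof -
  let ?p = "flat_orbit \<Gamma>" and ?X = "ctop (flat_quotient \<Gamma>)"
  have top: "topspace ?X = range ?p"
    by (simp add: flat_quotient_eq topspace_quotient_complex_space)
  have "openin ?X (?p ` ball 0 (real k))" for k
    using flat_orbit_open[OF \<Gamma>]
    by (auto simp: flat_quotient_eq ctop_quotient_complex_space)
  moreover have "topspace ?X \<subseteq> \<Union>(range (\<lambda>k. ?p ` ball 0 (real k)))"
  proof
    fix x assume "x \<in> topspace ?X"
    then obtain z where z: "x = ?p z" using top by auto
    obtain k where "norm z < real k" using reals_Archimedean2 by blast
    then have "x \<in> ?p ` ball 0 (real k)" using z by auto
    then show "x \<in> \<Union>(range (\<lambda>k. ?p ` ball 0 (real k)))" by blast
  qed
  ultimately obtain \<F> where \<F>: "finite \<F>" "\<F> \<subseteq> range (\<lambda>k. ?p ` ball 0 (real k))" "topspace ?X \<subseteq> \<Union>\<F>"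
    using comp[unfolded compact_space_alt, rule_format, of "range (\<lambda>k. ?p ` ball 0 (real k))"]
    by blast
  then obtain S where S: "finite S" "\<F> = (\<lambda>k. ?p ` ball 0 (real k)) ` S"
    using finite_subset_image by metis
  have "\<exists>\<gamma>\<in>\<Gamma>. norm (affine_act \<gamma> z) \<le> Max (insert 0 (real ` S))" for z
  proof -
    have "?p z \<in> \<Union>\<F>" using \<F>(3) unfolding top by blast
    then obtain k w where k: "k \<in> S" "norm w < real k" "?p z = ?p w" using S by auto
    then obtain \<gamma> where "\<gamma> \<in> \<Gamma>" "affine_act \<gamma> z = w" using flat_orbit_eq_iff[OF \<Gamma>] by blast
    moreover have "real k \<le> Max (insert 0 (real ` S))" using S k by (intro Max_ge) auto
    ultimately show ?thesis using k(2) by (intro bexI[of _ \<gamma>]) auto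
  qed
  then show thesis using that by blast
qed

locale diagonalized_group =
  fixes \<Gamma> :: "(((complex, 'n::{finite,linorder}) vec, 'n) vec \<times> (complex, 'n) vec) set"
    and P P' :: "((complex, 'n) vec, 'n) vec"
  assumes flat: "flat_kaehler_group \<Gamma>"
    and PP': "P ** P' = mat 1" "P' ** P = mat 1"
    and linear_parts: "fst ` \<Gamma> = {P ** diag_mat e ** P' | e. sign_vec e}"
begin

definition conjugate :: "('n \<Rightarrow> complex) \<Rightarrow> ((complex, 'n) vec, 'n) vec" where
  "conjugate e = P ** diag_mat e ** P'"

text \<open>Membership in the group after conjugation by \<open>P\<close>: the element sends
  \<open>P *v z\<close> to \<open>P *v (scale_by e z + v)\<close>.\<close>

definition T :: "('n \<Rightarrow> complex) \<Rightarrow> (complex, 'n) vec \<Rightarrow> bool" where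
  "T e v \<longleftrightarrow> sign_vec e \<and> (conjugate e, P *v v) \<in> \<Gamma>"

lemma P_inverse: "P *v (P' *v z) = z" "P' *v (P *v z) = z"
  by (simp_all add: matrix_vector_mul_assoc PP')

lemma conjugate_1: "conjugate (\<lambda>_. 1) = mat 1"
  by (simp add: conjugate_def diag_mat_1 PP')

lemma conjugate_act: "conjugate e *v (P *v v) = P *v (scale_by e v)"
  by (simp add: conjugate_def P_inverse flip: matrix_vector_mul_assoc)

lemma conjugate_mult: "conjugate e ** conjugate f = conjugate (\<lambda>k. e k * f k)"
proof -
  have "conjugate e ** conjugate f = P ** diag_mat e ** (P' ** P) ** diag_mat f ** P'"
    by (simp add: conjugate_def matrix_mul_assoc)
  also have "\<dots> = P ** (diag_mat e ** diag_mat f) ** P'" by (simp add: PP' matrix_mul_assoc)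
  finally show ?thesis by (simp add: conjugate_def diag_mat_mult)
qed

lemma conjugate_eq_iff: "conjugate e = conjugate f \<longleftrightarrow> e = f"
proof
  assume "conjugate e = conjugate f"
  then have "P' ** conjugate e ** P = P' ** conjugate f ** P" by simp
  moreover have "P' ** conjugate e ** P = diag_mat e" for e
  proof -
    have "P' ** conjugate e ** P = (P' ** P) ** diag_mat e ** (P' ** P)"
      by (simp add: conjugate_def matrix_mul_assoc)
    then show ?thesis by (simp add: PP')
  qed
  ultimately show "e = f" by (simp add: diag_mat_eq_iff)
qed simp

lemma sub: "subgroup \<Gamma> unitary_affine_group"
  using flat by (simp add: flat_kaehler_group_def)

lemma \<Gamma>_cases:
  assumes "\<gamma> \<in> \<Gamma>"
  obtains e v where "T e v" "\<gamma> = (conjugate e, P *v v)"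
proof -
  have "fst \<gamma> \<in> {P ** diag_mat e ** P' | e. sign_vec e}"
    unfolding linear_parts[symmetric] using assms by (rule imageI)
  then obtain e where e: "sign_vec e" "fst \<gamma> = conjugate e" by (auto simp: conjugate_def)
  then have eq: "\<gamma> = (conjugate e, P *v (P' *v snd \<gamma>))" by (simp add: P_inverse prod_eq_iff)
  then have "T e (P' *v snd \<gamma>)" using assms e(1) unfolding T_def by metis
  then show thesis using that eq by blast
qed

lemma T_mult:
  assumes "T e v" "T f w"
  shows "T (\<lambda>k. e k * f k) (scale_by e w + v)"
proof -
  have "(conjugate e, P *v v) \<otimes>\<^bsub>unitary_affine_group\<^esub> (conjugate f, P *v w) \<in> \<Gamma>"
    using assms unfolding T_def by (intro subgroup.m_closed[OF sub]) blast+
  moreover have "(conjugate e, P *v v) \<otimes>\<^bsub>unitary_affine_group\<^esub> (conjugate f, P *v w) =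
      (conjugate (\<lambda>k. e k * f k), P *v (scale_by e w + v))"
    by (simp add: conjugate_mult conjugate_act matrix_vector_right_distrib)
  ultimately show ?thesis using assms sign_vec_mult[of e f] by (simp add: T_def)
qed

lemma T_inv:
  assumes "T e v"
  shows "T e (- scale_by e v)"
proof -
  have e: "sign_vec e" and \<gamma>: "(conjugate e, P *v v) \<in> \<Gamma>" using assms by (simp_all add: T_def)
  obtain B u where B: "(B, u) \<in> \<Gamma>"
    "(B, u) \<otimes>\<^bsub>unitary_affine_group\<^esub> (conjugate e, P *v v) = \<one>\<^bsub>unitary_affine_group\<^esub>"
    using affine_inverse[OF sub \<gamma>] by (metis surj_pair)
  have sq: "conjugate e ** conjugate e = mat 1" by (simp add: conjugate_mult sign_vec_square[OF e] conjugate_1)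
  have "B ** conjugate e = mat 1" using B(2) by simp
  then have "B ** (conjugate e ** conjugate e) = conjugate e" by (simp add: matrix_mul_assoc)
  then have Be: "B = conjugate e" by (simp add: sq)
  moreover have "u = P *v (- scale_by e v)"
    using B(2) unfolding Be by (simp add: conjugate_act matrix_vector_minus eq_neg_iff_add_eq_0 add.commute)
  ultimately show ?thesis using B(1) e by (simp add: T_def)
qed

text \<open>The vector assumed to vanish is the translational part of the square, whose linear part
  is trivial.\<close>

lemma T_free:
  assumes "T e v" "scale_by e v + v = 0"
  shows "e = (\<lambda>_. 1)"
proof (rule ccontr)
  assume "e \<noteq> (\<lambda>_. 1)"
  then have "conjugate e \<noteq> mat 1" using conjugate_eq_iff conjugate_1 by metis
  then have "(conjugate e, P *v v) \<noteq> \<one>\<^bsub>unitary_affine_group\<^esub>" by simp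
  moreover have "(conjugate e, P *v v) \<in> \<Gamma>" using assms(1) by (simp add: T_def)
  ultimately have "(conjugate e, P *v v) [^]\<^bsub>unitary_affine_group\<^esub> (2::nat) \<noteq> \<one>\<^bsub>unitary_affine_group\<^esub>"
    using flat unfolding flat_kaehler_group_def by (metis zero_less_numeral)
  moreover have "(conjugate e, P *v v) [^]\<^bsub>unitary_affine_group\<^esub> (2::nat) = \<one>\<^bsub>unitary_affine_group\<^esub>"
    using assms by (simp add: numeral_2_eq_2 nat_pow_def conjugate_mult sign_vec_square T_def conjugate_1
        conjugate_act flip: matrix_vector_right_distrib)
  ultimately show False by blast
qed

lemma T_gap: "\<exists>r>0. \<forall>v. T (\<lambda>_. 1) v \<and> norm v < r \<longrightarrow> v = 0"
proof -
  have "discrete \<Gamma>" using flat by (simp add: flat_kaehler_group_def)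
  then obtain e where e: "e > 0"
    "\<And>A v w. (A, v) \<in> \<Gamma> \<Longrightarrow> (A, w) \<in> \<Gamma> \<Longrightarrow> norm (v - w) < e \<Longrightarrow> v = w"
    using translation_gap[OF sub] by blast
  obtain C where C: "C > 0" "\<And>v. norm (P *v v) \<le> norm v * C"
    using bounded_linear.pos_bounded[OF bounded_linear_matrix[of P]] by blast
  have "v = 0" if v: "T (\<lambda>_. 1) v" "norm v < e / C" for v
  proof -
    have "norm (P *v v) < e" using C(2)[of v] v(2) C(1) by (simp add: field_simps)
    moreover have "(mat 1, P *v v) \<in> \<Gamma>" using v(1) by (simp add: T_def conjugate_1)
    moreover have "(mat 1, 0) \<in> \<Gamma>" using subgroup.one_closed[OF sub] by simp
    ultimately have "P *v v = 0" using e(2)[of "mat 1" "P *v v" 0] by simp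
    then show "v = 0" by (metis P_inverse(2) matrix_vector_mult_0_right)
  qed
  then show ?thesis using e(1) C(1) by (intro exI[of _ "e / C"]) simp
qed

lemma T_cocompact: "\<exists>R. \<forall>z. \<exists>e v. T e v \<and> norm (scale_by e z + v) \<le> R"
proof -
  obtain R where R: "\<And>z. \<exists>\<gamma>\<in>\<Gamma>. norm (affine_act \<gamma> z) \<le> R"
    using flat_cocompact[OF sub] flat unfolding flat_kaehler_group_def by blast
  obtain C where C: "C > 0" "\<And>v. norm (P' *v v) \<le> norm v * C"
    using bounded_linear.pos_bounded[OF bounded_linear_matrix[of P']] by blast
  have "\<exists>e v. T e v \<and> norm (scale_by e z + v) \<le> R * C" for z
  proof -
    obtain \<gamma> where \<gamma>: "\<gamma> \<in> \<Gamma>" "norm (affine_act \<gamma> (P *v z)) \<le> R" using R by blast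
    obtain e v where ev: "T e v" "\<gamma> = (conjugate e, P *v v)" using \<gamma>(1) by (rule \<Gamma>_cases)
    have "affine_act \<gamma> (P *v z) = P *v (scale_by e z + v)"
      by (simp add: ev(2) conjugate_act matrix_vector_right_distrib)
    then have "norm (scale_by e z + v) \<le> norm (affine_act \<gamma> (P *v z)) * C"
      using C(2)[of "affine_act \<gamma> (P *v z)"] by (simp add: P_inverse)
    also have "\<dots> \<le> R * C" using \<gamma>(2) C(1) by (intro mult_right_mono) auto
    finally show ?thesis using ev(1) by blast
  qed
  then show ?thesis by blast
qed

lemma T_ex: "sign_vec e \<Longrightarrow> \<exists>v. T e v"
proof -
  assume e: "sign_vec e"
  then have "conjugate e \<in> fst ` \<Gamma>" unfolding linear_parts conjugate_def by blast
  then obtain u where "(conjugate e, u) \<in> \<Gamma>" by force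
  then have "T e (P' *v u)" using e by (simp add: T_def P_inverse)
  then show ?thesis by blast
qed

lemma orbit_T: "(\<exists>\<gamma>\<in>\<Gamma>. affine_act \<gamma> z = w) \<longleftrightarrow> (\<exists>e v. T e v \<and> scale_by e (P' *v z) + v = P' *v w)"
proof
  assume "\<exists>\<gamma>\<in>\<Gamma>. affine_act \<gamma> z = w"
  then obtain \<gamma> where \<gamma>: "\<gamma> \<in> \<Gamma>" "affine_act \<gamma> z = w" by blast
  obtain e v where ev: "T e v" "\<gamma> = (conjugate e, P *v v)" using \<gamma>(1) by (rule \<Gamma>_cases)
  have "w = conjugate e *v (P *v (P' *v z)) + P *v v" using \<gamma>(2) ev(2) by (simp add: P_inverse)
  then have "w = P *v (scale_by e (P' *v z) + v)"
    by (simp only: conjugate_act matrix_vector_right_distrib)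
  then show "\<exists>e v. T e v \<and> scale_by e (P' *v z) + v = P' *v w" using ev(1) P_inverse(2) by metis
next
  assume "\<exists>e v. T e v \<and> scale_by e (P' *v z) + v = P' *v w"
  then obtain e v where ev: "T e v" "scale_by e (P' *v z) + v = P' *v w" by blast
  have "conjugate e *v (P *v (P' *v z)) + P *v v = P *v (scale_by e (P' *v z) + v)"
    by (simp only: conjugate_act matrix_vector_right_distrib)
  then have "affine_act (conjugate e, P *v v) z = w" by (simp add: ev(2) P_inverse)
  then show "\<exists>\<gamma>\<in>\<Gamma>. affine_act \<gamma> z = w" using ev(1) unfolding T_def by blast
qed

end

text \<open>The isomorphism makes the holonomy a finite group of commuting involutions, hence
  diagonalizable at once; determinant one places it among the conjugated sign matrices, and equal
  cardinality makes the inclusion an equality.\<close>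

lemma holonomy_diagonalization:
  fixes \<Gamma> :: "((complex ^ 'n ^ 'n::finite) \<times> (complex ^ 'n)) set"
  assumes odd: "odd CARD('n)" and sub: "subgroup \<Gamma> unitary_affine_group"
    and iso: "holonomy_group \<Gamma> \<cong> product_group {..<CARD('n) - 1} (\<lambda>_. integer_mod_group 2)"
    and det: "\<forall>A \<in> carrier (holonomy_group \<Gamma>). det A = 1"
  obtains P P' :: "complex ^ 'n ^ 'n" where "P ** P' = mat 1" "P' ** P = mat 1"
    "fst ` \<Gamma> = {P ** diag_mat e ** P' | e. sign_vec e}"
    "finite (fst ` \<Gamma>)" "\<And>A. A \<in> fst ` \<Gamma> \<Longrightarrow> A ** A = mat 1"
proof -
  let ?H = "fst ` \<Gamma>" and ?G = "product_group {..<CARD('n) - 1} (\<lambda>_. integer_mod_group 2)"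
  have carrier: "carrier (holonomy_group \<Gamma>) = ?H" by (simp add: holonomy_group_def)
  have mult: "A \<otimes>\<^bsub>holonomy_group \<Gamma>\<^esub> B = A ** B" for A B
    by (simp add: holonomy_group_def unitary_group_def)
  obtain \<phi> where \<phi>: "\<phi> \<in> hom (holonomy_group \<Gamma>) ?G" "bij_betw \<phi> ?H (carrier ?G)"
    using iso unfolding is_iso_def iso_def carrier by blast
  have \<phi>_mult: "\<phi> (A ** B) = \<phi> A \<otimes>\<^bsub>?G\<^esub> \<phi> B" if "A \<in> ?H" "B \<in> ?H" for A B
    using hom_mult[OF \<phi>(1), of A B] that unfolding carrier mult by blast
  have \<phi>_mem: "\<phi> A \<in> carrier ?G" if "A \<in> ?H" for A
    using bij_betwE[OF \<phi>(2)] that by blast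
  have \<phi>_inj: "A = B" if "A \<in> ?H" "B \<in> ?H" "\<phi> A = \<phi> B" for A B
    using inj_onD[OF bij_betw_imp_inj_on[OF \<phi>(2)] that(3,1,2)] .
  have closed: "A ** B \<in> ?H" if A: "A \<in> ?H" and B: "B \<in> ?H" for A B
  proof -
    obtain v w where "(A, v) \<in> \<Gamma>" "(B, w) \<in> \<Gamma>" using A B by auto
    then have "(A, v) \<otimes>\<^bsub>unitary_affine_group\<^esub> (B, w) \<in> \<Gamma>" by (rule subgroup.m_closed[OF sub])
    then show ?thesis by force
  qed
  have one: "mat 1 \<in> ?H" using subgroup.one_closed[OF sub] by force
  have G_square: "x \<otimes>\<^bsub>?G\<^esub> x = \<one>\<^bsub>?G\<^esub>" for x
    by (auto simp: fun_eq_iff mult_integer_mod_group one_integer_mod_group)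
  have G_comm: "x \<otimes>\<^bsub>?G\<^esub> y = y \<otimes>\<^bsub>?G\<^esub> x" for x y
    by (auto simp: fun_eq_iff mult_integer_mod_group add.commute)
  have sq: "A ** A = mat 1" if A: "A \<in> ?H" for A
  proof (rule \<phi>_inj[OF closed[OF A A] one])
    have "\<phi> (mat 1) = \<one>\<^bsub>?G\<^esub>" using \<phi>_mult[OF one one] unfolding G_square by simp
    then show "\<phi> (A ** A) = \<phi> (mat 1)" unfolding \<phi>_mult[OF A A] G_square by simp
  qed
  have comm: "A ** B = B ** A" if A: "A \<in> ?H" and B: "B \<in> ?H" for A B
  proof (rule \<phi>_inj[OF closed[OF A B] closed[OF B A]])
    show "\<phi> (A ** B) = \<phi> (B ** A)" unfolding \<phi>_mult[OF A B] \<phi>_mult[OF B A] by (rule G_comm)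
  qed
  let ?S = "{diag_mat e :: complex ^ 'n ^ 'n | e. sign_vec e}"
  have S: "?S = diag_mat ` {e. sign_vec e}" by auto
  have S_card: "card ?S = card {e :: 'n \<Rightarrow> complex. sign_vec e}"
    unfolding S by (rule card_image) (simp add: inj_on_def diag_mat_eq_iff)
  \<comment> \<open>Both groups are isomorphic to the same product, so they have the same number of
    elements without that number being computed.\<close>
  have iso': "unitary_group\<lparr>carrier := ?S\<rparr> \<cong> ?G" by (rule sign_group_iso)
  have card: "card ?H = card {e :: 'n \<Rightarrow> complex. sign_vec e}"
    using iso_same_card[OF iso] iso_same_card[OF iso'] S_card unfolding carrier by simp
  have fin: "finite ?H"
    using iso_finite[OF iso] iso_finite[OF iso'] finite_sign_vecs[OF odd] unfolding carrier S by simp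
  obtain P P' :: "complex ^ 'n ^ 'n" where P: "P ** P' = mat 1" "P' ** P = mat 1"
    and diag: "\<And>A. A \<in> ?H \<Longrightarrow> \<exists>e. (\<forall>k. e k = 1 \<or> e k = -1) \<and> A = P ** diag_mat e ** P'"
    using simultaneous_diagonalization[OF fin sq comm] by blast
  let ?c = "\<lambda>e. P ** diag_mat e ** P'"
  have "?H \<subseteq> ?c ` {e. sign_vec e}"
  proof
    fix A assume A: "A \<in> ?H"
    obtain e where e: "\<forall>k. e k = 1 \<or> e k = -1" "A = ?c e" using diag[OF A] by blast
    have "det P * det P' = 1" using P(1) by (metis det_I det_mul)
    then have "det A = det (diag_mat e)" by (simp add: e(2) det_mul algebra_simps)
    then have "prod e UNIV = 1" using bspec[OF det, of A] A by (simp add: carrier det_diag_mat)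
    then show "A \<in> ?c ` {e. sign_vec e}" using e by (auto simp: sign_vec_def)
  qed
  moreover have "card (?c ` {e. sign_vec e}) = card {e :: 'n \<Rightarrow> complex. sign_vec e}"
  proof (rule card_image, rule inj_onI)
    fix e f assume "?c e = ?c f"
    then have "P' ** ?c e ** P = P' ** ?c f ** P" by simp
    moreover have "P' ** ?c e ** P = (P' ** P) ** diag_mat e ** (P' ** P)" for e
      by (simp add: matrix_mul_assoc)
    ultimately show "e = f" by (simp add: P diag_mat_eq_iff)
  qed
  ultimately have "?H = ?c ` {e. sign_vec e}"
    using finite_sign_vecs[OF odd] card by (intro card_subset_eq) auto
  then have "?H = {?c e | e. sign_vec e}" by auto
  then show thesis using that P fin sq by blast
qed

section \<open>The classification\<close>

lemma chw_manifold_imp_data: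
  fixes M :: "('a, 'n::{finite,linorder}) charted_space"
  assumes odd: "odd CARD('n)" and dim: "CARD('n) \<noteq> 1"
    and M: "complex_manifold M" and chw: "chw_manifold M"
  shows "\<exists>\<Lambda> t W x.
       (\<forall>i. is_lattice (\<Lambda> i)) \<and>
       (\<forall>i. nonzero_2_torsion (elliptic_curve (\<Lambda> i)) (t i)) \<and>
       subgroup W (curve_sum \<Lambda>) \<and>
       W \<subseteq> generate (curve_sum \<Lambda>) (range (\<lambda>i. axis_point \<Lambda> i (t i))) \<and>
       (\<forall>i. axis_point \<Lambda> i (t i) \<notin> W) \<and>
       (\<forall>i. x i \<in> carrier (curve_sum \<Lambda>)) \<and>
       (\<forall>i. nonzero_2_torsion (elliptic_curve (\<Lambda> i)) (x i i) \<and> x i i \<noteq> t i) \<and>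
       (\<forall>i j. i \<noteq> j \<longrightarrow> x_pair \<Lambda> x i j \<in> W) \<and>
       (\<forall>I. I \<subset> UNIV \<and> odd (card I) \<longrightarrow> (\<forall>y\<in>W. \<exists>j\<in>I. x_set \<Lambda> x I j \<noteq> y j)) \<and>
       (\<forall>j. x (Max UNIV) j = x_set \<Lambda> x {i. i < Max UNIV} j) \<and>
       biholomorphic M (curve_sum_quotient \<Lambda> x W)"
proof -
  obtain \<Gamma> :: "(((complex, 'n) vec, 'n) vec \<times> (complex, 'n) vec) set"
    where flat: "flat_kaehler_group \<Gamma>"
      and iso: "holonomy_group \<Gamma> \<cong> product_group {..<CARD('n) - 1} (\<lambda>_. integer_mod_group 2)"
      and det: "\<forall>A \<in> carrier (holonomy_group \<Gamma>). det A = 1"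
      and bih: "biholomorphic M (flat_quotient \<Gamma>)"
    using chw unfolding chw_manifold_def by blast
  have sub: "subgroup \<Gamma> unitary_affine_group" using flat by (simp add: flat_kaehler_group_def)
  obtain P P' :: "((complex, 'n) vec, 'n) vec" where P: "P ** P' = mat 1" "P' ** P = mat 1"
    and lin: "fst ` \<Gamma> = {P ** diag_mat e ** P' | e. sign_vec e}"
    and fin: "finite (fst ` \<Gamma>)" and sq: "\<And>A. A \<in> fst ` \<Gamma> \<Longrightarrow> A ** A = mat 1"
    using that by (rule holonomy_diagonalization[OF odd sub iso det])
  interpret D: diagonalized_group \<Gamma> P P'
    using flat P lin by (rule diagonalized_group.intro)
  interpret S: sign_crystal D.T
  proof
    show "D.T e v \<Longrightarrow> sign_vec e" for e v by (simp add: D.T_def)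
  qed (fact odd dim D.T_ex D.T_mult D.T_inv D.T_free D.T_gap D.T_cocompact)+
  obtain t b W where data: "chw_data S.\<Lambda> b W"
    and conds: "\<forall>i. nonzero_2_torsion (elliptic_curve (S.\<Lambda> i)) (t i)"
      "W \<subseteq> generate (curve_sum S.\<Lambda>) (range (\<lambda>i. axis_point S.\<Lambda> i (t i)))"
      "\<forall>i. axis_point S.\<Lambda> i (t i) \<notin> W"
      "\<forall>i. nonzero_2_torsion (elliptic_curve (S.\<Lambda> i)) (proj S.\<Lambda> (b i) i) \<and> proj S.\<Lambda> (b i) i \<noteq> t i"
      "\<forall>I. I \<subset> UNIV \<and> odd (card I) \<longrightarrow>
        (\<forall>y\<in>W. \<exists>j\<in>I. x_set S.\<Lambda> (\<lambda>i. proj S.\<Lambda> (b i)) I j \<noteq> y j)"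
      "\<forall>j. proj S.\<Lambda> (b (Max UNIV)) j = x_set S.\<Lambda> (\<lambda>i. proj S.\<Lambda> (b i)) {i. i < Max UNIV} j"
    and rel: "\<forall>z w. twisted_lattice.rel b (chw_data.L S.\<Lambda> W) z w \<longleftrightarrow>
        (\<exists>e v. D.T e v \<and> scale_by e z + v = w)"
    using S.data_exist by (elim exE conjE) (rule that; assumption)
  interpret C: chw_data S.\<Lambda> b W by (rule data)
  have fibres: "(\<exists>\<gamma>\<in>\<Gamma>. affine_act \<gamma> z = w) \<longleftrightarrow> C.rel (P' *v z) (P' *v w)" for z w
    unfolding D.orbit_T by (rule rel[rule_format, symmetric])
  \<comment> \<open>\<open>P\<close> and \<open>P'\<close> exchange their roles: the data live in
    the diagonalizing coordinates \<open>P' *v z\<close>.\<close>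
  have "biholomorphic M C.N"
    using C.biholomorphic_flat_quotient[OF flat fin _ P(2,1) _ M] sq fibres bih by blast
  moreover have "\<forall>i j. i \<noteq> j \<longrightarrow> x_pair S.\<Lambda> (\<lambda>i. proj S.\<Lambda> (b i)) i j \<in> W"
    by (intro allI impI C.pair)
  moreover have "\<forall>i. proj S.\<Lambda> (b i) \<in> carrier (curve_sum S.\<Lambda>)" by simp
  moreover have "\<forall>i. is_lattice (S.\<Lambda> i)" by (intro allI S.lattice)
  ultimately show ?thesis
    using conds C.W
    by (intro exI[of _ S.\<Lambda>] exI[of _ t] exI[of _ W] exI[of _ "\<lambda>i. proj S.\<Lambda> (b i)"] conjI)
qed

text \<open>Supplies \<open>W_torsion\<close>: each generator has a lift with a half period on a
  single axis, and half periods are closed under sums and negation.\<close>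

lemma (in torus) generate_axis_points_torsion:
  assumes t: "\<And>i. nonzero_2_torsion (elliptic_curve (\<Lambda> i)) (t i)"
    and w: "w \<in> generate (curve_sum \<Lambda>) (range (\<lambda>i. axis_point \<Lambda> i (t i)))"
  shows "\<exists>l. w = proj \<Lambda> l \<and> (\<forall>k. 2 * l $ k \<in> \<Lambda> k)"
proof -
  have axis: "\<exists>l. axis_point \<Lambda> i (t i) = proj \<Lambda> l \<and> (\<forall>k. 2 * l $ k \<in> \<Lambda> k)" for i
  proof -
    have "t i \<in> range (cls (\<Lambda> i))"
      using t[of i] by (simp add: nonzero_2_torsion_def flip: C.carrier_curve)
    then obtain c where c: "t i = cls (\<Lambda> i) c" by blast
    then have "2 * c \<in> \<Lambda> i" using t[of i] by (simp add: C.nonzero_2_torsion_cls)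
    moreover have "axis_point \<Lambda> i (t i) = proj \<Lambda> (\<chi> k. if k = i then c else 0)"
      by (auto simp: axis_point_def proj_def fun_eq_iff C.one_curve c)
    ultimately show ?thesis using C.zero by (intro exI[of _ "\<chi> k. if k = i then c else 0"]) simp
  qed
  show ?thesis using w
  proof (induction rule: generate.induct)
    case one
    then show ?case using C.zero by (intro exI[of _ 0]) (simp add: one_curve_sum)
  next
    case (incl h)
    then show ?case using axis by blast
  next
    case (inv h)
    then obtain l where l: "h = proj \<Lambda> l" "\<forall>k. 2 * l $ k \<in> \<Lambda> k" using axis by blast
    have "2 * (- l) $ k \<in> \<Lambda> k" for k using C.neg[OF l(2)[rule_format, of k]] by simp
    then show ?case using l(1) by (intro exI[of _ "- l"]) simp
  next
    case (eng h1 h2)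
    then obtain l m where l: "h1 = proj \<Lambda> l" "\<forall>k. 2 * l $ k \<in> \<Lambda> k"
      and m: "h2 = proj \<Lambda> m" "\<forall>k. 2 * m $ k \<in> \<Lambda> k" by blast
    have "2 * (l + m) $ k \<in> \<Lambda> k" for k
      using C.add[OF l(2)[rule_format, of k] m(2)[rule_format, of k]] by (simp add: algebra_simps)
    then show ?case using l(1) m(1) by (intro exI[of _ "l + m"]) simp
  qed
qed

lemma data_imp_chw_manifold:
  fixes M :: "('a, 'n::{finite,linorder}) charted_space"
  assumes odd: "odd CARD('n)" and M: "complex_manifold M"
    and lattice: "\<forall>i. is_lattice (\<Lambda> i)"
    and t: "\<forall>i. nonzero_2_torsion (elliptic_curve (\<Lambda> i)) (t i)"
    and W: "subgroup W (curve_sum \<Lambda>)"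
      "W \<subseteq> generate (curve_sum \<Lambda>) (range (\<lambda>i. axis_point \<Lambda> i (t i)))"
    and x: "\<forall>i. x i \<in> carrier (curve_sum \<Lambda>)"
      "\<forall>i. nonzero_2_torsion (elliptic_curve (\<Lambda> i)) (x i i) \<and> x i i \<noteq> t i"
    and pair: "\<forall>i j. i \<noteq> j \<longrightarrow> x_pair \<Lambda> x i j \<in> W"
    and generic: "\<forall>I. I \<subset> UNIV \<and> odd (card I) \<longrightarrow> (\<forall>y\<in>W. \<exists>j\<in>I. x_set \<Lambda> x I j \<noteq> y j)"
    and last: "\<forall>j. x (Max UNIV) j = x_set \<Lambda> x {i. i < Max UNIV} j"
    and bih: "biholomorphic M (curve_sum_quotient \<Lambda> x W)"
  shows "chw_manifold M"
proof -
  interpret ordered_torus \<Lambda>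
    by (intro ordered_torus.intro torus.intro) (rule lattice_subgroup[OF spec[OF lattice]])
  have "\<forall>i. \<exists>v. x i = proj \<Lambda> v" using x(1) unfolding carrier_curve_sum by blast
  from choice[OF this] obtain b where "\<And>i. x i = proj \<Lambda> (b i)" by blast
  then have b: "x = (\<lambda>i. proj \<Lambda> (b i))" by blast
  have data: "chw_data \<Lambda> b W"
  proof (intro chw_data.intro chw_data_axioms.intro)
    show "2 * l $ k \<in> \<Lambda> k" if l: "proj \<Lambda> l \<in> W" for l k
    proof -
      obtain m where m: "proj \<Lambda> l = proj \<Lambda> m" "\<And>k. 2 * m $ k \<in> \<Lambda> k"
        using generate_axis_points_torsion[OF spec[OF t] subsetD[OF W(2) l]] by blast
      \<comment> \<open>The lift \<open>l\<close> is arbitrary; it differs from the half period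
        vector \<open>m\<close> by periods, so \<open>2 * l\<close> differs from
        \<open>2 * m\<close> by periods too.\<close>
      have d: "l $ k - m $ k \<in> \<Lambda> k" using m(1) by (simp add: proj_eq_iff)
      show ?thesis using C.add[OF C.add[OF d d] m(2)[of k]] by (simp add: algebra_simps)
    qed
    show "2 * b i $ i \<in> \<Lambda> i" for i
      using spec[OF x(2), of i] by (simp add: b proj_def C.nonzero_2_torsion_cls)
  qed (use ordered_torus_axioms W pair in \<open>auto simp: b\<close>)
  interpret chw_full \<Lambda> b W
  proof (intro chw_full.intro chw_full_axioms.intro)
    show "\<exists>j\<in>I. x_set \<Lambda> (\<lambda>i. proj \<Lambda> (b i)) I j \<noteq> y j"
      if "odd (card I)" "I \<noteq> UNIV" "y \<in> W" for I y
      using generic that unfolding b by blast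
    show "proj \<Lambda> (b (Max UNIV)) j = x_set \<Lambda> (\<lambda>i. proj \<Lambda> (b i)) {i. i < Max UNIV} j" for j
      using spec[OF last, of j] unfolding b .
  qed (fact data odd | rule spec[OF lattice])+
  show ?thesis using M bih unfolding b by (rule chw_manifold_if)
qed

theorem theorem1:
  fixes M :: "('a, 'n::{finite,linorder}) charted_space"
  assumes "odd CARD('n)" and "CARD('n) \<noteq> 1"
    and "complex_manifold M"
  shows "chw_manifold M \<longleftrightarrow>
    (\<exists>(\<Lambda> :: 'n \<Rightarrow> complex set) (t :: 'n \<Rightarrow> complex set) (W :: ('n \<Rightarrow> complex set) set)
      (x :: 'n \<Rightarrow> 'n \<Rightarrow> complex set).
       (\<forall>i. is_lattice (\<Lambda> i)) \<and>
       (\<forall>i. nonzero_2_torsion (elliptic_curve (\<Lambda> i)) (t i)) \<and>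
       subgroup W (curve_sum \<Lambda>) \<and>
       W \<subseteq> generate (curve_sum \<Lambda>) (range (\<lambda>i. axis_point \<Lambda> i (t i))) \<and>
       (\<forall>i. axis_point \<Lambda> i (t i) \<notin> W) \<and>
       (\<forall>i. x i \<in> carrier (curve_sum \<Lambda>)) \<and>
       (\<forall>i. nonzero_2_torsion (elliptic_curve (\<Lambda> i)) (x i i) \<and> x i i \<noteq> t i) \<and>
       (\<forall>i j. i \<noteq> j \<longrightarrow> x_pair \<Lambda> x i j \<in> W) \<and>
       (\<forall>I. I \<subset> UNIV \<and> odd (card I) \<longrightarrow> (\<forall>y\<in>W. \<exists>j\<in>I. x_set \<Lambda> x I j \<noteq> y j)) \<and>
       (\<forall>j. x (Max UNIV) j = x_set \<Lambda> x {i. i < Max UNIV} j) \<and>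
       biholomorphic M (curve_sum_quotient \<Lambda> x W))"
proof (rule iffI, goal_cases)
  case 1
  then show ?case by (rule chw_manifold_imp_data[OF assms])
next
  case 2
  then show ?case by (elim exE conjE) (rule data_imp_chw_manifold[OF assms(1,3)])
qed

end
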